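(* Let $K$ be a unital commutative ring, let $(A,d,\pi_n,* )$ be an involutive $A_\infty$-algebra over $K$, and let $\varrho\in\{1,-1\}$. Then the five-tuple $({}^{\varrho}\mathcal{M}(A),t,r,d,\widetilde{\partial})$ is a dihedral module with $\infty$-simplicial faces, where $${}^{\varrho}\mathcal{M}(A)_{n,m}=(A^{\otimes(n+1)})_m,\quad n\geqslant0,\ m\geqslant0,$$ $$t_n(a_0\otimes\dots\otimes a_n)=(-1)^{|a_n|(|a_0|+\dots+|a_{n-1}|)}a_n\otimes a_0\otimes a_1\otimes\dots\otimes a_{n-1},$$ $$r_n(a_0\otimes\dots\otimes a_n)=\varrho(-1)^{\sum_{0<i<j\leqslant n}|a_i||a_j|}a_0^*\otimes a_n^*\otimes a_{n-1}^*\otimes\dots\otimes a_1^*,$$ $$d(a_0\otimes\dots\otimes a_n)=\sum_{i=0}^n(-1)^{|a_0|+\dots+|a_{i-1}|}a_0\otimes\dots\otimes a_{i-1}\otimes d(a_i)\otimes a_{i+1}\otimes\dots\otimes a_n,$$ and the maps $\partial_{(i_1,\dots,i_k)}:{}^{\varrho}\mathcal{M}(A)_{n,p}\to{}^{\varrho}\mathcal{M}(A)_{n-k,p+k-1}$, $1\leqslant k\leqslant n$, $0\leqslant i_1<\dots<i_k\leqslant n$, of the family $\widetilde\partial$ are given by $$\partial_{(i_1,\dots,i_k)}=\begin{cases}(-1)^{k(p-1)}1^{\otimes j}\otimes\pi_{k-1}\otimes1^{\otimes(n-k-j)},&\text{if } 0\leqslant j\leqslant n-k\text{ and }(i_1,\dots,i_k)=(j,j+1,\dots,j+k-1),\\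 (-1)^{q(k-1)}\partial_{(0,1,\dots,k-1)}t_n^q,&\text{if }1\leqslant q\leqslant k\text{ and }(i_1,\dots,i_k)=(0,1,\dots,k-q-1,n-q+1,n-q+2,\dots,n),\\ 0,&\text{otherwise.}\end{cases}$$
   Context: All modules and maps are $K$-modules and $K$-linear maps; $|a|=q$ means $a\in A_q$; tensor products of maps are evaluated with the Koszul sign $(f\otimes g)(x\otimes y)=(-1)^{|g||x|}f(x)\otimes g(y)$. **$A_\infty$-algebras.** An $A_\infty$-algebra $(A,d,\pi_n)$ is a differential module $A=\{A_n\}_{n\geqslant0}$, $d:A_\bullet\to A_{\bullet-1}$, with maps $\pi_n:(A^{\otimes(n+2)})_\bullet\to A_{\bullet+n}$, $n\geqslant0$, such that for all $n\geqslant1$ $$d(\pi_{n-1})=\sum_{m=1}^{n-1}\sum_{t=1}^{m+1}(-1)^{t(n-m)+n+1}\pi_{m-1}(\underbrace{1\otimes\dots\otimes1}_{t-1}\otimes\pi_{n-m-1}\otimes\underbrace{1\otimes\dots\otimes1}_{m-t+1}),$$ where $d(\pi_{n-1})=d\pi_{n-1}+(-1)^n\pi_{n-1}d$. An involutive $A_\infty$-algebra $(A,d,\pi_n,* )$ is an $A_\infty$-algebra with an automorphism of graded modules $*:A_\bullet\to A_\bullet$, $a\mapsto a^*$, such that $a^{**}=a$, $d(a^* )=d(a)^*$ and, for $n\geqslant0$, $$\pi_n(a_0\otimes\dots\otimes a_{n+1})^*=(-1)^{\varepsilon}\pi_n(a_{n+1}^*\otimes a_n^*\otimes\dots\otimes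 a_0^* ),\quad\varepsilon=\frac{n(n+1)}2+\sum_{0\leqslant i<j\leqslant n+1}|a_i||a_j|.$$ **Differential modules with $\infty$-simplicial faces.** Such an object $(X,d,\widetilde{\partial})$ is a bigraded module $X=\{X_{n,m}\}$, $n,m\geqslant 0$, with a differential $d:X_{*,\bullet}\to X_{*,\bullet-1}$ of bidegree $(0,-1)$ and a family of maps $\widetilde{\partial}=\{\partial_{(i_1,\dots,i_k)}:X_{n,\bullet}\to X_{n-k,\bullet+k-1}\}$, $1\leqslant k\leqslant n$, $0\leqslant i_1<\dots<i_k\leqslant n$ (integers), such that $$d(\partial_{(i_1,\dots,i_k)})=\sum_{\sigma\in\Sigma_k}\sum_{I_\sigma}(-1)^{\mathrm{sign}(\sigma)+1}\partial_{(\widehat{\sigma(i_1)},\dots,\widehat{\sigma(i_m)})}\,\partial_{(\widehat{\sigma(i_{m+1})},\dots,\widehat{\sigma(i_k)})},$$ where $d(\partial_{(i_1,\dots,i_k)})=d\,\partial_{(i_1,\dots,i_k)}+\partial_{(i_1,\dots,i_k)}\,d$. Here $\Sigma_k$ is the symmetric group, $\mathrm{sign}(\sigma)\in\{0,1\}$ is the parity of $\sigma$, $(\sigma(i_1),\dots,\sigma(i_k))$ is the tuple $(i_1,\dots,i_k)$ with components permuted by $\sigma$, $\widehat{\sigma(i_s)}=\sigma(i_s)-\alpha(\sigma(i_s))$ with $\alpha(\sigma(i_s))$ the number of entries of $(\sigma(i_1),\dots,\sigma(i_k))$ to the right of $\sigma(i_s)$ that are smaller than $\sigma(i_s)$, and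 $I_\sigma$ is the set of all partitions of $(\widehat{\sigma(i_1)},\dots,\widehat{\sigma(i_k)})$ into two consecutive tuples $(\widehat{\sigma(i_1)},\dots,\widehat{\sigma(i_m)})$, $(\widehat{\sigma(i_{m+1})},\dots,\widehat{\sigma(i_k)})$, $1\leqslant m\leqslant k-1$, both strictly increasing. **Dihedral module with $\infty$-simplicial faces** $(X,t,r,d,\widetilde{\partial})$: $(X,d,\widetilde{\partial})$ is a differential module with $\infty$-simplicial faces, and $t=\{t_n:X_{n,\bullet}\to X_{n,\bullet}\}$, $r=\{r_n:X_{n,\bullet}\to X_{n,\bullet}\}$, $n\geqslant0$, are families of maps with $t_n^{n+1}=1$, $r_n^2=1$, $r_nt_n=t_n^{-1}r_n$, $dt_n=t_nd$, $dr_n=r_nd$, and $$\partial_{(i_1,\dots,i_k)}t_n=\begin{cases}t_{n-k}\partial_{(i_1-1,\dots,i_k-1)},& i_1>0,\\ (-1)^{k-1}\partial_{(i_2-1,\dots,i_k-1,n)},& i_1=0,\end{cases}$$ $$\partial_{(i_1,\dots,i_k)}r_n=(-1)^{k(k-1)/2}r_{n-k}\partial_{(n-i_k,\dots,n-i_1)}.$$ *)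

theory Defs
  imports "HOL-Combinatorics.Permutations" "HOL-Algebra.Module" "HOL-Algebra.AbelCoset"
begin

section \<open>Modules and signs\<close>

definition lin_maps :: "('k, 'e) ring_scheme \<Rightarrow> ('k, 'a, 'c) module_scheme \<Rightarrow>
    ('k, 'b, 'f) module_scheme \<Rightarrow> ('a \<Rightarrow> 'b) set"
  where "lin_maps K M N = {h \<in> carrier M \<rightarrow> carrier N.
    (\<forall>x\<in>carrier M. \<forall>y\<in>carrier M. h (x \<oplus>\<^bsub>M\<^esub> y) = h x \<oplus>\<^bsub>N\<^esub> h y) \<and>
    (\<forall>c\<in>carrier K. \<forall>x\<in>carrier M. h (c \<odot>\<^bsub>M\<^esub> x) = c \<odot>\<^bsub>N\<^esub> h x)}"

text \<open>\<open>pm M e x\<close> is $(-1)^e x$ in the module \<open>M\<close>. The exponent is an integer, since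
  exponents such as $k(p-1)$ may be negative.\<close>

definition pm :: "('a, 'c) ring_scheme \<Rightarrow> int \<Rightarrow> 'a \<Rightarrow> 'a"
  where "pm M e x = (if even e then x else \<ominus>\<^bsub>M\<^esub> x)"

text \<open>The free \<open>K\<close>-module on a set \<open>S\<close>: finitely supported functions. The record fields
  \<open>mult\<close> and \<open>one\<close> are irrelevant for modules.\<close>

definition free_mod :: "('k, 'e) ring_scheme \<Rightarrow> 'g set \<Rightarrow> ('k, 'g \<Rightarrow> 'k) module"
  where "free_mod K S = \<lparr>
    carrier = {f. finite {x. f x \<noteq> \<zero>\<^bsub>K\<^esub>} \<and> (\<forall>x\<in>S. f x \<in> carrier K) \<and> (\<forall>x. x \<notin> S \<longrightarrow> f x = \<zero>\<^bsub>K\<^esub>)},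
    mult = undefined, one = undefined,
    zero = (\<lambda>_. \<zero>\<^bsub>K\<^esub>), add = (\<lambda>f g x. f x \<oplus>\<^bsub>K\<^esub> g x), smult = (\<lambda>c f x. c \<otimes>\<^bsub>K\<^esub> f x)\<rparr>"

definition free_gen :: "('k, 'e) ring_scheme \<Rightarrow> 'g \<Rightarrow> 'g \<Rightarrow> 'k"
  where "free_gen K x = (\<lambda>y. if y = x then \<one>\<^bsub>K\<^esub> else \<zero>\<^bsub>K\<^esub>)"

definition submod_span :: "('k, 'e) ring_scheme \<Rightarrow> ('k, 'a) module \<Rightarrow> 'a set \<Rightarrow> 'a set"
  where "submod_span K M S = \<Inter>{H. submodule H K M \<and> S \<subseteq> H}"

text \<open>The quotient of \<open>M\<close> by a submodule \<open>H\<close>. The image of a coset under multiplication by \<open>c\<close>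
  need not be a full coset (take $c = 0$), hence the union.\<close>

definition quot_mod :: "('k, 'a) module \<Rightarrow> 'a set \<Rightarrow> ('k, 'a set) module"
  where "quot_mod M H = \<lparr>
    carrier = a_rcosets\<^bsub>M\<^esub> H, mult = undefined, one = undefined,
    zero = H, add = set_add M, smult = (\<lambda>c C. \<Union>x\<in>C. H +>\<^bsub>M\<^esub> (c \<odot>\<^bsub>M\<^esub> x))\<rparr>"


section \<open>Graded modules and their tensor powers\<close>

text \<open>A module graded by $n \geq 0$ is a family indexed by the integers that vanishes in negative
  degrees, so that differentials in degree $0$ need no special treatment.\<close>

locale graded_module =
  fixes K :: "('k, 'e) ring_scheme" and A :: "int \<Rightarrow> ('k, 'a) module"
  assumes graded_module: "module K (A q)"
    and graded_neg: "q < 0 \<Longrightarrow> carrier (A q) = {\<zero>\<^bsub>A q\<^esub>}"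

text \<open>A differential lowers the degree by one; \<open>d q\<close> is its component on degree \<open>q\<close>.\<close>

locale differential_module = graded_module K A
  for K :: "('k, 'e) ring_scheme" and A :: "int \<Rightarrow> ('k, 'a) module" +
  fixes d :: "int \<Rightarrow> 'a \<Rightarrow> 'a"
  assumes diff_lin: "d q \<in> lin_maps K (A q) (A (q - 1))"
    and diff_diff: "x \<in> carrier (A q) \<Longrightarrow> d (q - 1) (d q x) = \<zero>\<^bsub>A (q - 2)\<^esub>"

definition word_deg :: "(int \<times> 'a) list \<Rightarrow> int"
  where "word_deg w = sum_list (map fst w)"

text \<open>Since the modules \<open>A q\<close> need not be disjoint, a homogeneous element is represented by a pair
  \<open>(q, a)\<close> with \<open>a\<close> in \<open>A q\<close>. The following words of length \<open>N\<close> and total degree \<open>m\<close> stand for the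
  pure tensors in $(A^{\otimes N})_m$.\<close>

definition tensor_words :: "(int \<Rightarrow> ('k, 'a) module) \<Rightarrow> nat \<Rightarrow> int \<Rightarrow> (int \<times> 'a) list set"
  where "tensor_words A N m =
    {w. length w = N \<and> (\<forall>(q, a)\<in>set w. a \<in> carrier (A q)) \<and> word_deg w = m}"

definition tensor_free ::
    "('k, 'e) ring_scheme \<Rightarrow> (int \<Rightarrow> ('k, 'a) module) \<Rightarrow> nat \<Rightarrow> int \<Rightarrow> ('k, (int \<times> 'a) list \<Rightarrow> 'k) module"
  where "tensor_free K A N m = free_mod K (tensor_words A N m)"

definition tensor_relators ::
    "('k, 'e) ring_scheme \<Rightarrow> (int \<Rightarrow> ('k, 'a) module) \<Rightarrow> nat \<Rightarrow> int \<Rightarrow> ((int \<times> 'a) list \<Rightarrow> 'k) set"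
  where "tensor_relators K A N m = (let F = tensor_free K A N m in
    {free_gen K (u @ (q, a \<oplus>\<^bsub>A q\<^esub> b) # v)
        \<ominus>\<^bsub>F\<^esub> (free_gen K (u @ (q, a) # v) \<oplus>\<^bsub>F\<^esub> free_gen K (u @ (q, b) # v)) | u q a b v.
      u @ (q, a) # v \<in> tensor_words A N m \<and> u @ (q, b) # v \<in> tensor_words A N m} \<union>
    {free_gen K (u @ (q, c \<odot>\<^bsub>A q\<^esub> a) # v) \<ominus>\<^bsub>F\<^esub> (c \<odot>\<^bsub>F\<^esub> free_gen K (u @ (q, a) # v)) | u q a c v.
      c \<in> carrier K \<and> u @ (q, a) # v \<in> tensor_words A N m})"

text \<open>The degree \<open>m\<close> component of the tensor power $A^{\otimes N}$ over \<open>K\<close>.\<close>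

definition tpow ::
    "('k, 'e) ring_scheme \<Rightarrow> (int \<Rightarrow> ('k, 'a) module) \<Rightarrow> nat \<Rightarrow> int \<Rightarrow> ('k, ((int \<times> 'a) list \<Rightarrow> 'k) set) module"
  where "tpow K A N m = quot_mod (tensor_free K A N m)
    (submod_span K (tensor_free K A N m) (tensor_relators K A N m))"

text \<open>The pure tensor of a word; its length and degree are those of the word.\<close>

definition ptens ::
    "('k, 'e) ring_scheme \<Rightarrow> (int \<Rightarrow> ('k, 'a) module) \<Rightarrow> (int \<times> 'a) list \<Rightarrow> ((int \<times> 'a) list \<Rightarrow> 'k) set"
  where "ptens K A w = (let N = length w; m = word_deg w; F = tensor_free K A N m in
    submod_span K F (tensor_relators K A N m) +>\<^bsub>F\<^esub> free_gen K w)"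

text \<open>The linear map on $(A^{\otimes N})_m$ with prescribed values on pure tensors. It exists and is
  unique for multilinear values, see \<open>tensor_lift\<close> at the end.\<close>

definition tensor_lift ::
    "('k, 'e) ring_scheme \<Rightarrow> (int \<Rightarrow> ('k, 'a) module) \<Rightarrow> nat \<Rightarrow> int \<Rightarrow> ('k, 'b) module \<Rightarrow>
     ((int \<times> 'a) list \<Rightarrow> 'b) \<Rightarrow> ((int \<times> 'a) list \<Rightarrow> 'k) set \<Rightarrow> 'b"
  where "tensor_lift K A N m M g = (THE h.
    h \<in> lin_maps K (tpow K A N m) M \<and> h \<in> extensional (carrier (tpow K A N m)) \<and>
    (\<forall>w\<in>tensor_words A N m. h (ptens K A w) = g w))"

text \<open>The differential of $A^{\otimes N}$ in degree \<open>m\<close>.\<close>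

definition tensor_diff ::
    "('k, 'e) ring_scheme \<Rightarrow> (int \<Rightarrow> ('k, 'a) module) \<Rightarrow> (int \<Rightarrow> 'a \<Rightarrow> 'a) \<Rightarrow> nat \<Rightarrow> int \<Rightarrow>
     ((int \<times> 'a) list \<Rightarrow> 'k) set \<Rightarrow> ((int \<times> 'a) list \<Rightarrow> 'k) set"
  where "tensor_diff K A d N m = tensor_lift K A N m (tpow K A N (m - 1))
    (\<lambda>w. \<Oplus>\<^bsub>tpow K A N (m - 1)\<^esub>i\<in>{..<N}.
       pm (tpow K A N (m - 1)) (word_deg (take i w))
         (ptens K A (w[i := (fst (w ! i) - 1, d (fst (w ! i)) (snd (w ! i)))])))"

text \<open>The map $1^{\otimes j} \otimes f \otimes 1^{\otimes s}$ on $(A^{\otimes (j+l+s)})_m$, for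
  $f : (A^{\otimes l})_\bullet \to A_{\bullet+e}$, evaluated with the Koszul sign.\<close>

definition tensor_insert ::
    "('k, 'e) ring_scheme \<Rightarrow> (int \<Rightarrow> ('k, 'a) module) \<Rightarrow> nat \<Rightarrow> nat \<Rightarrow> nat \<Rightarrow> int \<Rightarrow>
     (int \<Rightarrow> ((int \<times> 'a) list \<Rightarrow> 'k) set \<Rightarrow> 'a) \<Rightarrow> int \<Rightarrow>
     ((int \<times> 'a) list \<Rightarrow> 'k) set \<Rightarrow> ((int \<times> 'a) list \<Rightarrow> 'k) set"
  where "tensor_insert K A j l s e f m =
    tensor_lift K A (j + l + s) m (tpow K A (j + 1 + s) (m + e))
      (\<lambda>w. let u = take j w; y = take l (drop j w); v = drop (j + l) w in
        pm (tpow K A (j + 1 + s) (m + e)) (e * word_deg u)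
          (ptens K A (u @ (word_deg y + e, f (word_deg y) (ptens K A y)) # v)))"

text \<open>$\sum_{i<j} |a_i||a_j|$ over the letters of a word.\<close>

definition deg_pairs :: "(int \<times> 'a) list \<Rightarrow> int"
  where "deg_pairs w = (\<Sum>j<length w. \<Sum>i<j. fst (w ! i) * fst (w ! j))"


section \<open>$A_\infty$-algebras\<close>

text \<open>\<open>\<pi> n p\<close> is the component of $\pi_n$ on $(A^{\otimes(n+2)})_p$.\<close>

locale A_infinity_algebra = differential_module K A d
  for K :: "('k, 'e) ring_scheme" and A :: "int \<Rightarrow> ('k, 'a) module" and d :: "int \<Rightarrow> 'a \<Rightarrow> 'a" +
  fixes \<pi> :: "nat \<Rightarrow> int \<Rightarrow> ((int \<times> 'a) list \<Rightarrow> 'k) set \<Rightarrow> 'a"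
  assumes pi_lin: "\<pi> n p \<in> lin_maps K (tpow K A (n + 2) p) (A (p + int n))"
    and pi_rel: "\<lbrakk>n \<ge> 1; z \<in> carrier (tpow K A (n + 1) p)\<rbrakk> \<Longrightarrow>
      d (p + int n - 1) (\<pi> (n - 1) p z)
        \<oplus>\<^bsub>A (p + int n - 2)\<^esub> pm (A (p + int n - 2)) (int n) (\<pi> (n - 1) (p - 1) (tensor_diff K A d (n + 1) p z))
      = (\<Oplus>\<^bsub>A (p + int n - 2)\<^esub>m\<in>{1..n - 1}. \<Oplus>\<^bsub>A (p + int n - 2)\<^esub>t\<in>{1..m + 1}.
          pm (A (p + int n - 2)) (int t * (int n - int m) + int n + 1)
            (\<pi> (m - 1) (p + int (n - m - 1))
              (tensor_insert K A (t - 1) (n - m + 1) (m + 1 - t) (int (n - m - 1)) (\<pi> (n - m - 1)) p z)))"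

locale involutive_A_infinity_algebra = A_infinity_algebra K A d \<pi>
  for K :: "('k, 'e) ring_scheme" and A :: "int \<Rightarrow> ('k, 'a) module" and d :: "int \<Rightarrow> 'a \<Rightarrow> 'a"
    and \<pi> :: "nat \<Rightarrow> int \<Rightarrow> ((int \<times> 'a) list \<Rightarrow> 'k) set \<Rightarrow> 'a" +
  fixes star :: "int \<Rightarrow> 'a \<Rightarrow> 'a"
  assumes star_lin: "star q \<in> lin_maps K (A q) (A q)"
    and star_bij: "bij_betw (star q) (carrier (A q)) (carrier (A q))"
    and star_star: "a \<in> carrier (A q) \<Longrightarrow> star q (star q a) = a"
    and star_diff: "a \<in> carrier (A q) \<Longrightarrow> d q (star q a) = star (q - 1) (d q a)"
    and star_pi: "w \<in> tensor_words A (n + 2) p \<Longrightarrow>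
      star (p + int n) (\<pi> n p (ptens K A w))
      = pm (A (p + int n)) (int (n * (n + 1) div 2) + deg_pairs w)
          (\<pi> n p (ptens K A (rev (map (\<lambda>(q, a). (q, star q a)) w))))"


section \<open>Modules with $\infty$-simplicial faces\<close>

definition face_index :: "nat \<Rightarrow> nat list \<Rightarrow> bool"
  where "face_index n is \<longleftrightarrow>
    1 \<le> length is \<and> length is \<le> n \<and> sorted_wrt (<) is \<and> (\<forall>i\<in>set is. i \<le> n)"

text \<open>From the tuple with entries $\sigma(i_s)$ to the tuple with entries $\widehat{\sigma(i_s)}$.
  For tuples without repetition the subtraction does not truncate.\<close>

definition hat_tuple :: "nat list \<Rightarrow> nat list"
  where "hat_tuple xs =
    map (\<lambda>s. xs ! s - card {u. s < u \<and> u < length xs \<and> xs ! u < xs ! s}) [0..<length xs]"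

text \<open>The set $I_\sigma$; a partition into two consecutive tuples is given by the length of the
  first one.\<close>

definition hat_splits :: "nat list \<Rightarrow> nat set"
  where "hat_splits ys = {j. 1 \<le> j \<and> j \<le> length ys - 1 \<and>
    sorted_wrt (<) (take j ys) \<and> sorted_wrt (<) (drop j ys)}"

text \<open>\<open>d n m\<close> and \<open>face n m (i\<^sub>1, \<dots>, i\<^sub>k)\<close> are the components on \<open>X n m\<close>.\<close>

locale infinity_simplicial_module =
  fixes K :: "('k, 'e) ring_scheme" and X :: "nat \<Rightarrow> int \<Rightarrow> ('k, 'x) module"
    and d :: "nat \<Rightarrow> int \<Rightarrow> 'x \<Rightarrow> 'x" and face :: "nat \<Rightarrow> int \<Rightarrow> nat list \<Rightarrow> 'x \<Rightarrow> 'x"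
  assumes diff: "differential_module K (X n) (d n)"
    and face_lin: "\<lbrakk>face_index n is; k = length is\<rbrakk> \<Longrightarrow>
      face n m is \<in> lin_maps K (X n m) (X (n - k) (m + int k - 1))"
    and face_rel: "\<lbrakk>face_index n is; k = length is; x \<in> carrier (X n m); Y = X (n - k) (m + int k - 2)\<rbrakk> \<Longrightarrow>
      d (n - k) (m + int k - 1) (face n m is x) \<oplus>\<^bsub>Y\<^esub> face n (m - 1) is (d n m x)
      = (\<Oplus>\<^bsub>Y\<^esub>\<sigma>\<in>{\<sigma>. \<sigma> permutes {..<k}}. \<Oplus>\<^bsub>Y\<^esub>j\<in>hat_splits (hat_tuple (permute_list \<sigma> is)).
          pm Y ((if evenperm \<sigma> then 0 else 1) + 1)
            (face (n - (k - j)) (m + int (k - j) - 1) (take j (hat_tuple (permute_list \<sigma> is)))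
              (face n m (drop j (hat_tuple (permute_list \<sigma> is))) x)))"

locale dihedral_infinity_simplicial_module = infinity_simplicial_module K X d face
  for K :: "('k, 'e) ring_scheme" and X :: "nat \<Rightarrow> int \<Rightarrow> ('k, 'x) module"
    and t :: "nat \<Rightarrow> int \<Rightarrow> 'x \<Rightarrow> 'x" and r :: "nat \<Rightarrow> int \<Rightarrow> 'x \<Rightarrow> 'x"
    and d :: "nat \<Rightarrow> int \<Rightarrow> 'x \<Rightarrow> 'x" and face :: "nat \<Rightarrow> int \<Rightarrow> nat list \<Rightarrow> 'x \<Rightarrow> 'x" +
  assumes t_lin: "t n m \<in> lin_maps K (X n m) (X n m)"
    and r_lin: "r n m \<in> lin_maps K (X n m) (X n m)"
    and t_cyclic: "x \<in> carrier (X n m) \<Longrightarrow> (t n m ^^ (n + 1)) x = x"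
    and r_invol: "x \<in> carrier (X n m) \<Longrightarrow> r n m (r n m x) = x"
    and r_t: "x \<in> carrier (X n m) \<Longrightarrow> r n m (t n m x) = inv_into (carrier (X n m)) (t n m) (r n m x)"
    and d_t: "x \<in> carrier (X n m) \<Longrightarrow> d n m (t n m x) = t n (m - 1) (d n m x)"
    and d_r: "x \<in> carrier (X n m) \<Longrightarrow> d n m (r n m x) = r n (m - 1) (d n m x)"
    and face_t_pos: "\<lbrakk>face_index n is; k = length is; hd is > 0; x \<in> carrier (X n m)\<rbrakk> \<Longrightarrow>
      face n m is (t n m x) = t (n - k) (m + int k - 1) (face n m (map (\<lambda>i. i - 1) is) x)"
    and face_t_zero: "\<lbrakk>face_index n is; k = length is; hd is = 0; x \<in> carrier (X n m)\<rbrakk> \<Longrightarrow>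
      face n m is (t n m x)
      = pm (X (n - k) (m + int k - 1)) (int k - 1) (face n m (map (\<lambda>i. i - 1) (tl is) @ [n]) x)"
    and face_r: "\<lbrakk>face_index n is; k = length is; x \<in> carrier (X n m)\<rbrakk> \<Longrightarrow>
      face n m is (r n m x)
      = pm (X (n - k) (m + int k - 1)) (int (k * (k - 1) div 2))
          (r (n - k) (m + int k - 1) (face n m (map (\<lambda>i. n - i) (rev is)) x))"


section \<open>The dihedral module of an involutive $A_\infty$-algebra\<close>

definition M_obj :: "('k, 'e) ring_scheme \<Rightarrow> (int \<Rightarrow> ('k, 'a) module) \<Rightarrow>
    nat \<Rightarrow> int \<Rightarrow> ('k, ((int \<times> 'a) list \<Rightarrow> 'k) set) module"
  where "M_obj K A n m = tpow K A (n + 1) m"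

definition M_t :: "('k, 'e) ring_scheme \<Rightarrow> (int \<Rightarrow> ('k, 'a) module) \<Rightarrow>
    nat \<Rightarrow> int \<Rightarrow> ((int \<times> 'a) list \<Rightarrow> 'k) set \<Rightarrow> ((int \<times> 'a) list \<Rightarrow> 'k) set"
  where "M_t K A n m = tensor_lift K A (n + 1) m (M_obj K A n m)
    (\<lambda>w. pm (M_obj K A n m) (fst (last w) * word_deg (butlast w)) (ptens K A (last w # butlast w)))"

definition M_r :: "('k, 'e) ring_scheme \<Rightarrow> (int \<Rightarrow> ('k, 'a) module) \<Rightarrow> (int \<Rightarrow> 'a \<Rightarrow> 'a) \<Rightarrow> 'k \<Rightarrow>
    nat \<Rightarrow> int \<Rightarrow> ((int \<times> 'a) list \<Rightarrow> 'k) set \<Rightarrow> ((int \<times> 'a) list \<Rightarrow> 'k) set"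
  where "M_r K A star \<rho> n m = tensor_lift K A (n + 1) m (M_obj K A n m)
    (\<lambda>w. let w' = map (\<lambda>(q, a). (q, star q a)) w in
       \<rho> \<odot>\<^bsub>M_obj K A n m\<^esub> pm (M_obj K A n m) (deg_pairs (tl w)) (ptens K A (hd w' # rev (tl w'))))"

definition M_d :: "('k, 'e) ring_scheme \<Rightarrow> (int \<Rightarrow> ('k, 'a) module) \<Rightarrow> (int \<Rightarrow> 'a \<Rightarrow> 'a) \<Rightarrow>
    nat \<Rightarrow> int \<Rightarrow> ((int \<times> 'a) list \<Rightarrow> 'k) set \<Rightarrow> ((int \<times> 'a) list \<Rightarrow> 'k) set"
  where "M_d K A d n m = tensor_diff K A d (n + 1) m"

text \<open>The face of the tuple $(j, j+1, \dots, j+k-1)$.\<close>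

definition M_block :: "('k, 'e) ring_scheme \<Rightarrow> (int \<Rightarrow> ('k, 'a) module) \<Rightarrow>
    (nat \<Rightarrow> int \<Rightarrow> ((int \<times> 'a) list \<Rightarrow> 'k) set \<Rightarrow> 'a) \<Rightarrow> nat \<Rightarrow> int \<Rightarrow> nat \<Rightarrow> nat \<Rightarrow>
    ((int \<times> 'a) list \<Rightarrow> 'k) set \<Rightarrow> ((int \<times> 'a) list \<Rightarrow> 'k) set"
  where "M_block K A \<pi> n p k j x = pm (M_obj K A (n - k) (p + int k - 1)) (int k * (p - 1))
    (tensor_insert K A j (k + 1) (n - k - j) (int k - 1) (\<pi> (k - 1)) p x)"

text \<open>In both nontrivial cases the number bound by \<open>THE\<close> is determined by the tuple.\<close>

definition M_face :: "('k, 'e) ring_scheme \<Rightarrow> (int \<Rightarrow> ('k, 'a) module) \<Rightarrow>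
    (nat \<Rightarrow> int \<Rightarrow> ((int \<times> 'a) list \<Rightarrow> 'k) set \<Rightarrow> 'a) \<Rightarrow> nat \<Rightarrow> int \<Rightarrow> nat list \<Rightarrow>
    ((int \<times> 'a) list \<Rightarrow> 'k) set \<Rightarrow> ((int \<times> 'a) list \<Rightarrow> 'k) set"
  where "M_face K A \<pi> n p is x = (let k = length is; Y = M_obj K A (n - k) (p + int k - 1);
      block = (\<lambda>j. j \<le> n - k \<and> is = [j..<j + k]);
      wrap = (\<lambda>q. 1 \<le> q \<and> q \<le> k \<and> is = [0..<k - q] @ [n - q + 1..<n + 1])
    in if \<exists>j. block j then M_block K A \<pi> n p k (THE j. block j) x
       else if \<exists>q. wrap q then
         (let q = (THE q. wrap q)
          in pm Y (int q * (int k - 1)) (M_block K A \<pi> n p k 0 ((M_t K A n p ^^ q) x)))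
       else \<zero>\<^bsub>Y\<^esub>)"


section \<open>The universal property of the tensor powers\<close>

lemma free_mod_module:
  assumes "cring K"
  shows "module K (free_mod K S)"
proof -
  interpret cring K by fact
  let ?F = "free_mod K S"
  have fin: "finite {x. f x \<oplus>\<^bsub>K\<^esub> g x \<noteq> \<zero>\<^bsub>K\<^esub>}" if "finite {x. f x \<noteq> \<zero>\<^bsub>K\<^esub>}" "finite {x. g x \<noteq> \<zero>\<^bsub>K\<^esub>}" for f g :: "_ \<Rightarrow> 'a"
    by (rule finite_subset[OF _ finite_UnI[OF that]]) auto
  have cl: "f x \<in> carrier K" if "f \<in> carrier ?F" for f x
    using that by (cases "x \<in> S") (auto simp: free_mod_def)
  show ?thesis
  proof (rule moduleI)
    show "abelian_group ?F"
    proof (rule abelian_groupI)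
      fix f assume f: "f \<in> carrier ?F"
      show "\<exists>g\<in>carrier ?F. g \<oplus>\<^bsub>?F\<^esub> f = \<zero>\<^bsub>?F\<^esub>"
      proof (rule bexI[of _ "\<lambda>x. \<ominus>\<^bsub>K\<^esub> f x"])
        have "{x. \<ominus>\<^bsub>K\<^esub> f x \<noteq> \<zero>\<^bsub>K\<^esub>} \<subseteq> {x. f x \<noteq> \<zero>\<^bsub>K\<^esub>}" by auto
        then show "(\<lambda>x. \<ominus>\<^bsub>K\<^esub> f x) \<in> carrier ?F" using f
          by (auto simp: free_mod_def intro: finite_subset)
      qed (use cl[OF f] in \<open>simp add: free_mod_def l_neg\<close>)
    next
      fix f g assume "f \<in> carrier ?F" "g \<in> carrier ?F"
      then show "f \<oplus>\<^bsub>?F\<^esub> g \<in> carrier ?F" using fin[of f g] by (auto simp: free_mod_def)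
      from \<open>f \<in> carrier ?F\<close> \<open>g \<in> carrier ?F\<close> show "f \<oplus>\<^bsub>?F\<^esub> g = g \<oplus>\<^bsub>?F\<^esub> f"
        using cl[OF \<open>f \<in> carrier ?F\<close>] cl[OF \<open>g \<in> carrier ?F\<close>] by (simp add: free_mod_def a_comm)
    next
      fix f g h assume *: "f \<in> carrier ?F" "g \<in> carrier ?F" "h \<in> carrier ?F"
      then show "f \<oplus>\<^bsub>?F\<^esub> g \<oplus>\<^bsub>?F\<^esub> h = f \<oplus>\<^bsub>?F\<^esub> (g \<oplus>\<^bsub>?F\<^esub> h)"
        using cl[OF *(1)] cl[OF *(2)] cl[OF *(3)] by (simp add: free_mod_def a_assoc)
    next
      fix f assume "f \<in> carrier ?F"
      then show "\<zero>\<^bsub>?F\<^esub> \<oplus>\<^bsub>?F\<^esub> f = f" using cl[of f] by (simp add: free_mod_def)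
    qed (simp add: free_mod_def)
    fix a f assume af: "a \<in> carrier K" "f \<in> carrier ?F"
    have "{x. a \<otimes>\<^bsub>K\<^esub> f x \<noteq> \<zero>\<^bsub>K\<^esub>} \<subseteq> {x. f x \<noteq> \<zero>\<^bsub>K\<^esub>}" using af(1) by auto
    then show "a \<odot>\<^bsub>?F\<^esub> f \<in> carrier ?F"
      using af by (auto simp: free_mod_def intro: finite_subset)
    fix b assume b: "b \<in> carrier K"
    show "(a \<oplus>\<^bsub>K\<^esub> b) \<odot>\<^bsub>?F\<^esub> f = (a \<odot>\<^bsub>?F\<^esub> f) \<oplus>\<^bsub>?F\<^esub> (b \<odot>\<^bsub>?F\<^esub> f)"
      using cl[OF af(2)] af(1) b by (simp add: free_mod_def l_distr)
    show "(a \<otimes>\<^bsub>K\<^esub> b) \<odot>\<^bsub>?F\<^esub> f = a \<odot>\<^bsub>?F\<^esub> (b \<odot>\<^bsub>?F\<^esub> f)"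
      using cl[OF af(2)] af(1) b by (simp add: free_mod_def m_assoc)
  next
    fix a f g assume "a \<in> carrier K" "f \<in> carrier ?F" "g \<in> carrier ?F"
    then show "a \<odot>\<^bsub>?F\<^esub> (f \<oplus>\<^bsub>?F\<^esub> g) = (a \<odot>\<^bsub>?F\<^esub> f) \<oplus>\<^bsub>?F\<^esub> (a \<odot>\<^bsub>?F\<^esub> g)"
      using cl[of f] cl[of g] by (simp add: free_mod_def r_distr)
  next
    fix f assume "f \<in> carrier ?F"
    then show "\<one>\<^bsub>K\<^esub> \<odot>\<^bsub>?F\<^esub> f = f" using cl[of f] by (simp add: free_mod_def)
  qed fact
qed

lemma free_gen_carrier:
  assumes "cring K" "x \<in> S"
  shows "free_gen K x \<in> carrier (free_mod K S)"
proof -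
  interpret cring K by fact
  have "{y. free_gen K x y \<noteq> \<zero>\<^bsub>K\<^esub>} \<subseteq> {x}" by (auto simp: free_gen_def)
  then have "finite {y. free_gen K x y \<noteq> \<zero>\<^bsub>K\<^esub>}" by (rule finite_subset) simp
  then show ?thesis using assms(2) by (auto simp: free_mod_def free_gen_def)
qed

lemma submod_span_submodule:
  assumes "module K M" "S \<subseteq> carrier M"
  shows "submodule (submod_span K M S) K M"
proof -
  interpret module K M by fact
  have ne: "carrier M \<in> {H. submodule H K M \<and> S \<subseteq> H}"
    using carrier_is_submodule assms(2) by auto
  show ?thesis
  proof (rule submoduleI)
    show "submod_span K M S \<subseteq> carrier M" using ne unfolding submod_span_def by blast
  qed (auto simp: submod_span_def dest: submoduleE(3,5) subgroup.one_closed[OF submodule.axioms(1)] intro: submoduleE(4))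
qed

lemma quot_mod_module:
  assumes "module K M" "submodule H K M"
  shows "module K (quot_mod M H)"
    and "\<And>x y. \<lbrakk>x \<in> carrier M; y \<in> carrier M\<rbrakk> \<Longrightarrow>
      (H +>\<^bsub>M\<^esub> x) \<oplus>\<^bsub>quot_mod M H\<^esub> (H +>\<^bsub>M\<^esub> y) = H +>\<^bsub>M\<^esub> (x \<oplus>\<^bsub>M\<^esub> y)"
    and "\<And>c x. \<lbrakk>c \<in> carrier K; x \<in> carrier M\<rbrakk> \<Longrightarrow>
      c \<odot>\<^bsub>quot_mod M H\<^esub> (H +>\<^bsub>M\<^esub> x) = H +>\<^bsub>M\<^esub> (c \<odot>\<^bsub>M\<^esub> x)"
proof -
  interpret module K M by fact
  interpret S: submodule H K M by fact
  interpret A: abelian_subgroup H M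
    by (rule abelian_subgroupI3) (unfold_locales, auto intro: additive_subgroupI S.subgroup_axioms)
  let ?Q = "quot_mod M H"
  have carr: "carrier ?Q = {H +>\<^bsub>M\<^esub> x | x. x \<in> carrier M}"
    by (auto simp: quot_mod_def A_RCOSETS_def')
  show add: "(H +>\<^bsub>M\<^esub> x) \<oplus>\<^bsub>?Q\<^esub> (H +>\<^bsub>M\<^esub> y) = H +>\<^bsub>M\<^esub> (x \<oplus>\<^bsub>M\<^esub> y)"
    if "x \<in> carrier M" "y \<in> carrier M" for x y
    using A.a_rcos_sum[OF that] by (simp add: quot_mod_def)
  show sm: "c \<odot>\<^bsub>?Q\<^esub> (H +>\<^bsub>M\<^esub> x) = H +>\<^bsub>M\<^esub> (c \<odot>\<^bsub>M\<^esub> x)"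
    if c: "c \<in> carrier K" and x: "x \<in> carrier M" for c x
  proof -
    have k1: "H +>\<^bsub>M\<^esub> (c \<odot>\<^bsub>M\<^esub> y) = H +>\<^bsub>M\<^esub> (c \<odot>\<^bsub>M\<^esub> x)" if "y \<in> H +>\<^bsub>M\<^esub> x" for y
    proof -
      from that obtain h where h: "h \<in> H" "y = h \<oplus>\<^bsub>M\<^esub> x" by (auto simp: a_r_coset_def')
      have hM: "h \<in> carrier M" using h by simp
      have "c \<odot>\<^bsub>M\<^esub> y = (c \<odot>\<^bsub>M\<^esub> h) \<oplus>\<^bsub>M\<^esub> (c \<odot>\<^bsub>M\<^esub> x)" using h c x hM by (simp add: smult_r_distr)
      then have "c \<odot>\<^bsub>M\<^esub> y \<in> H +>\<^bsub>M\<^esub> (c \<odot>\<^bsub>M\<^esub> x)" using h c by (auto simp: a_r_coset_def')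
      then show ?thesis using A.a_repr_independence' c x by (metis smult_closed)
    qed
    have k2: "x \<in> H +>\<^bsub>M\<^esub> x" using x A.a_rcos_self by simp
    have "(\<Union>y\<in>H +>\<^bsub>M\<^esub> x. H +>\<^bsub>M\<^esub> (c \<odot>\<^bsub>M\<^esub> y)) = H +>\<^bsub>M\<^esub> (c \<odot>\<^bsub>M\<^esub> x)"
      by (rule SUP_eq_const) (use k2 in blast, rule k1)
    then show ?thesis by (simp add: quot_mod_def)
  qed
  have zero: "\<zero>\<^bsub>?Q\<^esub> = H +>\<^bsub>M\<^esub> \<zero>\<^bsub>M\<^esub>" 
    using A.a_subset by (simp add: quot_mod_def)
  show "module K ?Q"
  proof (rule moduleI)
    show "abelian_group ?Q"
    proof (rule abelian_groupI)
      show "\<zero>\<^bsub>?Q\<^esub> \<in> carrier ?Q" using zero carr by auto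
      fix x assume "x \<in> carrier ?Q"
      then obtain a where a: "a \<in> carrier M" "x = H +>\<^bsub>M\<^esub> a" using carr by auto
      then have "(H +>\<^bsub>M\<^esub> (\<ominus>\<^bsub>M\<^esub> a)) \<oplus>\<^bsub>?Q\<^esub> x = \<zero>\<^bsub>?Q\<^esub>" using add zero by (simp add: l_neg M.l_neg)
      then show "\<exists>y\<in>carrier ?Q. y \<oplus>\<^bsub>?Q\<^esub> x = \<zero>\<^bsub>?Q\<^esub>" using a carr by blast
    next
      fix x y assume "x \<in> carrier ?Q" "y \<in> carrier ?Q"
      then obtain a b where ab: "a \<in> carrier M" "x = H +>\<^bsub>M\<^esub> a" "b \<in> carrier M" "y = H +>\<^bsub>M\<^esub> b" using carr by auto
      then have "x \<oplus>\<^bsub>?Q\<^esub> y = H +>\<^bsub>M\<^esub> (a \<oplus>\<^bsub>M\<^esub> b)" "a \<oplus>\<^bsub>M\<^esub> b \<in> carrier M" using add by auto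
      then show "x \<oplus>\<^bsub>?Q\<^esub> y \<in> carrier ?Q" using carr by blast
      show "x \<oplus>\<^bsub>?Q\<^esub> y = y \<oplus>\<^bsub>?Q\<^esub> x" using ab by (simp add: add M.a_comm)
      fix z assume "z \<in> carrier ?Q"
      then obtain c where "c \<in> carrier M" "z = H +>\<^bsub>M\<^esub> c" using carr by auto
      then show "x \<oplus>\<^bsub>?Q\<^esub> y \<oplus>\<^bsub>?Q\<^esub> z = x \<oplus>\<^bsub>?Q\<^esub> (y \<oplus>\<^bsub>?Q\<^esub> z)" using ab by (simp add: add M.a_assoc)
    next
      fix x assume "x \<in> carrier ?Q"
      then obtain a where "a \<in> carrier M" "x = H +>\<^bsub>M\<^esub> a" using carr by auto
      then show "\<zero>\<^bsub>?Q\<^esub> \<oplus>\<^bsub>?Q\<^esub> x = x" by (simp only: add zero M.zero_closed M.l_zero)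
    qed
  next
    fix a x assume a: "a \<in> carrier K" and "x \<in> carrier ?Q"
    then obtain x' where x': "x' \<in> carrier M" "x = H +>\<^bsub>M\<^esub> x'" using carr by auto
    show "a \<odot>\<^bsub>?Q\<^esub> x \<in> carrier ?Q" using a x' carr sm smult_closed by auto
    fix b assume b: "b \<in> carrier K"
    show "(a \<oplus>\<^bsub>K\<^esub> b) \<odot>\<^bsub>?Q\<^esub> x = (a \<odot>\<^bsub>?Q\<^esub> x) \<oplus>\<^bsub>?Q\<^esub> (b \<odot>\<^bsub>?Q\<^esub> x)"
      using a b x' by (simp add: sm add smult_l_distr)
    show "(a \<otimes>\<^bsub>K\<^esub> b) \<odot>\<^bsub>?Q\<^esub> x = a \<odot>\<^bsub>?Q\<^esub> (b \<odot>\<^bsub>?Q\<^esub> x)"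
      using a b x' by (simp add: sm smult_assoc1)
  next
    fix a x y assume a: "a \<in> carrier K" and "x \<in> carrier ?Q" "y \<in> carrier ?Q"
    then obtain x' y' where "x' \<in> carrier M" "x = H +>\<^bsub>M\<^esub> x'" "y' \<in> carrier M" "y = H +>\<^bsub>M\<^esub> y'" using carr by auto
    then show "a \<odot>\<^bsub>?Q\<^esub> (x \<oplus>\<^bsub>?Q\<^esub> y) = (a \<odot>\<^bsub>?Q\<^esub> x) \<oplus>\<^bsub>?Q\<^esub> (a \<odot>\<^bsub>?Q\<^esub> y)"
      using a by (simp add: sm add smult_r_distr)
  next
    fix x assume "x \<in> carrier ?Q"
    then obtain x' where "x' \<in> carrier M" "x = H +>\<^bsub>M\<^esub> x'" using carr by auto
    then show "\<one>\<^bsub>K\<^esub> \<odot>\<^bsub>?Q\<^esub> x = x" using sm by simp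
  qed (rule R.is_cring)
qed


definition tensor_multilin ::
    "('k, 'e) ring_scheme \<Rightarrow> (int \<Rightarrow> ('k, 'a) module) \<Rightarrow> nat \<Rightarrow> int \<Rightarrow> ('k, 'b) module \<Rightarrow>
     ((int \<times> 'a) list \<Rightarrow> 'b) \<Rightarrow> bool"
  where "tensor_multilin K A N m M g \<longleftrightarrow> (\<forall>w\<in>tensor_words A N m. g w \<in> carrier M) \<and>
    (\<forall>u q a b v. u @ (q, a) # v \<in> tensor_words A N m \<longrightarrow> u @ (q, b) # v \<in> tensor_words A N m \<longrightarrow>
       g (u @ (q, a \<oplus>\<^bsub>A q\<^esub> b) # v) = g (u @ (q, a) # v) \<oplus>\<^bsub>M\<^esub> g (u @ (q, b) # v)) \<and>
    (\<forall>u q a c v. c \<in> carrier K \<longrightarrow> u @ (q, a) # v \<in> tensor_words A N m \<longrightarrow>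
       g (u @ (q, c \<odot>\<^bsub>A q\<^esub> a) # v) = c \<odot>\<^bsub>M\<^esub> g (u @ (q, a) # v))"

lemma lin_maps_free_unique:
  assumes K: "cring K" and M: "module K M" and h: "h \<in> lin_maps K (free_mod K S) M" "h' \<in> lin_maps K (free_mod K S) M"
    and eq: "\<And>w. w \<in> S \<Longrightarrow> h (free_gen K w) = h' (free_gen K w)" and f: "f \<in> carrier (free_mod K S)"
  shows "h f = h' f"
proof -
  interpret cring K by fact
  interpret M: module K M by fact
  let ?F = "free_mod K S"
  interpret F: module K ?F using free_mod_module[OF K] .
  have z: "h \<zero>\<^bsub>?F\<^esub> = \<zero>\<^bsub>M\<^esub>" if "h \<in> lin_maps K ?F M" for h
  proof -
    have zc: "\<zero>\<^bsub>?F\<^esub> \<in> carrier ?F" by (rule F.M.zero_closed)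
    have "h (\<zero>\<^bsub>K\<^esub> \<odot>\<^bsub>?F\<^esub> \<zero>\<^bsub>?F\<^esub>) = \<zero>\<^bsub>K\<^esub> \<odot>\<^bsub>M\<^esub> h \<zero>\<^bsub>?F\<^esub>" "h \<zero>\<^bsub>?F\<^esub> \<in> carrier M"
      using that zc zero_closed unfolding lin_maps_def by blast+
    then show ?thesis by (simp only: F.smult_l_null[OF zc] M.smult_l_null)
  qed
  have "finite T \<Longrightarrow> f \<in> carrier ?F \<Longrightarrow> {x. f x \<noteq> \<zero>\<^bsub>K\<^esub>} = T \<Longrightarrow> h f = h' f" for T f
  proof (induction T arbitrary: f rule: finite_induct)
    case empty
    then have "f = \<zero>\<^bsub>?F\<^esub>" by (auto simp: free_mod_def)
    then show ?case using z[OF h(1)] z[OF h(2)] by simp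
  next
    case (insert w T)
    let ?f = "f(w := \<zero>\<^bsub>K\<^esub>)"
    have T: "{x. ?f x \<noteq> \<zero>\<^bsub>K\<^esub>} = T"
    proof -
      have "{x. ?f x \<noteq> \<zero>\<^bsub>K\<^esub>} = {x. f x \<noteq> \<zero>\<^bsub>K\<^esub>} - {w}" by auto
      then show ?thesis unfolding insert.prems(2) using insert.hyps by simp
    qed
    have "w \<in> {x. f x \<noteq> \<zero>\<^bsub>K\<^esub>}" unfolding insert.prems(2) by simp
    then have wS: "w \<in> S" using insert.prems(1) unfolding free_mod_def by auto
    have fw: "f w \<in> carrier K" using insert.prems(1) wS by (auto simp: free_mod_def)
    have fc: "?f \<in> carrier ?F" using insert.prems(1) T insert.hyps by (auto simp: free_mod_def)
    have fx: "f x \<in> carrier K" for x using insert.prems(1) by (cases "x \<in> S") (auto simp: free_mod_def)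
    have g: "free_gen K w \<in> carrier ?F" using free_gen_carrier[OF K wS] .
    have dec: "f = ?f \<oplus>\<^bsub>?F\<^esub> (f w \<odot>\<^bsub>?F\<^esub> free_gen K w)"
      using fx fw by (auto simp: free_mod_def free_gen_def fun_eq_iff)
    have hd: "h (?f \<oplus>\<^bsub>?F\<^esub> (f w \<odot>\<^bsub>?F\<^esub> free_gen K w)) = h ?f \<oplus>\<^bsub>M\<^esub> (f w \<odot>\<^bsub>M\<^esub> h (free_gen K w))"
      if "h \<in> lin_maps K ?F M" for h
      using that fc g fw F.smult_closed[OF fw g] unfolding lin_maps_def by auto
    have "h f = h ?f \<oplus>\<^bsub>M\<^esub> (f w \<odot>\<^bsub>M\<^esub> h (free_gen K w))"
      by (rule trans[OF arg_cong[OF dec, of h] hd[OF h(1)]])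
    also have "\<dots> = h' ?f \<oplus>\<^bsub>M\<^esub> (f w \<odot>\<^bsub>M\<^esub> h' (free_gen K w))"
      by (simp only: insert.IH[OF fc T] eq[OF wS])
    also have "\<dots> = h' f"
      by (rule trans[OF arg_cong[OF dec, of h'] hd[OF h(2)], symmetric])
    finally show ?case .
  qed
  then show ?thesis using f by (auto simp: free_mod_def)
qed

lemma free_lift:
  fixes M :: "('k, 'b) module"
  assumes K: "cring K" and M: "module K M" and g: "\<And>w. w \<in> S \<Longrightarrow> g w \<in> carrier M"
  obtains h where "h \<in> lin_maps K (free_mod K S) M" "\<And>w. w \<in> S \<Longrightarrow> h (free_gen K w) = g w"
proof -
  interpret cring K by fact
  interpret M: module K M by fact
  let ?F = "free_mod K S"
  let ?h = "\<lambda>f. \<Oplus>\<^bsub>M\<^esub>w\<in>{w. f w \<noteq> \<zero>\<^bsub>K\<^esub>}. f w \<odot>\<^bsub>M\<^esub> g w"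
  have h: "?h f = (\<Oplus>\<^bsub>M\<^esub>w\<in>T. f w \<odot>\<^bsub>M\<^esub> g w)" 
    if "f \<in> carrier ?F" "finite T" "{w. f w \<noteq> \<zero>\<^bsub>K\<^esub>} \<subseteq> T" "T \<subseteq> S" for f T
    by (rule M.add.finprod_mono_neutral_cong_left) (use that g in \<open>auto simp: free_mod_def Pi_def\<close>)
  have supp: "finite {w. f w \<noteq> \<zero>\<^bsub>K\<^esub>}" "{w. f w \<noteq> \<zero>\<^bsub>K\<^esub>} \<subseteq> S" "w \<in> S \<Longrightarrow> f w \<in> carrier K" if "f \<in> carrier ?F" for f w
    using that by (auto simp: free_mod_def)
  have "?h \<in> lin_maps K ?F M"
    unfolding lin_maps_def
  proof (intro CollectI conjI ballI funcsetI)
    fix f assume f: "f \<in> carrier ?F"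
    show "?h f \<in> carrier M" using supp[OF f] g by (intro M.finsum_closed) auto
    fix f' assume f': "f' \<in> carrier ?F"
    let ?T = "{w. f w \<noteq> \<zero>\<^bsub>K\<^esub>} \<union> {w. f' w \<noteq> \<zero>\<^bsub>K\<^esub>}"
    have T: "finite ?T" "?T \<subseteq> S" using supp f f' by auto
    have ff: "f \<oplus>\<^bsub>?F\<^esub> f' \<in> carrier ?F" using free_mod_module[OF K, of S] f f'
      by (meson abelian_groupE(1) module.axioms(2))
    have "?h (f \<oplus>\<^bsub>?F\<^esub> f') = (\<Oplus>\<^bsub>M\<^esub>w\<in>?T. (f \<oplus>\<^bsub>?F\<^esub> f') w \<odot>\<^bsub>M\<^esub> g w)"
      by (rule h) (use ff T in \<open>auto simp: free_mod_def\<close>)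
    also have "\<dots> = (\<Oplus>\<^bsub>M\<^esub>w\<in>?T. f w \<odot>\<^bsub>M\<^esub> g w \<oplus>\<^bsub>M\<^esub> f' w \<odot>\<^bsub>M\<^esub> g w)"
      by (rule M.finsum_cong') (use T supp[OF f] supp[OF f'] g in \<open>auto simp: free_mod_def M.smult_l_distr subset_iff\<close>)
    also have "\<dots> = (\<Oplus>\<^bsub>M\<^esub>w\<in>?T. f w \<odot>\<^bsub>M\<^esub> g w) \<oplus>\<^bsub>M\<^esub> (\<Oplus>\<^bsub>M\<^esub>w\<in>?T. f' w \<odot>\<^bsub>M\<^esub> g w)"
      by (rule M.finsum_addf) (use T supp[OF f] supp[OF f'] g in \<open>auto simp: subset_iff\<close>)
    also have "\<dots> = ?h f \<oplus>\<^bsub>M\<^esub> ?h f'" using h[OF f T(1) _ T(2)] h[OF f' T(1) _ T(2)] by auto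
    finally show "?h (f \<oplus>\<^bsub>?F\<^esub> f') = ?h f \<oplus>\<^bsub>M\<^esub> ?h f'" .
  next
    fix c f assume c: "c \<in> carrier K" and f: "f \<in> carrier ?F"
    have cf: "c \<odot>\<^bsub>?F\<^esub> f \<in> carrier ?F" using module.smult_closed[OF free_mod_module[OF K]] c f .
    have "?h (c \<odot>\<^bsub>?F\<^esub> f) = (\<Oplus>\<^bsub>M\<^esub>w\<in>{w. f w \<noteq> \<zero>\<^bsub>K\<^esub>}. (c \<odot>\<^bsub>?F\<^esub> f) w \<odot>\<^bsub>M\<^esub> g w)"
      by (rule h) (use cf supp[OF f] c in \<open>auto simp: free_mod_def\<close>)
    also have "\<dots> = (\<Oplus>\<^bsub>M\<^esub>w\<in>{w. f w \<noteq> \<zero>\<^bsub>K\<^esub>}. c \<odot>\<^bsub>M\<^esub> (f w \<odot>\<^bsub>M\<^esub> g w))"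
      by (rule M.finsum_cong') (use supp[OF f] g c in \<open>auto simp: free_mod_def M.smult_assoc1 subset_iff\<close>)
    also have "\<dots> = c \<odot>\<^bsub>M\<^esub> ?h f"
      by (rule M.finsum_smult_ldistr[symmetric]) (use supp[OF f] g c in \<open>auto\<close>)
    finally show "?h (c \<odot>\<^bsub>?F\<^esub> f) = c \<odot>\<^bsub>M\<^esub> ?h f" .
  qed
  moreover have "?h (free_gen K w) = g w" if w: "w \<in> S" for w
  proof -
    have "?h (free_gen K w) = (\<Oplus>\<^bsub>M\<^esub>v\<in>{w}. free_gen K w v \<odot>\<^bsub>M\<^esub> g v)"
      by (rule h) (use w free_gen_carrier[OF K w] in \<open>auto simp: free_gen_def\<close>)
    then show ?thesis using g[OF w] by (simp add: free_gen_def)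
  qed
  ultimately show ?thesis using that by blast
qed

lemma tensor_words_mid:
  assumes "u @ (q, a) # v \<in> tensor_words A N m"
  shows "a \<in> carrier (A q)" "b \<in> carrier (A q) \<Longrightarrow> u @ (q, b) # v \<in> tensor_words A N m"
  using assms by (auto simp: tensor_words_def word_deg_def)

lemma tensor_relators_carrier:
  assumes "graded_module K A"
  shows "tensor_relators K A N m \<subseteq> carrier (tensor_free K A N m)"
proof -
  interpret graded_module K A by fact
  have K: "cring K" by (rule module.axioms(1)[OF graded_module])
  interpret F: module K "tensor_free K A N m" unfolding tensor_free_def by (rule free_mod_module[OF K])
  have gen: "free_gen K w \<in> carrier (tensor_free K A N m)" if "w \<in> tensor_words A N m" for w
    unfolding tensor_free_def using free_gen_carrier[OF K that] .
  have add: "u @ (q, a \<oplus>\<^bsub>A q\<^esub> b) # v \<in> tensor_words A N m"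
    if "u @ (q, a) # v \<in> tensor_words A N m" "u @ (q, b) # v \<in> tensor_words A N m" for u q a b v
    using tensor_words_mid[OF that(1)] tensor_words_mid(1)[OF that(2)]
    by (simp add: abelian_groupE(1)[OF module.axioms(2)[OF graded_module]])
  have sm: "u @ (q, c \<odot>\<^bsub>A q\<^esub> a) # v \<in> tensor_words A N m"
    if "u @ (q, a) # v \<in> tensor_words A N m" "c \<in> carrier K" for u q a c v
    using tensor_words_mid[OF that(1)] that(2) by (simp add: module.smult_closed[OF graded_module])
  show ?thesis
    unfolding tensor_relators_def Let_def
    using gen add sm by (auto intro!: F.M.minus_closed F.M.a_closed F.smult_closed)
qed

lemma tpow_module:
  assumes "graded_module K A"
  shows "module K (tpow K A N m)"
proof -
  interpret graded_module K A by fact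
  have K: "cring K" by (rule module.axioms(1)[OF graded_module])
  have F: "module K (tensor_free K A N m)" unfolding tensor_free_def by (rule free_mod_module[OF K])
  show ?thesis unfolding tpow_def
    by (rule quot_mod_module(1)[OF F submod_span_submodule[OF F tensor_relators_carrier[OF assms]]])
qed

lemma tensor_lift:
  fixes M :: "('k, 'b) module"
  assumes A: "graded_module K A" and M: "module K M" and g: "tensor_multilin K A N m M g"
  shows "tensor_lift K A N m M g \<in> lin_maps K (tpow K A N m) M"
    and "w \<in> tensor_words A N m \<Longrightarrow> tensor_lift K A N m M g (ptens K A w) = g w"
proof -
  interpret graded_module K A by fact
  have K: "cring K" by (rule module.axioms(1)[OF graded_module])
  interpret M: module K M by fact
  define F where "F = tensor_free K A N m"
  define H where "H = submod_span K F (tensor_relators K A N m)"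
  have Fm: "module K F" unfolding F_def tensor_free_def by (rule free_mod_module[OF K])
  interpret F: module K F by fact
  have H: "submodule H K F" unfolding H_def F_def[symmetric]
    using submod_span_submodule[OF Fm] tensor_relators_carrier[OF A] F_def by metis
  interpret H: submodule H K F by fact
  interpret Ab: abelian_subgroup H F
    by (rule abelian_subgroupI3) (unfold_locales, auto intro: additive_subgroupI H.subgroup_axioms)
  have T: "tpow K A N m = quot_mod F H" unfolding tpow_def F_def H_def ..
  have carr: "carrier (quot_mod F H) = {H +>\<^bsub>F\<^esub> x | x. x \<in> carrier F}"
    by (auto simp: quot_mod_def A_RCOSETS_def')
  have gen: "free_gen K w \<in> carrier F" if "w \<in> tensor_words A N m" for w
    unfolding F_def tensor_free_def using free_gen_carrier[OF K that] .
  have pt: "ptens K A w = H +>\<^bsub>F\<^esub> free_gen K w" if "w \<in> tensor_words A N m" for w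
    using that by (auto simp: ptens_def H_def F_def Let_def tensor_words_def word_deg_def)
  obtain h0 where h0: "h0 \<in> lin_maps K F M" and h0g: "\<And>w. w \<in> tensor_words A N m \<Longrightarrow> h0 (free_gen K w) = g w"
    unfolding F_def tensor_free_def
    by (rule free_lift[OF K M, of "tensor_words A N m" g]) (use g in \<open>simp add: tensor_multilin_def\<close>, blast)
  have h0a: "h0 (x \<oplus>\<^bsub>F\<^esub> y) = h0 x \<oplus>\<^bsub>M\<^esub> h0 y" if "x \<in> carrier F" "y \<in> carrier F" for x y
    using h0 that unfolding lin_maps_def by auto
  have h0c: "h0 x \<in> carrier M" if "x \<in> carrier F" for x
    using h0 that unfolding lin_maps_def by auto
  have h0s: "h0 (c \<odot>\<^bsub>F\<^esub> x) = c \<odot>\<^bsub>M\<^esub> h0 x" if "x \<in> carrier F" "c \<in> carrier K" for x c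
    using h0 that unfolding lin_maps_def by auto
  have zF: "\<zero>\<^bsub>F\<^esub> \<in> carrier F" by (rule F.M.zero_closed)
  have h0z: "h0 \<zero>\<^bsub>F\<^esub> = \<zero>\<^bsub>M\<^esub>"
    using h0s[OF zF cring.cring_simprules(2)[OF K]]
    by (simp only: F.smult_l_null[OF zF] M.smult_l_null[OF h0c[OF zF]])
  have h0n: "h0 (\<ominus>\<^bsub>F\<^esub> x) = \<ominus>\<^bsub>M\<^esub> h0 x" if "x \<in> carrier F" for x
  proof -
    have "h0 (\<ominus>\<^bsub>F\<^esub> x) \<oplus>\<^bsub>M\<^esub> h0 x = \<zero>\<^bsub>M\<^esub>"
      using h0a[of "\<ominus>\<^bsub>F\<^esub> x" x] that h0z by (simp add: F.M.l_neg)
    then show ?thesis using that h0c by (metis F.M.a_inv_closed M.minus_equality)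
  qed
  let ?Ker = "{x \<in> carrier F. h0 x = \<zero>\<^bsub>M\<^esub>}"
  have ker: "submodule ?Ker K F"
    by (rule F.submoduleI) (auto simp: h0z h0n h0a h0s)
  have rel: "tensor_relators K A N m \<subseteq> ?Ker"
  proof
    fix x assume x: "x \<in> tensor_relators K A N m"
    have xF: "x \<in> carrier F" using tensor_relators_carrier[OF A] x unfolding F_def by blast
    have Aa: "abelian_group (A q)" for q by (rule module.axioms(2)[OF graded_module])
    from x consider
      (1) u q a b v where "u @ (q, a) # v \<in> tensor_words A N m" "u @ (q, b) # v \<in> tensor_words A N m"
        "x = free_gen K (u @ (q, a \<oplus>\<^bsub>A q\<^esub> b) # v)
        \<ominus>\<^bsub>F\<^esub> (free_gen K (u @ (q, a) # v) \<oplus>\<^bsub>F\<^esub> free_gen K (u @ (q, b) # v))"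
    | (2) u q a c v where "u @ (q, a) # v \<in> tensor_words A N m" "c \<in> carrier K"
        "x = free_gen K (u @ (q, c \<odot>\<^bsub>A q\<^esub> a) # v) \<ominus>\<^bsub>F\<^esub> (c \<odot>\<^bsub>F\<^esub> free_gen K (u @ (q, a) # v))"
      unfolding tensor_relators_def Let_def F_def by blast
    then have "h0 x = \<zero>\<^bsub>M\<^esub>"
    proof cases
      case 1
      have w: "u @ (q, a \<oplus>\<^bsub>A q\<^esub> b) # v \<in> tensor_words A N m"
        using tensor_words_mid[OF 1(1)] tensor_words_mid(1)[OF 1(2)] abelian_groupE(1)[OF Aa] by blast
      have "g (u @ (q, a \<oplus>\<^bsub>A q\<^esub> b) # v) = g (u @ (q, a) # v) \<oplus>\<^bsub>M\<^esub> g (u @ (q, b) # v)"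
        "g (u @ (q, a) # v) \<in> carrier M" "g (u @ (q, b) # v) \<in> carrier M"
        using g 1 unfolding tensor_multilin_def by blast+
      then show ?thesis unfolding 1(3) a_minus_def
        using gen[OF w] gen[OF 1(1)] gen[OF 1(2)] 
        by (simp add: h0a h0n h0g[OF w] h0g[OF 1(1)] h0g[OF 1(2)] M.r_neg)
    next
      case 2
      have w: "u @ (q, c \<odot>\<^bsub>A q\<^esub> a) # v \<in> tensor_words A N m"
        using tensor_words_mid[OF 2(1)] module.smult_closed[OF graded_module] 2(2) by blast
      have "g (u @ (q, c \<odot>\<^bsub>A q\<^esub> a) # v) = c \<odot>\<^bsub>M\<^esub> g (u @ (q, a) # v)"
        "g (u @ (q, a) # v) \<in> carrier M"
        using g 2 unfolding tensor_multilin_def by blast+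
      then show ?thesis unfolding 2(3) a_minus_def
        using gen[OF w] gen[OF 2(1)] 2(2)
        by (simp add: h0a h0n h0s h0g[OF w] h0g[OF 2(1)] M.r_neg)
    qed
    then show "x \<in> ?Ker" using xF by blast
  qed
  have Hker: "H \<subseteq> ?Ker" unfolding H_def submod_span_def using ker rel by blast
  define h where "h = (\<lambda>C\<in>carrier (quot_mod F H). h0 (SOME f. f \<in> C))"
  have hC: "h (H +>\<^bsub>F\<^esub> f) = h0 f" if f: "f \<in> carrier F" for f
  proof -
    have "(SOME f'. f' \<in> H +>\<^bsub>F\<^esub> f) \<in> H +>\<^bsub>F\<^esub> f" by (rule someI[of "\<lambda>f'. f' \<in> H +>\<^bsub>F\<^esub> f", OF Ab.a_rcos_self[OF f]])
    then obtain y where y: "y \<in> H" "(SOME f'. f' \<in> H +>\<^bsub>F\<^esub> f) = y \<oplus>\<^bsub>F\<^esub> f" by (auto simp: a_r_coset_def')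
    have "h0 (y \<oplus>\<^bsub>F\<^esub> f) = h0 f" using Hker y(1) f h0a[of y f] h0c[of f] by auto
    moreover have "H +>\<^bsub>F\<^esub> f \<in> carrier (quot_mod F H)" using f carr by blast
    ultimately show ?thesis unfolding h_def using y(2) by simp
  qed
  note q = quot_mod_module(2,3)[OF Fm H]
  have hl: "h \<in> lin_maps K (quot_mod F H) M"
    unfolding lin_maps_def
  proof (intro CollectI conjI ballI funcsetI)
    fix x assume "x \<in> carrier (quot_mod F H)"
    then obtain x' where x: "x' \<in> carrier F" "x = H +>\<^bsub>F\<^esub> x'" using carr by blast
    then show "h x \<in> carrier M" using hC h0c by simp
    fix y assume "y \<in> carrier (quot_mod F H)"
    then obtain y' where y: "y' \<in> carrier F" "y = H +>\<^bsub>F\<^esub> y'" using carr by blast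
    show "h (x \<oplus>\<^bsub>quot_mod F H\<^esub> y) = h x \<oplus>\<^bsub>M\<^esub> h y" using x y by (simp add: q(1) hC h0a)
  next
    fix c x assume c: "c \<in> carrier K" "x \<in> carrier (quot_mod F H)"
    then obtain x' where x: "x' \<in> carrier F" "x = H +>\<^bsub>F\<^esub> x'" using carr by blast
    then show "h (c \<odot>\<^bsub>quot_mod F H\<^esub> x) = c \<odot>\<^bsub>M\<^esub> h x" using c by (simp add: q(2) hC h0s)
  qed
  have hg: "h (ptens K A w) = g w" if "w \<in> tensor_words A N m" for w
    using pt[OF that] hC[OF gen[OF that]] h0g[OF that] by simp
  let ?P = "\<lambda>h. h \<in> lin_maps K (tpow K A N m) M \<and> h \<in> extensional (carrier (tpow K A N m)) \<and>
    (\<forall>w\<in>tensor_words A N m. h (ptens K A w) = g w)"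
  have ex: "?P h" using hl hg T by (auto simp: h_def)
  have "h' = h" if h': "?P h'" for h'
  proof (rule extensionalityI)
    show "h' \<in> extensional (carrier (quot_mod F H))" "h \<in> extensional (carrier (quot_mod F H))"
      using h' ex T by auto
    fix C assume "C \<in> carrier (quot_mod F H)"
    then obtain f where f: "f \<in> carrier F" "C = H +>\<^bsub>F\<^esub> f" using carr by blast
    have lin: "(\<lambda>f. k (H +>\<^bsub>F\<^esub> f)) \<in> lin_maps K (free_mod K (tensor_words A N m)) M"
      if k: "k \<in> lin_maps K (tpow K A N m) M" for k
    proof -
      have kk: "k \<in> carrier (quot_mod F H) \<rightarrow> carrier M" 
        "\<And>x y. x \<in> carrier (quot_mod F H) \<Longrightarrow> y \<in> carrier (quot_mod F H) \<Longrightarrow> k (x \<oplus>\<^bsub>quot_mod F H\<^esub> y) = k x \<oplus>\<^bsub>M\<^esub> k y"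
        "\<And>c x. c \<in> carrier K \<Longrightarrow> x \<in> carrier (quot_mod F H) \<Longrightarrow> k (c \<odot>\<^bsub>quot_mod F H\<^esub> x) = c \<odot>\<^bsub>M\<^esub> k x"
        using k unfolding T lin_maps_def by auto
      have cs: "H +>\<^bsub>F\<^esub> x \<in> carrier (quot_mod F H)" if "x \<in> carrier F" for x using that carr by blast
      show ?thesis unfolding F_def[unfolded tensor_free_def, symmetric] lin_maps_def
        using kk(1) cs by (auto simp: q[symmetric] kk(2,3))
    qed
    have fF: "f \<in> carrier (free_mod K (tensor_words A N m))" using f by (simp add: F_def tensor_free_def)
    have "h' (H +>\<^bsub>F\<^esub> free_gen K w) = h (H +>\<^bsub>F\<^esub> free_gen K w)" if "w \<in> tensor_words A N m" for w
      using h' ex that pt[OF that] by metis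
    then have "h' (H +>\<^bsub>F\<^esub> f) = h (H +>\<^bsub>F\<^esub> f)"
      using lin_maps_free_unique[OF K M lin lin _ fF, of h' h] h' ex by blast
    then show "h' C = h C" using f by simp
  qed
  then have "tensor_lift K A N m M g = h" unfolding tensor_lift_def using ex by (intro the_equality) blast+
  then show "tensor_lift K A N m M g \<in> lin_maps K (tpow K A N m) M"
    and "w \<in> tensor_words A N m \<Longrightarrow> tensor_lift K A N m M g (ptens K A w) = g w" using ex by blast+
qed

end

theory Submission
  imports Defs
begin

text \<open>
  All maps of the theorem are linear maps on tensor powers, and pure tensors span, so every identity
  is checked on words (\<open>tensor_ext\<close>). There the maps send a pure tensor to a pure tensor with a sign,
  or to a sum of such. With \<open>sp e w\<close> for the pure tensor of \<open>w\<close> with the sign $(-1)^e$, an identity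
  of maps becomes an identity of words and a congruence of exponents modulo 2.

  The face of a tuple $(i_1,\dots,i_k)$ is best seen on a circle. Place the letters $a_0,\dots,a_n$ of a
  word on a circle and let the gap \<open>i\<close> be the one between $a_i$ and $a_{i+1}$, so that the gap \<open>n\<close>
  lies between $a_n$ and $a_0$. The face is nonzero only if the entries are the gaps of an arc, and
  then it replaces the \<open>k + 1\<close> letters along this arc by the value of one operation. The cyclic
  operator rotates the circle, and the two formulas for $\partial_{(i_1,\dots,i_k)}t_n$ say that the faces
  are compatible with rotations up to sign (\<open>set_face_M_t_pos\<close>, \<open>set_face_M_t_zero\<close>). Hence a property
  of tuples that is inherited from a rotated tuple has to be checked only on convenient
  representatives (\<open>rot_cyclic_induct\<close>). As a tuple misses at least one gap, it can be rotated
  until it misses the gap \<open>n\<close>, and then no face that wraps around occurs: it remains to treat the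
  initial intervals $(0,\dots,k-1)$, and the tuples that miss the gap \<open>n\<close> and are not intervals.

  For the reflection, both sides vanish on tuples of the second kind, and for $(0,\dots,k-1)$ the claim
  becomes the compatibility of the operation with the involution (\<open>M_block_M_r\<close>).

  For the boundary of a face, the sum over permutations and splittings is first turned into a sum over
  the proper nonempty subsets \<open>S\<close> of the set of entries (\<open>finsum_hat_splits\<close>): \<open>S\<close> is contracted
  first, the remaining gaps are renumbered and contracted afterwards, and the sign counts the pairs
  of an entry of \<open>S\<close> and a larger remaining entry. In this form the relation is compatible with
  rotations (\<open>face_relation_rot\<close>). For the initial interval only the subintervals contribute, the
  differentials of the letters outside the arc cancel, and what is left is the relation
  between the operations of the $A_\infty$-algebra, tensored with the other letters
  (\<open>face_relation_initial\<close>). For a set that misses the gap \<open>n\<close> and is not an interval, the face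
  itself is zero. Contracting \<open>S\<close> and then the rest is nonzero only if the set consists of two
  separated intervals, of which \<open>S\<close> is one. These two terms cancel, because the two contractions
  involve disjoint blocks of letters and commute up to a sign (\<open>face_relation_gap\<close>).
\<close>

section \<open>Linear maps, signs and finite sums\<close>

lemma lin_mapsD:
  assumes "h \<in> lin_maps K M N"
  shows "x \<in> carrier M \<Longrightarrow> h x \<in> carrier N"
    and "x \<in> carrier M \<Longrightarrow> y \<in> carrier M \<Longrightarrow> h (x \<oplus>\<^bsub>M\<^esub> y) = h x \<oplus>\<^bsub>N\<^esub> h y"
    and "c \<in> carrier K \<Longrightarrow> x \<in> carrier M \<Longrightarrow> h (c \<odot>\<^bsub>M\<^esub> x) = c \<odot>\<^bsub>N\<^esub> h x"
  using assms by (auto simp: lin_maps_def)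

lemma lin_mapsI:
  assumes "\<And>x. x \<in> carrier M \<Longrightarrow> h x \<in> carrier N"
    and "\<And>x y. x \<in> carrier M \<Longrightarrow> y \<in> carrier M \<Longrightarrow> h (x \<oplus>\<^bsub>M\<^esub> y) = h x \<oplus>\<^bsub>N\<^esub> h y"
    and "\<And>c x. c \<in> carrier K \<Longrightarrow> x \<in> carrier M \<Longrightarrow> h (c \<odot>\<^bsub>M\<^esub> x) = c \<odot>\<^bsub>N\<^esub> h x"
  shows "h \<in> lin_maps K M N"
  using assms by (auto simp: lin_maps_def)

lemma lin_zero:
  assumes "module K M" "module K N" "h \<in> lin_maps K M N"
  shows "h \<zero>\<^bsub>M\<^esub> = \<zero>\<^bsub>N\<^esub>"
proof -
  interpret M: module K M by fact
  interpret N: module K N by fact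
  have "h (\<zero>\<^bsub>K\<^esub> \<odot>\<^bsub>M\<^esub> \<zero>\<^bsub>M\<^esub>) = \<zero>\<^bsub>K\<^esub> \<odot>\<^bsub>N\<^esub> h \<zero>\<^bsub>M\<^esub>"
    by (rule lin_mapsD(3)[OF assms(3)]) auto
  moreover have "h \<zero>\<^bsub>M\<^esub> \<in> carrier N" using lin_mapsD(1)[OF assms(3)] by simp
  ultimately show ?thesis by (simp only: M.smult_l_null[OF M.M.zero_closed] N.smult_l_null)
qed

lemma lin_neg:
  assumes "module K M" "module K N" "h \<in> lin_maps K M N" "x \<in> carrier M"
  shows "h (\<ominus>\<^bsub>M\<^esub> x) = \<ominus>\<^bsub>N\<^esub> h x"
proof -
  interpret M: module K M by fact
  interpret N: module K N by fact
  note h = lin_mapsD[OF assms(3)]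
  have "h (\<ominus>\<^bsub>M\<^esub> x) \<oplus>\<^bsub>N\<^esub> h x = \<zero>\<^bsub>N\<^esub>"
    using h(2)[of "\<ominus>\<^bsub>M\<^esub> x" x] assms(4) lin_zero[OF assms(1-3)] by (simp add: M.M.l_neg)
  then show ?thesis using h(1) assms(4) by (metis M.M.a_inv_closed N.M.minus_equality)
qed

lemma lin_pm:
  assumes "module K M" "module K N" "h \<in> lin_maps K M N" "x \<in> carrier M"
  shows "h (pm M e x) = pm N e (h x)"
  using assms by (simp add: pm_def lin_neg)

lemma lin_finsum:
  assumes "module K M" "module K N" "h \<in> lin_maps K M N" "\<And>i. i \<in> I \<Longrightarrow> f i \<in> carrier M"
  shows "h (\<Oplus>\<^bsub>M\<^esub>i\<in>I. f i) = (\<Oplus>\<^bsub>N\<^esub>i\<in>I. h (f i))"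
proof -
  interpret M: module K M by fact
  interpret N: module K N by fact
  note h = lin_mapsD[OF assms(3)]
  show ?thesis using assms(4)
  proof (induction I rule: infinite_finite_induct)
    case (insert i I)
    then show ?case using h by (simp add: M.M.finsum_insert N.M.finsum_insert Pi_def M.M.finsum_closed)
  qed (simp_all add: lin_zero[OF assms(1-3)])
qed

lemma lin_comp:
  assumes "h \<in> lin_maps K M N" "g \<in> lin_maps K N P"
  shows "(\<lambda>x. g (h x)) \<in> lin_maps K M P"
  using lin_mapsD[OF assms(1)] lin_mapsD[OF assms(2)] by (auto intro!: lin_mapsI)

lemma lin_id: "(\<lambda>x. x) \<in> lin_maps K M M"
  by (auto intro: lin_mapsI)

lemma lin_zero_map:
  assumes "module K N" shows "(\<lambda>x. \<zero>\<^bsub>N\<^esub>) \<in> lin_maps K M N"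
proof -
  interpret N: module K N by fact
  show ?thesis by (rule lin_mapsI) auto
qed

lemma lin_pm_map:
  assumes "module K N" "h \<in> lin_maps K M N"
  shows "(\<lambda>x. pm N e (h x)) \<in> lin_maps K M N"
proof -
  interpret N: module K N by fact
  show ?thesis using lin_mapsD[OF assms(2)]
    by (intro lin_mapsI) (auto simp: pm_def N.M.minus_add N.M.a_comm N.smult_r_minus)
qed

lemma lin_add_map:
  assumes "module K N" "h \<in> lin_maps K M N" "g \<in> lin_maps K M N"
  shows "(\<lambda>x. h x \<oplus>\<^bsub>N\<^esub> g x) \<in> lin_maps K M N"
proof -
  interpret N: module K N by fact
  show ?thesis using lin_mapsD[OF assms(2)] lin_mapsD[OF assms(3)]
    by (intro lin_mapsI) (auto simp: N.M.a_ac N.smult_r_distr)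
qed

lemma lin_maps_cong:
  assumes "module K M" "h \<in> lin_maps K M N" "\<And>x. x \<in> carrier M \<Longrightarrow> g x = h x"
  shows "g \<in> lin_maps K M N"
proof -
  interpret M: module K M by fact
  show ?thesis using lin_mapsD[OF assms(2)] assms(3) by (auto intro!: lin_mapsI)
qed

lemma lin_finsum_map:
  assumes "module K M" "module K N" "\<And>i. i \<in> I \<Longrightarrow> h i \<in> lin_maps K M N"
  shows "(\<lambda>x. \<Oplus>\<^bsub>N\<^esub>i\<in>I. h i x) \<in> lin_maps K M N"
  using assms(3)
proof (induction I rule: infinite_finite_induct)
  case (infinite I)
  interpret N: module K N by fact
  show ?case using infinite lin_zero_map[OF assms(2)] by simp
next
  case empty
  interpret N: module K N by fact
  show ?case using lin_zero_map[OF assms(2)] by simp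
next
  case (insert i I)
  interpret N: module K N by fact
  have "(\<lambda>x. h i x \<oplus>\<^bsub>N\<^esub> (\<Oplus>\<^bsub>N\<^esub>i\<in>I. h i x)) \<in> lin_maps K M N"
    using insert by (intro lin_add_map[OF assms(2)]) auto
  moreover have "(\<Oplus>\<^bsub>N\<^esub>i\<in>insert i I. h i x) = h i x \<oplus>\<^bsub>N\<^esub> (\<Oplus>\<^bsub>N\<^esub>i\<in>I. h i x)" if "x \<in> carrier M" for x
    using insert.hyps insert.prems that lin_mapsD(1) by (intro N.M.finsum_insert) fastforce+
  ultimately show ?case by (rule lin_maps_cong[OF assms(1)])
qed

context module
begin

lemma pm_closed [simp]: "x \<in> carrier M \<Longrightarrow> pm M e x \<in> carrier M"
  by (simp add: pm_def)

lemma pm_pm: "x \<in> carrier M \<Longrightarrow> pm M e (pm M e' x) = pm M (e + e') x"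
  by (auto simp: pm_def)

lemma pm_add: "x \<in> carrier M \<Longrightarrow> y \<in> carrier M \<Longrightarrow> pm M e (x \<oplus>\<^bsub>M\<^esub> y) = pm M e x \<oplus>\<^bsub>M\<^esub> pm M e y"
  by (auto simp: pm_def M.minus_add M.a_comm)

lemma pm_cancel: "x \<in> carrier M \<Longrightarrow> odd (e + e') \<Longrightarrow> pm M e x \<oplus>\<^bsub>M\<^esub> pm M e' x = \<zero>\<^bsub>M\<^esub>"
  by (auto simp: pm_def M.l_neg M.r_neg)

lemma pm_zero [simp]: "pm M e \<zero>\<^bsub>M\<^esub> = \<zero>\<^bsub>M\<^esub>"
  by (simp add: pm_def)

lemma pm_finsum:
  "(\<And>i. i \<in> I \<Longrightarrow> f i \<in> carrier M) \<Longrightarrow> pm M e (\<Oplus>\<^bsub>M\<^esub>i\<in>I. f i) = (\<Oplus>\<^bsub>M\<^esub>i\<in>I. pm M e (f i))"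
  by (rule lin_finsum[where K = R]) (auto intro: module_axioms lin_pm_map lin_id)

end

lemma pm_even: "even e \<Longrightarrow> pm M e x = x" by (simp add: pm_def)

lemma pm_parity: "even (e + e') \<Longrightarrow> pm M e x = pm M e' x"
  by (auto simp: pm_def)

context abelian_monoid
begin

lemma finsum_Sigma:
  assumes "finite I" "\<And>i. i \<in> I \<Longrightarrow> finite (B i)" "\<And>i j. i \<in> I \<Longrightarrow> j \<in> B i \<Longrightarrow> f i j \<in> carrier G"
  shows "(\<Oplus>i\<in>I. \<Oplus>j\<in>B i. f i j) = (\<Oplus>z\<in>Sigma I B. f (fst z) (snd z))"
  using assms
proof (induction I rule: finite_induct)
  case empty then show ?case by simp
next
  case (insert i I)
  have S: "Sigma (insert i I) B = Pair i ` B i \<union> Sigma I B" by auto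
  have "(\<Oplus>z\<in>Sigma (insert i I) B. f (fst z) (snd z))
      = (\<Oplus>z\<in>Pair i ` B i. f (fst z) (snd z)) \<oplus> (\<Oplus>z\<in>Sigma I B. f (fst z) (snd z))"
    unfolding S using insert by (intro finsum_Un_disjoint) auto
  also have "(\<Oplus>z\<in>Pair i ` B i. f (fst z) (snd z)) = (\<Oplus>j\<in>B i. f i j)"
    using insert.prems by (subst finsum_reindex) (auto simp: inj_on_def)
  finally show ?case using insert
    by (subst finsum_insert) (auto intro!: finsum_closed)
qed

lemma finsum_lessThan_Suc_shift:
  assumes "\<And>i. i < Suc n \<Longrightarrow> f i \<in> carrier G"
  shows "(\<Oplus>i\<in>{..<Suc n}. f i) = f 0 \<oplus> (\<Oplus>i\<in>{..<n}. f (Suc i))"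
proof -
  have "(\<Oplus>i\<in>insert 0 (Suc ` {..<n}). f i) = f 0 \<oplus> (\<Oplus>i\<in>Suc ` {..<n}. f i)"
    using assms by (intro finsum_insert) auto
  also have "(\<Oplus>i\<in>Suc ` {..<n}. f i) = (\<Oplus>i\<in>{..<n}. f (Suc i))"
    using assms by (intro finsum_reindex) auto
  finally show ?thesis by (simp add: lessThan_Suc_eq_insert_0)
qed

lemma finsum_lessThan_Suc:
  assumes "\<And>i. i < Suc n \<Longrightarrow> f i \<in> carrier G"
  shows "(\<Oplus>i\<in>{..<Suc n}. f i) = (\<Oplus>i\<in>{..<n}. f i) \<oplus> f n"
proof -
  have "(\<Oplus>i\<in>{..<Suc n}. f i) = f n \<oplus> (\<Oplus>i\<in>{..<n}. f i)"
    unfolding lessThan_Suc using assms by (intro finsum_insert) auto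
  also have "\<dots> = (\<Oplus>i\<in>{..<n}. f i) \<oplus> f n"
    using assms by (intro a_comm finsum_closed) auto
  finally show ?thesis .
qed

lemma finsum_lessThan_add:
  fixes m n :: nat
  assumes "\<And>i. i < m + n \<Longrightarrow> f i \<in> carrier G"
  shows "(\<Oplus>i\<in>{..<m + n}. f i) = (\<Oplus>i\<in>{..<m}. f i) \<oplus> (\<Oplus>i\<in>{..<n}. f (m + i))"
  using assms
proof (induction n)
  case 0
  then have "(\<Oplus>i\<in>{..<m}. f i) \<in> carrier G" by (intro finsum_closed) auto
  then show ?case by simp
next
  case (Suc n)
  have c: "(\<Oplus>i\<in>{..<m}. f i) \<in> carrier G" "(\<Oplus>i\<in>{..<n}. f (m + i)) \<in> carrier G" "f (m + n) \<in> carrier G"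
    using Suc.prems by (auto intro!: finsum_closed)
  show ?case using Suc c
    by (simp add: finsum_lessThan_Suc a_assoc)
qed

lemma finsum_lessThan_rev:
  fixes n :: nat
  assumes "\<And>i. i < n \<Longrightarrow> f i \<in> carrier G"
  shows "(\<Oplus>i\<in>{..<n}. f (n - 1 - i)) = (\<Oplus>i\<in>{..<n}. f i)"
proof -
  have b: "(\<lambda>i. n - 1 - i) ` {..<n} = {..<n}"
  proof (intro equalityI subsetI)
    fix i assume "i \<in> {..<n}"
    then have "i = n - 1 - (n - 1 - i)" "n - 1 - i \<in> {..<n}" by auto
    then show "i \<in> (\<lambda>i. n - 1 - i) ` {..<n}" by blast
  qed auto
  have "(\<Oplus>i\<in>(\<lambda>i. n - 1 - i) ` {..<n}. f i) = (\<Oplus>i\<in>{..<n}. f (n - 1 - i))"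
    using assms b by (intro finsum_reindex) (auto simp: inj_on_def)
  then show ?thesis by (simp only: b)
qed

end

text \<open>This is the bookkeeping behind $d^2 = 0$ on a tensor power.\<close>

lemma (in abelian_group) finsum_alternating_square:
  fixes n :: nat
  assumes "\<And>i j. i < n \<Longrightarrow> j < n \<Longrightarrow> f i j \<in> carrier G" "\<And>i. i < n \<Longrightarrow> f i i = \<zero>"
    "\<And>i j. i < j \<Longrightarrow> j < n \<Longrightarrow> f i j \<oplus> f j i = \<zero>"
  shows "(\<Oplus>i\<in>{..<n}. \<Oplus>j\<in>{..<n}. f i j) = \<zero>"
  using assms
proof (induction n)
  case 0 then show ?case by simp
next
  case (Suc n)
  have IH: "(\<Oplus>i\<in>{..<n}. \<Oplus>j\<in>{..<n}. f i j) = \<zero>" using Suc by auto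
  have c: "\<And>i j. i < Suc n \<Longrightarrow> j < Suc n \<Longrightarrow> f i j \<in> carrier G" using Suc.prems by auto
  have "(\<Oplus>i\<in>{..<Suc n}. \<Oplus>j\<in>{..<Suc n}. f i j)
      = (\<Oplus>i\<in>{..<n}. \<Oplus>j\<in>{..<Suc n}. f i j) \<oplus> (\<Oplus>j\<in>{..<Suc n}. f n j)"
    by (subst finsum_lessThan_Suc) (auto intro!: finsum_closed c)
  also have "(\<Oplus>i\<in>{..<n}. \<Oplus>j\<in>{..<Suc n}. f i j) = (\<Oplus>i\<in>{..<n}. (\<Oplus>j\<in>{..<n}. f i j) \<oplus> f i n)"
    by (intro finsum_cong' finsum_lessThan_Suc) (auto intro!: finsum_closed c)
  also have "\<dots> = (\<Oplus>i\<in>{..<n}. f i n)"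
    using c by (subst finsum_addf) (auto simp: IH intro!: finsum_closed l_zero)
  also have "(\<Oplus>j\<in>{..<Suc n}. f n j) = (\<Oplus>j\<in>{..<n}. f n j)"
    using c Suc.prems(2)[of n] by (subst finsum_lessThan_Suc) (auto intro!: finsum_closed r_zero)
  also have "(\<Oplus>i\<in>{..<n}. f i n) \<oplus> (\<Oplus>j\<in>{..<n}. f n j) = (\<Oplus>i\<in>{..<n}. f i n \<oplus> f n i)"
    using c by (subst finsum_addf) auto
  also have "\<dots> = \<zero>" using Suc.prems(3) by (intro add.finprod_one_eqI) auto
  finally show ?case .
qed

section \<open>Words, tensor powers and signed pure tensors\<close>

lemma word_deg_simps [simp]:
  "word_deg [] = 0" "word_deg (x # w) = fst x + word_deg w" "word_deg (u @ v) = word_deg u + word_deg v"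
  "word_deg (rev w) = word_deg w"
  by (auto simp: word_deg_def rev_map[symmetric])

lemma deg_pairs_snoc: "deg_pairs (w @ [x]) = deg_pairs w + word_deg w * fst x"
proof -
  have "deg_pairs (w @ [x]) = (\<Sum>j<length w. \<Sum>i<j. fst ((w @ [x]) ! i) * fst ((w @ [x]) ! j))
      + (\<Sum>i<length w. fst ((w @ [x]) ! i) * fst x)"
    by (simp add: deg_pairs_def)
  also have "(\<Sum>j<length w. \<Sum>i<j. fst ((w @ [x]) ! i) * fst ((w @ [x]) ! j)) = deg_pairs w"
    unfolding deg_pairs_def by (intro sum.cong) (auto simp: nth_append)
  also have "(\<Sum>i<length w. fst ((w @ [x]) ! i) * fst x) = (\<Sum>i<length w. fst (w ! i)) * fst x"
    by (simp add: nth_append sum_distrib_right)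
  also have "(\<Sum>i<length w. fst (w ! i)) = word_deg w"
    by (simp add: word_deg_def sum_list_sum_nth atLeast0LessThan)
  finally show ?thesis .
qed

lemma deg_pairs_append: "deg_pairs (u @ v) = deg_pairs u + deg_pairs v + word_deg u * word_deg v"
proof (induction v rule: rev_induct)
  case Nil then show ?case by (simp add: deg_pairs_def)
next
  case (snoc x v)
  have "deg_pairs (u @ v @ [x]) = deg_pairs ((u @ v) @ [x])" by simp
  then show ?case using snoc by (simp only: deg_pairs_snoc) (simp add: algebra_simps)
qed

lemma deg_pairs_simps [simp]: "deg_pairs [] = 0" "deg_pairs [x] = 0"
  by (auto simp: deg_pairs_def)

lemma deg_pairs_Cons: "deg_pairs (x # v) = deg_pairs v + fst x * word_deg v"
  using deg_pairs_append[of "[x]" v] by simp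

context graded_module
begin

abbreviation T where "T \<equiv> tpow K A"
abbreviation cyc where "cyc \<equiv> M_t K A"

definition letters :: "(int \<times> 'a) list \<Rightarrow> bool"
  where "letters w \<longleftrightarrow> (\<forall>(q, a)\<in>set w. a \<in> carrier (A q))"

lemma letters_simps [simp]:
  "letters []" "letters (x # w) \<longleftrightarrow> snd x \<in> carrier (A (fst x)) \<and> letters w"
  "letters (u @ v) \<longleftrightarrow> letters u \<and> letters v" "letters (rev w) \<longleftrightarrow> letters w"
  by (auto simp: letters_def case_prod_beta)

lemma tensor_words_iff: "w \<in> tensor_words A N m \<longleftrightarrow> letters w \<and> length w = N \<and> word_deg w = m"
  by (auto simp: tensor_words_def letters_def)

lemma K_cring: "cring K" by (rule module.axioms(1)[OF graded_module])

lemma T_module: "module K (T N m)" by (rule tpow_module[OF graded_module_axioms])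

lemma tensor_free_module: "module K (tensor_free K A N m)"
  unfolding tensor_free_def by (rule free_mod_module[OF K_cring])

lemma relator_span: "submodule (submod_span K (tensor_free K A N m) (tensor_relators K A N m)) K (tensor_free K A N m)"
  by (rule submod_span_submodule[OF tensor_free_module tensor_relators_carrier[OF graded_module_axioms]])

lemma ptens_coset:
  "w \<in> tensor_words A N m \<Longrightarrow>
    ptens K A w = submod_span K (tensor_free K A N m) (tensor_relators K A N m) +>\<^bsub>tensor_free K A N m\<^esub> free_gen K w"
  by (auto simp: ptens_def Let_def tensor_words_def word_deg_def)

lemma free_gen_word: "w \<in> tensor_words A N m \<Longrightarrow> free_gen K w \<in> carrier (tensor_free K A N m)"
  unfolding tensor_free_def by (rule free_gen_carrier[OF K_cring])

lemma coset_projection: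
  "(\<lambda>f. submod_span K (tensor_free K A N m) (tensor_relators K A N m) +>\<^bsub>tensor_free K A N m\<^esub> f)
    \<in> lin_maps K (tensor_free K A N m) (T N m)"
  unfolding tpow_def
  by (rule lin_mapsI)
    (auto simp: quot_mod_module(2,3)[OF tensor_free_module relator_span],
      auto simp: quot_mod_def A_RCOSETS_def')

lemma T_carrier:
  "carrier (T N m) = (\<lambda>f. submod_span K (tensor_free K A N m) (tensor_relators K A N m) +>\<^bsub>tensor_free K A N m\<^esub> f)
     ` carrier (tensor_free K A N m)"
  by (auto simp: tpow_def quot_mod_def A_RCOSETS_def')

lemma ptens_closed: "w \<in> tensor_words A N m \<Longrightarrow> ptens K A w \<in> carrier (T N m)"
  using lin_mapsD(1)[OF coset_projection free_gen_word] by (simp add: ptens_coset)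

text \<open>Pure tensors span, so a linear map is determined by its values on words.\<close>

lemma tensor_ext:
  assumes "module K M" "h \<in> lin_maps K (T N m) M" "h' \<in> lin_maps K (T N m) M"
    and "\<And>w. w \<in> tensor_words A N m \<Longrightarrow> h (ptens K A w) = h' (ptens K A w)"
    and "x \<in> carrier (T N m)"
  shows "h x = h' x"
proof -
  let ?c = "\<lambda>f. submod_span K (tensor_free K A N m) (tensor_relators K A N m) +>\<^bsub>tensor_free K A N m\<^esub> f"
  obtain f where f: "f \<in> carrier (tensor_free K A N m)" "x = ?c f" using assms(5) T_carrier by auto
  have "h (?c f) = h' (?c f)"
  proof (rule lin_maps_free_unique[OF K_cring assms(1), of "\<lambda>f. h (?c f)" _ "\<lambda>f. h' (?c f)"])
    show "(\<lambda>f. h (?c f)) \<in> lin_maps K (free_mod K (tensor_words A N m)) M"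
      "(\<lambda>f. h' (?c f)) \<in> lin_maps K (free_mod K (tensor_words A N m)) M"
      using lin_comp[OF coset_projection assms(2)] lin_comp[OF coset_projection assms(3)]
      by (simp_all add: tensor_free_def)
    show "f \<in> carrier (free_mod K (tensor_words A N m))" using f by (simp add: tensor_free_def)
  qed (use assms(4) in \<open>simp add: ptens_coset[symmetric]\<close>)
  then show ?thesis using f by simp
qed

lemma coset_eqI:
  assumes "module K F" "submodule H K F" "x \<in> carrier F" "y \<in> carrier F" "x \<ominus>\<^bsub>F\<^esub> y \<in> H"
  shows "H +>\<^bsub>F\<^esub> x = H +>\<^bsub>F\<^esub> y"
proof -
  interpret F: module K F by fact
  interpret H: submodule H K F by fact
  interpret Ab: abelian_subgroup H F
    by (rule abelian_subgroupI3) (unfold_locales, auto intro: additive_subgroupI H.subgroup_axioms)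
  have "x = (x \<ominus>\<^bsub>F\<^esub> y) \<oplus>\<^bsub>F\<^esub> y"
    using assms(3,4) by (simp add: a_minus_def F.M.a_assoc F.M.l_neg)
  then have "x \<in> H +>\<^bsub>F\<^esub> y" using assms(5) unfolding a_r_coset_def' by blast
  then show ?thesis using Ab.a_repr_independence' assms(4) by metis
qed

text \<open>A pure tensor is linear in each letter; this is the only way in which the relators enter.\<close>

lemma ptens_slot:
  assumes "letters u" "letters v" "length u + 1 + length v = N" "word_deg u + q + word_deg v = m"
  shows "(\<lambda>a. ptens K A (u @ (q, a) # v)) \<in> lin_maps K (A q) (T N m)"
proof (rule lin_mapsI)
  let ?F = "tensor_free K A N m" and ?R = "tensor_relators K A N m"
  let ?H = "submod_span K ?F ?R"
  interpret F: module K ?F by (rule tensor_free_module)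
  interpret Aq: module K "A q" by (rule graded_module)
  have w: "u @ (q, a) # v \<in> tensor_words A N m" if "a \<in> carrier (A q)" for a
    using assms that by (auto simp: tensor_words_iff)
  have pc: "ptens K A (u @ (q, a) # v) = ?H +>\<^bsub>?F\<^esub> free_gen K (u @ (q, a) # v)" if "a \<in> carrier (A q)" for a
    using ptens_coset[OF w[OF that]] .
  have RH: "x \<in> ?H" if "x \<in> ?R" for x using that by (auto simp: submod_span_def)
  fix a assume a: "a \<in> carrier (A q)"
  then show "ptens K A (u @ (q, a) # v) \<in> carrier (T N m)" by (intro ptens_closed w)
  {
    fix b assume b: "b \<in> carrier (A q)"
    have "?H +>\<^bsub>?F\<^esub> free_gen K (u @ (q, a \<oplus>\<^bsub>A q\<^esub> b) # v)
        = ?H +>\<^bsub>?F\<^esub> (free_gen K (u @ (q, a) # v) \<oplus>\<^bsub>?F\<^esub> free_gen K (u @ (q, b) # v))"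
    proof (intro coset_eqI[OF tensor_free_module relator_span] RH)
      show "free_gen K (u @ (q, a \<oplus>\<^bsub>A q\<^esub> b) # v)
          \<ominus>\<^bsub>?F\<^esub> (free_gen K (u @ (q, a) # v) \<oplus>\<^bsub>?F\<^esub> free_gen K (u @ (q, b) # v)) \<in> ?R"
        unfolding tensor_relators_def Let_def using w[OF a] w[OF b] by blast
    qed (use a b in \<open>auto intro!: F.M.a_closed free_gen_word w\<close>)
    then show "ptens K A (u @ (q, a \<oplus>\<^bsub>A q\<^esub> b) # v) = ptens K A (u @ (q, a) # v) \<oplus>\<^bsub>T N m\<^esub> ptens K A (u @ (q, b) # v)"
      using a b w by (simp add: pc lin_mapsD(2)[OF coset_projection] free_gen_word)
  next
    fix c assume c: "c \<in> carrier K"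
    have "?H +>\<^bsub>?F\<^esub> free_gen K (u @ (q, c \<odot>\<^bsub>A q\<^esub> a) # v) = ?H +>\<^bsub>?F\<^esub> (c \<odot>\<^bsub>?F\<^esub> free_gen K (u @ (q, a) # v))"
    proof (intro coset_eqI[OF tensor_free_module relator_span] RH)
      show "free_gen K (u @ (q, c \<odot>\<^bsub>A q\<^esub> a) # v) \<ominus>\<^bsub>?F\<^esub> (c \<odot>\<^bsub>?F\<^esub> free_gen K (u @ (q, a) # v)) \<in> ?R"
        unfolding tensor_relators_def Let_def using w[OF a] c by blast
    qed (use a c in \<open>auto intro!: F.smult_closed free_gen_word w\<close>)
    then show "ptens K A (u @ (q, c \<odot>\<^bsub>A q\<^esub> a) # v) = c \<odot>\<^bsub>T N m\<^esub> ptens K A (u @ (q, a) # v)"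
      using a c w by (simp add: pc lin_mapsD(3)[OF coset_projection] free_gen_word)
  }
qed

text \<open>Multilinearity, with the two conditions on each slot read as linearity of the map that inserts a
  letter there. Slot maps can then be built from linear maps by composition.\<close>

lemma tensor_multilinI:
  assumes "\<And>w. w \<in> tensor_words A N m \<Longrightarrow> g w \<in> carrier M"
    and "\<And>u q v. letters u \<Longrightarrow> letters v \<Longrightarrow> length u + 1 + length v = N \<Longrightarrow> word_deg u + q + word_deg v = m \<Longrightarrow>
      (\<lambda>a. g (u @ (q, a) # v)) \<in> lin_maps K (A q) M"
  shows "tensor_multilin K A N m M g"
  unfolding tensor_multilin_def
  using assms(1) lin_mapsD[OF assms(2)] by (auto simp: tensor_words_iff add.assoc)

text \<open>The pure tensor of a word with the sign $(-1)^e$. Length and degree of the word determine the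
  module that it lives in, so that calculations with signed pure tensors carry no indices.\<close>

definition sp :: "int \<Rightarrow> (int \<times> 'a) list \<Rightarrow> ((int \<times> 'a) list \<Rightarrow> 'k) set"
  where "sp e w = pm (T (length w) (word_deg w)) e (ptens K A w)"

lemma sp_closed: "letters w \<Longrightarrow> length w = N \<Longrightarrow> word_deg w = m \<Longrightarrow> sp e w \<in> carrier (T N m)"
  unfolding sp_def using module.pm_closed[OF T_module ptens_closed, of w N m e] by (auto simp: tensor_words_iff)

text \<open>Together with \<open>pm_sp\<close> this reduces every comparison of signs to a parity check.\<close>

lemma sp_parity: "even (e + e') \<Longrightarrow> sp e w = sp e' w"
  unfolding sp_def by (rule pm_parity)

lemma ptens_sp: "ptens K A w = sp 0 w"
  by (simp add: sp_def pm_def)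

lemma pm_ptens: "length w = N \<Longrightarrow> word_deg w = m \<Longrightarrow> pm (T N m) e (ptens K A w) = sp e w"
  by (auto simp: sp_def)

lemma pm_sp: "letters w \<Longrightarrow> length w = N \<Longrightarrow> word_deg w = m \<Longrightarrow> pm (T N m) e (sp e' w) = sp (e + e') w"
  unfolding sp_def using module.pm_pm[OF T_module ptens_closed, of w N m] by (auto simp: tensor_words_iff)

lemma sp_slot:
  assumes "letters u" "letters v" "length u + 1 + length v = N" "word_deg u + q + word_deg v = m"
  shows "(\<lambda>a. sp e (u @ (q, a) # v)) \<in> lin_maps K (A q) (T N m)"
  using lin_pm_map[OF T_module ptens_slot[OF assms], of e] assms(3,4)
  by (simp add: sp_def add.assoc)

lemma sp_slot_comp:
  assumes "h \<in> lin_maps K M (A q)" "letters u" "letters v" "length u + 1 + length v = N" "word_deg u + q + word_deg v = m"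
  shows "(\<lambda>a. sp e (u @ (q, h a) # v)) \<in> lin_maps K M (T N m)"
  by (rule lin_comp[OF assms(1) sp_slot[OF assms(2-5)]])

lemma sp_zero:
  assumes "letters u" "letters v" "length u + 1 + length v = N" "word_deg u + q + word_deg v = m"
  shows "sp e (u @ (q, \<zero>\<^bsub>A q\<^esub>) # v) = \<zero>\<^bsub>T N m\<^esub>"
  by (rule lin_zero[OF graded_module T_module sp_slot[OF assms]])

lemma tensor_lift_sp:
  assumes "module K M" "tensor_multilin K A N m M g" "letters w" "length w = N" "word_deg w = m"
  shows "tensor_lift K A N m M g (sp c w) = pm M c (g w)"
proof -
  have w: "w \<in> tensor_words A N m" using assms by (simp add: tensor_words_iff)
  note tl = tensor_lift[OF graded_module_axioms assms(1,2)]
  have "tensor_lift K A N m M g (pm (T N m) c (ptens K A w)) = pm M c (tensor_lift K A N m M g (ptens K A w))"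
    by (rule lin_pm[OF T_module assms(1) tl(1) ptens_closed[OF w]])
  then show ?thesis using tl(2)[OF w] assms by (simp add: pm_ptens)
qed

lemma tensor_ext_sp:
  assumes "module K M" "h \<in> lin_maps K (T N m) M" "h' \<in> lin_maps K (T N m) M"
    and "\<And>w. letters w \<Longrightarrow> length w = N \<Longrightarrow> word_deg w = m \<Longrightarrow> h (sp 0 w) = h' (sp 0 w)"
    and "x \<in> carrier (T N m)"
  shows "h x = h' x"
  using tensor_ext[OF assms(1-3) _ assms(5)] assms(4) by (simp add: tensor_words_iff ptens_sp)

text \<open>A word of negative degree has a letter of negative degree, which is zero.\<close>

lemma T_neg:
  assumes "m < 0" shows "carrier (T N m) = {\<zero>\<^bsub>T N m\<^esub>}"
proof -
  interpret M: module K "T N m" by (rule T_module)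
  have "x = \<zero>\<^bsub>T N m\<^esub>" if x: "x \<in> carrier (T N m)" for x
  proof (rule tensor_ext_sp[OF T_module lin_id lin_zero_map[OF T_module] _ x])
    fix w assume w: "letters w" "length w = N" "word_deg w = m"
    have "\<exists>x\<in>set w. fst x < 0"
    proof (rule ccontr)
      assume "\<not> ?thesis"
      then have "0 \<le> word_deg w" unfolding word_deg_def by (intro sum_list_nonneg) auto
      then show False using w assms by simp
    qed
    then obtain u q a v where uv: "w = u @ (q, a) # v" "q < 0" by (force simp: in_set_conv_decomp)
    then have "a = \<zero>\<^bsub>A q\<^esub>" using w(1) graded_neg[OF uv(2)] by auto
    then show "sp 0 w = \<zero>\<^bsub>T N m\<^esub>" using w uv sp_zero[of u v N q m 0] by simp
  qed
  then show ?thesis by auto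
qed

lemma M_t_multilin: "tensor_multilin K A (n + 1) m (T (n + 1) m)
    (\<lambda>w. pm (T (n + 1) m) (fst (last w) * word_deg (butlast w)) (ptens K A (last w # butlast w)))"
proof (rule tensor_multilinI)
  fix w assume "w \<in> tensor_words A (n + 1) m"
  then obtain u b where w: "w = u @ [b]" "letters (u @ [b])" "length (b # u) = n + 1" "word_deg (b # u) = m"
    by (cases w rule: rev_exhaust) (auto simp: tensor_words_iff)
  then show "pm (T (n + 1) m) (fst (last w) * word_deg (butlast w)) (ptens K A (last w # butlast w)) \<in> carrier (T (n + 1) m)"
    by (intro module.pm_closed[OF T_module] ptens_closed) (auto simp: tensor_words_iff)
next
  fix u v :: "(int \<times> 'a) list" and q
  assume *: "letters u" "letters v" "length u + 1 + length v = n + 1" "word_deg u + q + word_deg v = m"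
  show "(\<lambda>a. pm (T (n + 1) m) (fst (last (u @ (q, a) # v)) * word_deg (butlast (u @ (q, a) # v)))
         (ptens K A (last (u @ (q, a) # v) # butlast (u @ (q, a) # v)))) \<in> lin_maps K (A q) (T (n + 1) m)"
  proof (cases v rule: rev_exhaust)
    case Nil
    then show ?thesis using sp_slot[of "[]" u "n + 1" q m "q * word_deg u"] * by (simp add: pm_ptens)
  next
    case (snoc v' b)
    then have "(\<lambda>a. sp (fst b * word_deg (u @ (q, a) # v')) ((b # u) @ (q, a) # v')) \<in> lin_maps K (A q) (T (n + 1) m)"
      using * sp_slot[of "b # u" v' "n + 1" q m "fst b * (word_deg u + (q + word_deg v'))"] by simp
    moreover have "butlast (u @ (q, a) # v) = u @ (q, a) # v'" "last (u @ (q, a) # v) = b" for a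
      using snoc by (simp_all add: butlast_append)
    ultimately show ?thesis using * snoc by (simp add: pm_ptens)
  qed
qed

lemma M_t_lin: "cyc n m \<in> lin_maps K (T (n + 1) m) (T (n + 1) m)"
  unfolding M_t_def M_obj_def by (rule tensor_lift(1)[OF graded_module_axioms T_module M_t_multilin])

lemma M_t_sp:
  assumes "letters (u @ [b])" "length u = n" "word_deg u + fst b = m"
  shows "cyc n m (sp c (u @ [b])) = sp (c + fst b * word_deg u) (b # u)"
  unfolding M_t_def M_obj_def
  using assms by (subst tensor_lift_sp[OF T_module M_t_multilin]) (auto simp: pm_ptens pm_sp)

text \<open>The values of \<open>tensor_insert\<close> on words.\<close>

definition insert_word :: "nat \<Rightarrow> nat \<Rightarrow> nat \<Rightarrow> int \<Rightarrow> (int \<Rightarrow> ((int \<times> 'a) list \<Rightarrow> 'k) set \<Rightarrow> 'a) \<Rightarrow> int \<Rightarrow>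
    (int \<times> 'a) list \<Rightarrow> ((int \<times> 'a) list \<Rightarrow> 'k) set"
  where "insert_word j l s e f m w = (let u = take j w; y = take l (drop j w); v = drop (j + l) w in
        pm (T (j + 1 + s) (m + e)) (e * word_deg u)
          (ptens K A (u @ (word_deg y + e, f (word_deg y) (ptens K A y)) # v)))"

lemma insert_word_append:
  assumes "length u = j" "length y = l" "length v = s" "word_deg u + word_deg y + word_deg v = m"
  shows "insert_word j l s e f m (u @ y @ v)
    = sp (e * word_deg u) (u @ (word_deg y + e, f (word_deg y) (ptens K A y)) # v)"
  using assms by (simp add: insert_word_def pm_ptens)

lemma word_split3:
  assumes "length w = j + l + s"
  obtains u y v where "w = u @ y @ v" "length u = j" "length y = l" "length v = s"
proof (rule that)
  show "w = take j w @ take l (drop j w) @ drop l (drop j w)" by (simp only: append_take_drop_id)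
qed (use assms in auto)

lemma insert_multilin:
  assumes f: "\<And>q. f q \<in> lin_maps K (T l q) (A (q + e))"
  shows "tensor_multilin K A (j + l + s) m (T (j + 1 + s) (m + e)) (insert_word j l s e f m)"
proof (rule tensor_multilinI)
  fix w assume w: "w \<in> tensor_words A (j + l + s) m"
  then have "length w = j + l + s" by (simp add: tensor_words_iff)
  then obtain u y v where uyv: "w = u @ y @ v" "length u = j" "length y = l" "length v = s"
    by (rule word_split3)
  have "ptens K A y \<in> carrier (T l (word_deg y))"
    using w uyv by (intro ptens_closed) (auto simp: tensor_words_iff)
  then have "f (word_deg y) (ptens K A y) \<in> carrier (A (word_deg y + e))" using lin_mapsD(1)[OF f] by simp
  then show "insert_word j l s e f m w \<in> carrier (T (j + 1 + s) (m + e))"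
    using w uyv by (auto simp: insert_word_append tensor_words_iff intro!: sp_closed)
next
  fix u v :: "(int \<times> 'a) list" and q
  assume *: "letters u" "letters v" "length u + 1 + length v = j + l + s" "word_deg u + q + word_deg v = m"
  have set_face: "f (word_deg y) (ptens K A y) \<in> carrier (A (word_deg y + e))" if "letters y" "length y = l" for y
    using lin_mapsD(1)[OF f ptens_closed] that by (simp add: tensor_words_iff)
  consider (left) "length u < j" | (mid) "j \<le> length u" "length u < j + l" | (right) "j + l \<le> length u" by linarith
  then show "(\<lambda>a. insert_word j l s e f m (u @ (q, a) # v)) \<in> lin_maps K (A q) (T (j + 1 + s) (m + e))"
  proof cases
    case left
    then have "length v = (j - length u - 1) + l + s" using * by simp
    then obtain v1 y v2 where v: "v = v1 @ y @ v2" "length v1 = j - length u - 1" "length y = l" "length v2 = s"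
      by (rule word_split3)
    let ?b = "(word_deg y + e, f (word_deg y) (ptens K A y))"
    have "insert_word j l s e f m (u @ (q, a) # v)
      = sp (e * (word_deg u + (q + word_deg v1))) (u @ (q, a) # v1 @ ?b # v2)" for a
      using insert_word_append[of "u @ (q, a) # v1" j y l v2 s m e f] v left * by simp
    then show ?thesis using sp_slot[of u "v1 @ ?b # v2"] left v * set_face[of y] by simp
  next
    case mid
    obtain u1 y1 where u: "u = u1 @ y1" "length u1 = j"
      using that[of "take j u" "drop j u"] mid by simp
    then have y1: "length y1 < l" using mid by simp
    obtain y2 v2 where v': "v = y2 @ v2" "length y2 = l - length y1 - 1"
      using that[of "take (l - length y1 - 1) v" "drop (l - length y1 - 1) v"] * u y1 by simp
    then have y2: "length y1 + Suc (length y2) = l" using y1 by simp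
    then have v2: "length v2 = s" using * u v' by simp
    let ?q = "word_deg y1 + (q + word_deg y2)"
    have "insert_word j l s e f m (u @ (q, a) # v)
      = sp (e * word_deg u1) (u1 @ (?q + e, f ?q (ptens K A (y1 @ (q, a) # y2))) # v2)" for a
      using insert_word_append[of u1 j "y1 @ (q, a) # y2" l v2 s m e f] v'(1) v2 y2 u * by simp
    moreover have "(\<lambda>a. sp (e * word_deg u1) (u1 @ (?q + e, f ?q (ptens K A (y1 @ (q, a) # y2))) # v2))
      \<in> lin_maps K (A q) (T (j + 1 + s) (m + e))"
    proof (rule sp_slot_comp)
      show "(\<lambda>a. f ?q (ptens K A (y1 @ (q, a) # y2))) \<in> lin_maps K (A q) (A (?q + e))"
        using u v'(1) v2 y2 * by (intro lin_comp[OF ptens_slot f]) auto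
    qed (use u v'(1) v2 y2 * in auto)
    ultimately show ?thesis by simp
  next
    case right
    then have "length u = j + l + (length u - j - l)" by simp
    then obtain u1 y u2 where u: "u = u1 @ y @ u2" "length u1 = j" "length y = l"
      by (rule word_split3)
    let ?b = "(word_deg y + e, f (word_deg y) (ptens K A y))"
    have "insert_word j l s e f m (u @ (q, a) # v) = sp (e * word_deg u1) ((u1 @ ?b # u2) @ (q, a) # v)" for a
      using insert_word_append[of u1 j y l "u2 @ (q, a) # v" s m e f] u right * by simp
    then show ?thesis using sp_slot[of "u1 @ ?b # u2" v] right u * set_face[of y] by simp
  qed
qed

lemma tensor_insert_lift:
  "tensor_insert K A j l s e f m = tensor_lift K A (j + l + s) m (T (j + 1 + s) (m + e)) (insert_word j l s e f m)"
  unfolding tensor_insert_def by (rule arg_cong[of _ _ "tensor_lift K A _ _ _"]) (simp add: insert_word_def fun_eq_iff)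

lemma tensor_insert_lin:
  assumes "\<And>q. f q \<in> lin_maps K (T l q) (A (q + e))"
  shows "tensor_insert K A j l s e f m \<in> lin_maps K (T (j + l + s) m) (T (j + 1 + s) (m + e))"
  unfolding tensor_insert_lift
  by (rule tensor_lift(1)[OF graded_module_axioms T_module insert_multilin[OF assms]])

lemma tensor_insert_sp:
  assumes "\<And>q. f q \<in> lin_maps K (T l q) (A (q + e))"
    and "letters (u @ y @ v)" "length u = j" "length y = l" "length v = s" "word_deg u + word_deg y + word_deg v = m"
  shows "tensor_insert K A j l s e f m (sp c (u @ y @ v))
    = sp (c + e * word_deg u) (u @ (word_deg y + e, f (word_deg y) (ptens K A y)) # v)"
proof -
  have "f (word_deg y) (ptens K A y) \<in> carrier (A (word_deg y + e))"
    using lin_mapsD(1)[OF assms(1) ptens_closed] assms by (simp add: tensor_words_iff)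
  then show ?thesis
    unfolding tensor_insert_lift using assms(2-)
    by (subst tensor_lift_sp[OF T_module insert_multilin[OF assms(1)]]) (auto simp: insert_word_append pm_sp)
qed

end

context differential_module
begin

abbreviation bd where "bd \<equiv> tensor_diff K A d"

definition diff_letter :: "int \<times> 'a \<Rightarrow> int \<times> 'a"
  where "diff_letter x = (fst x - 1, d (fst x) (snd x))"

lemma diff_letter_closed [simp]: "snd x \<in> carrier (A (fst x)) \<Longrightarrow> snd (diff_letter x) \<in> carrier (A (fst x - 1))"
  using lin_mapsD(1)[OF diff_lin] by (simp add: diff_letter_def)

lemma fst_diff_letter [simp]: "fst (diff_letter x) = fst x - 1" by (simp add: diff_letter_def)

lemma letters_nth: "letters w \<Longrightarrow> i < length w \<Longrightarrow> snd (w ! i) \<in> carrier (A (fst (w ! i)))"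
  unfolding letters_def using nth_mem by (fastforce simp: case_prod_beta)

lemma letters_update: "letters w \<Longrightarrow> snd x \<in> carrier (A (fst x)) \<Longrightarrow> letters (w[i := x])"
  unfolding letters_def using set_update_subset_insert[of w i x] by (force simp: case_prod_beta)

lemma word_deg_update: "i < length w \<Longrightarrow> word_deg (w[i := x]) = word_deg w - fst (w ! i) + fst x"
  using arg_cong[OF id_take_nth_drop[of i w], of word_deg] by (simp add: upd_conv_take_nth_drop)

lemma diff_word_term:
  assumes "letters w" "length w = N" "word_deg w = m" "i < N"
  shows "sp e (w[i := diff_letter (w ! i)]) \<in> carrier (T N (m - 1))"
  using assms by (intro sp_closed) (auto simp: letters_nth letters_update word_deg_update)

text \<open>A term of the differential is linear in the letter of a slot in each of the three positions that
  the slot can have relative to the letter that is differentiated.\<close>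

lemma diff_multilin: "tensor_multilin K A N m (T N (m - 1))
    (\<lambda>w. \<Oplus>\<^bsub>T N (m - 1)\<^esub>i\<in>{..<N}. pm (T N (m - 1)) (word_deg (take i w))
         (ptens K A (w[i := (fst (w ! i) - 1, d (fst (w ! i)) (snd (w ! i)))])))"
  unfolding diff_letter_def[symmetric]
proof (rule tensor_multilinI)
  interpret M: module K "T N (m - 1)" by (rule T_module)
  {
    fix w assume "w \<in> tensor_words A N m"
    then have "pm (T N (m - 1)) (word_deg (take i w)) (ptens K A (w[i := diff_letter (w ! i)])) \<in> carrier (T N (m - 1))"
      if "i < N" for i
      using diff_word_term[of w N m i "word_deg (take i w)"] that by (auto simp: pm_ptens word_deg_update tensor_words_iff)
    then show "(\<Oplus>\<^bsub>T N (m - 1)\<^esub>i\<in>{..<N}. pm (T N (m - 1)) (word_deg (take i w))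
         (ptens K A (w[i := diff_letter (w ! i)]))) \<in> carrier (T N (m - 1))"
      by (intro M.M.finsum_closed) auto
  next
    fix u v :: "(int \<times> 'a) list" and q
    assume *: "letters u" "letters v" "length u + 1 + length v = N" "word_deg u + q + word_deg v = m"
    show "(\<lambda>a. \<Oplus>\<^bsub>T N (m - 1)\<^esub>i\<in>{..<N}. pm (T N (m - 1)) (word_deg (take i (u @ (q, a) # v)))
         (ptens K A ((u @ (q, a) # v)[i := diff_letter ((u @ (q, a) # v) ! i)]))) \<in> lin_maps K (A q) (T N (m - 1))"
    proof (rule lin_finsum_map[OF graded_module T_module])
      fix i assume i: "i \<in> {..<N}"
      consider (left) "i < length u" | (mid) "i = length u" | (right) k where "i = length u + Suc k" "k < length v"
      proof -
        show thesis
        proof (cases "i \<le> length u")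
          case True then show ?thesis using left mid by linarith
        next
          case False
          then show ?thesis using right[of "i - length u - 1"] i * by simp
        qed
      qed
      then show "(\<lambda>a. pm (T N (m - 1)) (word_deg (take i (u @ (q, a) # v)))
         (ptens K A ((u @ (q, a) # v)[i := diff_letter ((u @ (q, a) # v) ! i)]))) \<in> lin_maps K (A q) (T N (m - 1))"
      proof cases
        case left
        then show ?thesis
          using sp_slot[of "u[i := diff_letter (u ! i)]" v N q "m - 1" "word_deg (take i u)"] *
          by (simp add: nth_append list_update_append word_deg_update pm_ptens letters_nth letters_update)
      next
        case mid
        then show ?thesis
          using sp_slot_comp[OF diff_lin, of u v N q "m - 1" "word_deg u"] *
          by (simp add: nth_append list_update_append diff_letter_def pm_ptens)
      next
        case (right k)
        then show ?thesis
          using sp_slot[of u "v[k := diff_letter (v ! k)]" N q "m - 1" "word_deg u + (q + word_deg (take k v))"] *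
          by (simp add: nth_append list_update_append word_deg_update pm_ptens letters_nth letters_update)
      qed
    qed
  }
qed

lemma tensor_diff_lin: "bd N m \<in> lin_maps K (T N m) (T N (m - 1))"
  unfolding tensor_diff_def by (rule tensor_lift(1)[OF graded_module_axioms T_module diff_multilin])

lemma tensor_diff_sp:
  assumes "letters w" "length w = N" "word_deg w = m"
  shows "bd N m (sp c w)
    = (\<Oplus>\<^bsub>T N (m - 1)\<^esub>i\<in>{..<N}. sp (c + word_deg (take i w)) (w[i := diff_letter (w ! i)]))"
proof -
  interpret M: module K "T N (m - 1)" by (rule T_module)
  note t = diff_word_term[OF assms]
  have e: "pm (T N (m - 1)) e (ptens K A (w[i := diff_letter (w ! i)])) = sp e (w[i := diff_letter (w ! i)])" if "i < N" for i e
    using assms that by (simp add: pm_ptens word_deg_update)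
  have "bd N m (sp c w) = pm (T N (m - 1)) c
    (\<Oplus>\<^bsub>T N (m - 1)\<^esub>i\<in>{..<N}. pm (T N (m - 1)) (word_deg (take i w)) (ptens K A (w[i := diff_letter (w ! i)])))"
    unfolding tensor_diff_def by (subst tensor_lift_sp[OF T_module diff_multilin assms]) (simp add: diff_letter_def)
  also have "\<dots> = (\<Oplus>\<^bsub>T N (m - 1)\<^esub>i\<in>{..<N}. pm (T N (m - 1)) c (pm (T N (m - 1)) (word_deg (take i w)) (ptens K A (w[i := diff_letter (w ! i)]))))"
    using t e by (intro M.pm_finsum) auto
  also have "\<dots> = (\<Oplus>\<^bsub>T N (m - 1)\<^esub>i\<in>{..<N}. sp (c + word_deg (take i w)) (w[i := diff_letter (w ! i)]))"
    using t e assms by (intro M.M.finsum_cong')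
      (auto simp: pm_sp letters_nth letters_update word_deg_update)
  finally show ?thesis .
qed

end

section \<open>The cyclic operator, the reflection and the differential\<close>

lemma lin_funpow: "h \<in> lin_maps K M M \<Longrightarrow> h ^^ i \<in> lin_maps K M M"
proof (induction i)
  case 0 then show ?case using lin_id by (simp add: id_def)
next
  case (Suc i)
  then show ?case using lin_comp[OF Suc.IH[OF Suc.prems] Suc.prems] by (simp add: o_def)
qed

context graded_module
begin

lemma sp_cancel:
  assumes "odd (e + e')" "letters w" "length w = N" "word_deg w = m"
  shows "sp e w \<oplus>\<^bsub>T N m\<^esub> sp e' w = \<zero>\<^bsub>T N m\<^esub>"
  using module.pm_cancel[OF T_module ptens_closed[of w N m] assms(1)] assms by (simp add: pm_ptens tensor_words_iff)

text \<open>Moving the letters of \<open>y\<close> one by one past all other letters gives the Koszul sign of moving \<open>y\<close>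
  past \<open>u\<close>: the signs among the letters of \<open>y\<close> occur twice.\<close>

lemma M_t_pow_sp:
  assumes "letters (u @ y)" "length u + length y = n + 1" "word_deg u + word_deg y = m"
  shows "(cyc n m ^^ length y) (sp c (u @ y)) = sp (c + word_deg y * word_deg u) (y @ u)"
  using assms
proof (induction y arbitrary: u c rule: rev_induct)
  case Nil then show ?case by simp
next
  case (snoc b y)
  have "cyc n m (sp c ((u @ y) @ [b])) = sp (c + fst b * word_deg (u @ y)) (b # u @ y)"
    using snoc.prems by (intro M_t_sp) auto
  then have "(cyc n m ^^ length (y @ [b])) (sp c (u @ y @ [b]))
      = (cyc n m ^^ length y) (sp (c + fst b * word_deg (u @ y)) ((b # u) @ y))"
    by (simp add: funpow_swap1)
  also have "\<dots> = sp (c + fst b * word_deg (u @ y) + word_deg y * word_deg (b # u)) (y @ b # u)"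
    using snoc.prems by (intro snoc.IH) auto
  also have "\<dots> = sp (c + word_deg (y @ [b]) * word_deg u) ((y @ [b]) @ u)"
    by (simp, rule sp_parity) auto
  finally show ?case .
qed

lemma M_t_cyclic:
  assumes "x \<in> carrier (T (n + 1) m)"
  shows "(cyc n m ^^ (n + 1)) x = x"
proof (rule tensor_ext_sp[OF T_module lin_funpow[OF M_t_lin] lin_id _ assms])
  fix w assume "letters w" "length w = n + 1" "word_deg w = m"
  then show "(cyc n m ^^ (n + 1)) (sp 0 w) = sp 0 w"
    using M_t_pow_sp[of "[]" w n m 0] by simp
qed

lemma M_t_closed: "x \<in> carrier (T (n + 1) m) \<Longrightarrow> cyc n m x \<in> carrier (T (n + 1) m)"
  by (rule lin_mapsD(1)[OF M_t_lin])

lemma M_t_pow_closed: "x \<in> carrier (T (n + 1) m) \<Longrightarrow> (cyc n m ^^ i) x \<in> carrier (T (n + 1) m)"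
  by (rule lin_mapsD(1)[OF lin_funpow[OF M_t_lin]])

lemma M_t_inj: "inj_on (cyc n m) (carrier (T (n + 1) m))"
proof (rule inj_onI)
  fix x y assume "x \<in> carrier (T (n + 1) m)" "y \<in> carrier (T (n + 1) m)" "cyc n m x = cyc n m y"
  then show "x = y" using M_t_cyclic[of x n m] M_t_cyclic[of y n m] by (simp add: funpow_swap1)
qed

lemma M_t_surj:
  assumes "x \<in> carrier (T (n + 1) m)"
  obtains y where "y \<in> carrier (T (n + 1) m)" "x = cyc n m y"
proof (rule that)
  show "(cyc n m ^^ n) x \<in> carrier (T (n + 1) m)" by (rule M_t_pow_closed[OF assms])
  show "x = cyc n m ((cyc n m ^^ n) x)" using M_t_cyclic[OF assms] by simp
qed

end

context differential_module
begin

lemma tensor_diff_closed: "x \<in> carrier (T N m) \<Longrightarrow> bd N m x \<in> carrier (T N (m - 1))"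
  by (rule lin_mapsD(1)[OF tensor_diff_lin])

lemma tensor_diff_square:
  assumes "x \<in> carrier (T N m)"
  shows "bd N (m - 1) (bd N m x) = \<zero>\<^bsub>T N (m - 2)\<^esub>"
proof -
  have "bd N (m - 1) (bd N m (sp 0 w)) = \<zero>\<^bsub>T N (m - 2)\<^esub>"
    if w: "letters w" "length w = N" "word_deg w = m" for w
  proof -
  interpret M: module K "T N (m - 2)" by (rule T_module)
  define v where "v i = w[i := diff_letter (w ! i)]" for i
  have v: "letters (v i)" "length (v i) = N" "word_deg (v i) = m - 1" if "i < N" for i
    using w that by (auto simp: v_def letters_update letters_nth word_deg_update)
  let ?f = "\<lambda>i j. sp (word_deg (take i w) + word_deg (take j (v i))) ((v i)[j := diff_letter (v i ! j)])"
  have set_face: "?f i j \<in> carrier (T N (m - 2))" if "i < N" "j < N" for i j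
    using diff_word_term[OF v[OF that(1)] that(2)] by simp
  have "bd N (m - 1) (bd N m (sp 0 w))
    = (\<Oplus>\<^bsub>T N (m - 2)\<^esub>i\<in>{..<N}. bd N (m - 1) (sp (word_deg (take i w)) (v i)))"
    using lin_finsum[OF T_module T_module tensor_diff_lin[of N "m - 1"], of "{..<N}" "\<lambda>i. sp (word_deg (take i w)) (v i)"] v
    by (simp add: tensor_diff_sp[OF w] v_def[symmetric] sp_closed)
  also have "\<dots> = (\<Oplus>\<^bsub>T N (m - 2)\<^esub>i\<in>{..<N}. \<Oplus>\<^bsub>T N (m - 2)\<^esub>j\<in>{..<N}. ?f i j)"
    using set_face v tensor_diff_sp[OF v] by (intro M.M.finsum_cong') (auto intro!: M.M.finsum_closed)
  also have "\<dots> = \<zero>\<^bsub>T N (m - 2)\<^esub>"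
  proof (rule M.M.finsum_alternating_square)
    fix i assume i: "i < N"
    obtain q a where x: "w ! i = (q, a)" "a \<in> carrier (A q)" using letters_nth[OF w(1), of i] i w(2) by (cases "w ! i") auto
    have "v i ! i = (q - 1, d q a)" using i w x by (simp add: v_def diff_letter_def)
    then have "(v i)[i := diff_letter (v i ! i)] = take i w @ (q - 2, \<zero>\<^bsub>A (q - 2)\<^esub>) # drop (Suc i) w"
      using i w x diff_diff[OF x(2)] by (simp add: v_def diff_letter_def upd_conv_take_nth_drop)
    moreover have "w = take i w @ (q, a) # drop (Suc i) w" using id_take_nth_drop[of i w] i w x by simp
    then have "letters (take i w)" "letters (drop (Suc i) w)" "word_deg (take i w) + (q + word_deg (drop (Suc i) w)) = m"
      using w by (metis letters_simps(2,3), metis letters_simps(2,3), metis word_deg_simps(2,3) fst_conv)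
    ultimately show "?f i i = \<zero>\<^bsub>T N (m - 2)\<^esub>" using i w by (simp only:) (rule sp_zero; simp)
  next
    fix i j assume ij: "i < j" "j < N"
    have "(v i)[j := diff_letter (v i ! j)] = (v j)[i := diff_letter (v j ! i)]"
      using ij w by (simp add: v_def list_update_swap)
    moreover have "word_deg (take j (v i)) = word_deg (take j w) - 1" "take i (v j) = take i w"
      using ij w by (simp_all add: v_def take_update_swap[of j] word_deg_update)
    moreover have "letters ((v j)[i := diff_letter (v j ! i)])" "length ((v j)[i := diff_letter (v j ! i)]) = N"
      "word_deg ((v j)[i := diff_letter (v j ! i)]) = m - 2"
      using v[of j] ij by (auto simp: letters_update letters_nth word_deg_update)
    ultimately show "?f i j \<oplus>\<^bsub>T N (m - 2)\<^esub> ?f j i = \<zero>\<^bsub>T N (m - 2)\<^esub>"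
      by (simp only:) (rule sp_cancel, auto)
  qed (use set_face in auto)
    finally show ?thesis .
  qed
  moreover have "(\<lambda>x. bd N (m - 1) (bd N m x)) \<in> lin_maps K (T N m) (T N (m - 2))"
    using lin_comp[OF tensor_diff_lin[of N m] tensor_diff_lin[of N "m - 1"]] by simp
  ultimately show ?thesis
    by (rule tensor_ext_sp[OF T_module _ lin_zero_map[OF T_module] _ assms, rotated])
qed

lemma tensor_power_differential_module: "differential_module K (T N) (bd N)"
proof (intro differential_module.intro graded_module.intro differential_module_axioms.intro)
  show "module K (T N q)" for q by (rule T_module)
  show "carrier (T N q) = {\<zero>\<^bsub>T N q\<^esub>}" if "q < 0" for q by (rule T_neg[OF that])
qed (simp_all add: tensor_diff_lin tensor_diff_square)

text \<open>The summands correspond to each other with a shift of the position by one; the last summand on one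
  side is the first one on the other.\<close>

lemma tensor_diff_M_t:
  assumes "x \<in> carrier (T (n + 1) m)"
  shows "bd (n + 1) m (cyc n m x) = cyc n (m - 1) (bd (n + 1) m x)"
proof (rule tensor_ext_sp[OF T_module lin_comp[OF M_t_lin tensor_diff_lin] lin_comp[OF tensor_diff_lin M_t_lin] _ assms])
  fix w assume w: "letters w" "length w = n + 1" "word_deg w = m"
  obtain u b where ub: "w = u @ [b]" using w by (cases w rule: rev_exhaust) auto
  have u: "letters u" "snd b \<in> carrier (A (fst b))" "length u = n" "word_deg u + fst b = m" using w ub by auto
  let ?M = "T (n + 1) (m - 1)"
  interpret M: module K ?M by (rule T_module)
  let ?f = "\<lambda>i. sp (word_deg (take i u) + fst b * (word_deg u - 1)) (b # u[i := diff_letter (u ! i)])"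
  let ?z = "sp (fst b * word_deg u) (diff_letter b # u)"
  have set_face: "?f i \<in> carrier ?M" if "i < n" for i
    using u that by (intro sp_closed) (auto simp: letters_update letters_nth word_deg_update)
  have zc: "?z \<in> carrier ?M" using u by (intro sp_closed) auto
  have "bd (n + 1) m (cyc n m (sp 0 w)) = bd (n + 1) m (sp (fst b * word_deg u) (b # u))"
    using u ub by (simp add: M_t_sp)
  also have "\<dots> = (\<Oplus>\<^bsub>?M\<^esub>i\<in>{..<Suc n}. sp (fst b * word_deg u + word_deg (take i (b # u))) ((b # u)[i := diff_letter ((b # u) ! i)]))"
    using u by (subst tensor_diff_sp) auto
  also have "\<dots> = ?z \<oplus>\<^bsub>?M\<^esub> (\<Oplus>\<^bsub>?M\<^esub>i\<in>{..<n}. sp (fst b * word_deg u + (fst b + word_deg (take i u))) (b # u[i := diff_letter (u ! i)]))"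
    using u diff_word_term[of "b # u" "n + 1" m] by (subst M.M.finsum_lessThan_Suc_shift) auto
  also have "(\<Oplus>\<^bsub>?M\<^esub>i\<in>{..<n}. sp (fst b * word_deg u + (fst b + word_deg (take i u))) (b # u[i := diff_letter (u ! i)]))
      = (\<Oplus>\<^bsub>?M\<^esub>i\<in>{..<n}. ?f i)"
    using set_face by (intro M.M.finsum_cong') (auto intro!: sp_parity)
  also have "?z \<oplus>\<^bsub>?M\<^esub> (\<Oplus>\<^bsub>?M\<^esub>i\<in>{..<n}. ?f i) = (\<Oplus>\<^bsub>?M\<^esub>i\<in>{..<n}. ?f i) \<oplus>\<^bsub>?M\<^esub> ?z"
    using set_face zc by (intro M.M.a_comm M.M.finsum_closed) auto
  also have "\<dots> = (\<Oplus>\<^bsub>?M\<^esub>i\<in>{..<Suc n}. cyc n (m - 1) (sp (word_deg (take i w)) (w[i := diff_letter (w ! i)])))"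
  proof -
    have f: "cyc n (m - 1) (sp (word_deg (take i w)) (w[i := diff_letter (w ! i)])) = ?f i" if "i < n" for i
      using u ub that M_t_sp[of "u[i := diff_letter (u ! i)]" b n "m - 1" "word_deg (take i u)"]
      by (simp add: nth_append list_update_append letters_update letters_nth word_deg_update)
    have "cyc n (m - 1) (sp (word_deg (take n w)) (w[n := diff_letter (w ! n)])) = sp (word_deg u + (fst b - 1) * word_deg u) (diff_letter b # u)"
      using u ub M_t_sp[of u "diff_letter b" n "m - 1" "word_deg u"] by (simp add: nth_append list_update_append)
    also have "\<dots> = ?z" by (rule sp_parity) auto
    finally have z: "cyc n (m - 1) (sp (word_deg (take n w)) (w[n := diff_letter (w ! n)])) = ?z" .
    have "(\<Oplus>\<^bsub>?M\<^esub>i\<in>{..<n}. ?f i) = (\<Oplus>\<^bsub>?M\<^esub>i\<in>{..<n}. cyc n (m - 1) (sp (word_deg (take i w)) (w[i := diff_letter (w ! i)])))"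
      using set_face f by (intro M.M.finsum_cong') auto
    then show ?thesis using set_face zc f z
      by (subst M.M.finsum_lessThan_Suc) (auto simp: less_Suc_eq)
  qed
  also have "\<dots> = cyc n (m - 1) (bd (n + 1) m (sp 0 w))"
    using lin_finsum[OF T_module T_module M_t_lin[of n "m - 1"], of "{..<Suc n}" "\<lambda>i. sp (word_deg (take i w)) (w[i := diff_letter (w ! i)])"]
      diff_word_term[OF w] unfolding tensor_diff_sp[OF w] by simp
  finally show "bd (n + 1) m (cyc n m (sp 0 w)) = cyc n (m - 1) (bd (n + 1) m (sp 0 w))" .
qed

end

lemma deg_pairs_rev [simp]: "deg_pairs (rev w) = deg_pairs w"
  by (induction w) (auto simp: deg_pairs_Cons deg_pairs_append)

text \<open>The involutive algebra with the sign $\varrho$. As an exponent (\<open>rho_exp\<close>) this sign takes part in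
  the parity calculations like all others.\<close>

locale signed_involutive_algebra = involutive_A_infinity_algebra K A d \<pi> star
  for K :: "('k, 'e) ring_scheme" and A :: "int \<Rightarrow> ('k, 'a) module" and d :: "int \<Rightarrow> 'a \<Rightarrow> 'a"
    and \<pi> :: "nat \<Rightarrow> int \<Rightarrow> ((int \<times> 'a) list \<Rightarrow> 'k) set \<Rightarrow> 'a"
    and star :: "int \<Rightarrow> 'a \<Rightarrow> 'a" +
  fixes \<rho> :: 'k
  assumes rho: "\<rho> \<in> {\<one>\<^bsub>K\<^esub>, \<ominus>\<^bsub>K\<^esub> \<one>\<^bsub>K\<^esub>}"
begin

abbreviation flip where "flip \<equiv> M_r K A star \<rho>"

definition rho_exp :: int
  where "rho_exp = (if \<rho> = \<one>\<^bsub>K\<^esub> then 0 else 1)"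

lemma rho_smult:
  assumes "module K M" "x \<in> carrier M" shows "\<rho> \<odot>\<^bsub>M\<^esub> x = pm M rho_exp x"
proof -
  interpret M: module K M by fact
  show ?thesis using rho assms by (auto simp: rho_exp_def pm_def M.smult_l_minus)
qed

definition star_letter :: "int \<times> 'a \<Rightarrow> int \<times> 'a"
  where "star_letter x = (fst x, star (fst x) (snd x))"

lemma star_letter_Pair: "star_letter (q, a) = (q, star q a)" by (simp add: star_letter_def)

lemma fst_star_letter [simp]: "fst (star_letter x) = fst x" by (simp add: star_letter_def)

lemma star_letter_closed [simp]: "snd x \<in> carrier (A (fst x)) \<Longrightarrow> snd (star_letter x) \<in> carrier (A (fst x))"
  using lin_mapsD(1)[OF star_lin] by (simp add: star_letter_def)

lemma star_star_letter [simp]: "snd x \<in> carrier (A (fst x)) \<Longrightarrow> star_letter (star_letter x) = x"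
  using star_star by (simp add: star_letter_def prod_eq_iff)

lemma star_diff_letter: "snd x \<in> carrier (A (fst x)) \<Longrightarrow> star_letter (diff_letter x) = diff_letter (star_letter x)"
  using star_diff by (simp add: star_letter_def diff_letter_def)

lemma letters_map_star [simp]: "letters w \<Longrightarrow> letters (map star_letter w)"
  by (induction w) auto

lemma word_deg_map_star [simp]: "word_deg (map star_letter w) = word_deg w"
  by (induction w) auto

lemma deg_pairs_map_star [simp]: "deg_pairs (map star_letter w) = deg_pairs w"
  by (induction w) (auto simp: deg_pairs_Cons)

lemma map_star_map_star [simp]: "letters w \<Longrightarrow> map star_letter (map star_letter w) = w"
  by (induction w) auto

text \<open>The values of $r_n$ on words.\<close>

definition r_word :: "nat \<Rightarrow> int \<Rightarrow> (int \<times> 'a) list \<Rightarrow> ((int \<times> 'a) list \<Rightarrow> 'k) set"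
  where "r_word n m w = (let w' = map (\<lambda>(q, a). (q, star q a)) w in
       \<rho> \<odot>\<^bsub>M_obj K A n m\<^esub> pm (M_obj K A n m) (deg_pairs (tl w)) (ptens K A (hd w' # rev (tl w'))))"

lemma r_word_Cons:
  assumes "letters (x # u)" "length u = n" "fst x + word_deg u = m"
  shows "r_word n m (x # u) = sp (rho_exp + deg_pairs u) (star_letter x # rev (map star_letter u))"
proof -
  have star_letter: "(\<lambda>(q, a). (q, star q a)) = star_letter" by (auto simp: star_letter_def)
  have "sp (deg_pairs u) (star_letter x # rev (map star_letter u)) \<in> carrier (T (n + 1) m)"
    using assms by (intro sp_closed) auto
  then show ?thesis unfolding r_word_def M_obj_def star_letter using assms
    by (simp add: pm_ptens rho_smult[OF T_module] pm_sp)
qed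

lemma M_r_multilin: "tensor_multilin K A (n + 1) m (T (n + 1) m) (r_word n m)"
proof (rule tensor_multilinI)
  fix w assume "w \<in> tensor_words A (n + 1) m"
  then obtain x u where w: "w = x # u" "letters (x # u)" "length u = n" "fst x + word_deg u = m"
    by (cases w) (auto simp: tensor_words_iff)
  then have "sp (rho_exp + deg_pairs u) (star_letter x # rev (map star_letter u)) \<in> carrier (T (n + 1) m)"
    by (intro sp_closed) auto
  then show "r_word n m w \<in> carrier (T (n + 1) m)"
    unfolding w(1) r_word_Cons[OF w(2-4)] .
next
  fix u v :: "(int \<times> 'a) list" and q
  assume *: "letters u" "letters v" "length u + 1 + length v = n + 1" "word_deg u + q + word_deg v = m"
  have rs: "r_word n m (u @ (q, a) # v) = pm (T (n + 1) m) rho_exp (sp (deg_pairs (tl (u @ (q, a) # v)))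
      (hd (map star_letter (u @ (q, a) # v)) # rev (tl (map star_letter (u @ (q, a) # v)))))" if "a \<in> carrier (A q)" for a
  proof (cases u)
    case Nil
    then show ?thesis using * that r_word_Cons[of "(q, a)" v n m] star_letter_closed[of "(q, a)"] by (simp add: pm_sp)
  next
    case (Cons x u')
    then show ?thesis
      using * that r_word_Cons[of x "u' @ (q, a) # v" n m] star_letter_closed[of "(q, a)"] by (simp add: pm_sp)
  qed
  have "(\<lambda>a. sp (deg_pairs (tl (u @ (q, a) # v))) (hd (map star_letter (u @ (q, a) # v)) # rev (tl (map star_letter (u @ (q, a) # v)))))
      \<in> lin_maps K (A q) (T (n + 1) m)"
  proof (cases u)
    case Nil
    then show ?thesis using * sp_slot_comp[OF star_lin, of "[]" "rev (map star_letter v)" "n + 1" q m "deg_pairs v"] by (simp add: star_letter_Pair)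
  next
    case (Cons x u')
    then show ?thesis
      using * sp_slot_comp[OF star_lin, of "star_letter x # rev (map star_letter v)" "rev (map star_letter u')" "n + 1" q m "deg_pairs (u' @ (q, undefined) # v)"]
      by (simp add: star_letter_Pair deg_pairs_append deg_pairs_Cons)
  qed
  then show "(\<lambda>a. r_word n m (u @ (q, a) # v)) \<in> lin_maps K (A q) (T (n + 1) m)"
    by (rule lin_maps_cong[OF graded_module lin_pm_map[OF T_module] rs])
qed

lemma M_r_lift: "flip n m = tensor_lift K A (n + 1) m (T (n + 1) m) (r_word n m)"
  unfolding M_r_def M_obj_def[symmetric] r_word_def[abs_def] by (simp add: M_obj_def)

lemma M_r_lin: "flip n m \<in> lin_maps K (T (n + 1) m) (T (n + 1) m)"
  unfolding M_r_lift by (rule tensor_lift(1)[OF graded_module_axioms T_module M_r_multilin])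

lemma M_r_closed: "x \<in> carrier (T (n + 1) m) \<Longrightarrow> flip n m x \<in> carrier (T (n + 1) m)"
  by (rule lin_mapsD(1)[OF M_r_lin])

lemma M_r_sp:
  assumes "letters (x # u)" "length u = n" "fst x + word_deg u = m"
  shows "flip n m (sp c (x # u)) = sp (c + rho_exp + deg_pairs u) (star_letter x # rev (map star_letter u))"
  unfolding M_r_lift using assms
  by (subst tensor_lift_sp[OF T_module M_r_multilin]) (auto simp: r_word_Cons pm_sp add.assoc)

lemma M_r_involution:
  assumes "x \<in> carrier (T (n + 1) m)"
  shows "flip n m (flip n m x) = x"
proof (rule tensor_ext_sp[OF T_module lin_comp[OF M_r_lin M_r_lin] lin_id _ assms])
  fix w assume w: "letters w" "length w = n + 1" "word_deg w = m"
  then obtain x u where "w = x # u" by (cases w) auto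
  then show "flip n m (flip n m (sp 0 w)) = sp 0 w"
    using w by (simp add: M_r_sp rev_map del: map_map) (rule sp_parity, auto)
qed

text \<open>The relation $rt = t^{-1}r$ in a form without inverses.\<close>

lemma M_t_M_r_M_t:
  assumes "x \<in> carrier (T (n + 1) m)"
  shows "cyc n m (flip n m (cyc n m x)) = flip n m x"
proof (rule tensor_ext_sp[OF T_module lin_comp[OF lin_comp[OF M_t_lin M_r_lin] M_t_lin] M_r_lin _ assms])
  fix w assume w: "letters w" "length w = n + 1" "word_deg w = m"
  then obtain u b where ub: "w = u @ [b]" by (cases w rule: rev_exhaust) auto
  show "cyc n m (flip n m (cyc n m (sp 0 w))) = flip n m (sp 0 w)"
  proof (cases u)
    case Nil
    then have b: "snd b \<in> carrier (A (fst b))" "n = 0" "fst b = m" using w ub by auto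
    then show ?thesis using Nil ub M_t_sp[of "[]" "star_letter b" 0 m] M_t_sp[of "[]" b 0 m] star_letter_closed[OF b(1)]
      by (simp add: M_r_sp)
  next
    case (Cons x u')
    have "cyc n m (sp 0 w) = sp (fst b * word_deg u) (b # u)" using M_t_sp[of u b n m 0] w ub by simp
    moreover have "flip n m (sp (fst b * word_deg u) (b # u))
      = sp (fst b * word_deg u + rho_exp + deg_pairs u) ((star_letter b # rev (map star_letter u')) @ [star_letter x])"
      using M_r_sp[of b u n m] w ub Cons by simp
    moreover have "cyc n m \<dots> = sp (fst b * word_deg u + rho_exp + deg_pairs u + fst x * (fst b + word_deg u')) (star_letter x # star_letter b # rev (map star_letter u'))"
      using M_t_sp[of "star_letter b # rev (map star_letter u')" "star_letter x" n m] w ub Cons by simp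
    moreover have "\<dots> = sp (rho_exp + deg_pairs (u' @ [b])) (star_letter x # star_letter b # rev (map star_letter u'))"
      by (rule sp_parity) (auto simp: Cons deg_pairs_Cons deg_pairs_append)
    moreover have "flip n m (sp 0 w) = sp (rho_exp + deg_pairs (u' @ [b])) (star_letter x # star_letter b # rev (map star_letter u'))"
      using M_r_sp[of x "u' @ [b]" n m 0] w ub Cons by simp
    ultimately show ?thesis by simp
  qed
qed

lemma M_r_M_t:
  assumes "x \<in> carrier (T (n + 1) m)"
  shows "flip n m (cyc n m x) = inv_into (carrier (T (n + 1) m)) (cyc n m) (flip n m x)"
  using inv_into_f_f[OF M_t_inj M_r_closed[OF M_t_closed[OF assms]]] M_t_M_r_M_t[OF assms] by simp

text \<open>The letter $a_0$ stays in place, and the differential of a later letter corresponds to the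
  mirror position.\<close>

lemma tensor_diff_M_r:
  assumes "x \<in> carrier (T (n + 1) m)"
  shows "bd (n + 1) m (flip n m x) = flip n (m - 1) (bd (n + 1) m x)"
proof (rule tensor_ext_sp[OF T_module lin_comp[OF M_r_lin tensor_diff_lin] lin_comp[OF tensor_diff_lin M_r_lin] _ assms])
  fix w assume w: "letters w" "length w = n + 1" "word_deg w = m"
  obtain x u where xu: "w = x # u" using w by (cases w) auto
  have u: "letters u" "snd x \<in> carrier (A (fst x))" "length u = n" "fst x + word_deg u = m" using w xu by auto
  let ?M = "T (n + 1) (m - 1)"
  let ?r = "flip n (m - 1)"
  interpret M: module K ?M by (rule T_module)
  define u' where "u' = rev (map star_letter u)"
  have u': "letters u'" "length u' = n" "word_deg u' = word_deg u" using u by (auto simp: u'_def)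
  let ?z = "sp (rho_exp + deg_pairs u) (diff_letter (star_letter x) # u')"
  let ?f = "\<lambda>i. sp (rho_exp + deg_pairs u + (fst x + word_deg (take i u'))) (star_letter x # u'[i := diff_letter (u' ! i)])"
  let ?g = "\<lambda>i. sp (fst x + word_deg (take i u)) (x # u[i := diff_letter (u ! i)])"
  have gc: "?g i \<in> carrier ?M" if "i < n" for i
    using u that by (intro sp_closed) (auto simp: letters_update letters_nth word_deg_update)
  have set_face: "?f i \<in> carrier ?M" if "i < n" for i
    using u u' that by (intro sp_closed) (auto simp: letters_update letters_nth word_deg_update)
  have "bd (n + 1) m (flip n m (sp 0 w)) = bd (n + 1) m (sp (rho_exp + deg_pairs u) (star_letter x # u'))"
    using u xu by (simp add: M_r_sp u'_def)
  also have "\<dots> = (\<Oplus>\<^bsub>?M\<^esub>i\<in>{..<Suc n}. sp (rho_exp + deg_pairs u + word_deg (take i (star_letter x # u'))) ((star_letter x # u')[i := diff_letter ((star_letter x # u') ! i)]))"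
    using u u' by (subst tensor_diff_sp) auto
  also have "\<dots> = ?z \<oplus>\<^bsub>?M\<^esub> (\<Oplus>\<^bsub>?M\<^esub>i\<in>{..<n}. ?f i)"
    using u u' diff_word_term[of "star_letter x # u'" "n + 1" m] by (subst M.M.finsum_lessThan_Suc_shift) auto
  also have "(\<Oplus>\<^bsub>?M\<^esub>i\<in>{..<n}. ?f i) = (\<Oplus>\<^bsub>?M\<^esub>i\<in>{..<n}. ?r (?g (n - 1 - i)))"
  proof (rule M.M.finsum_cong')
    fix i assume i: "i \<in> {..<n}"
    define k where "k = n - 1 - i"
    have k: "k < n" "i = n - 1 - k" using i by (auto simp: k_def)
    obtain u1 z u2 where uu: "u = u1 @ z # u2" "length u1 = k"
      using id_take_nth_drop[of k u] k u by (metis length_take min.absorb4)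
    have i': "i = length u2" using uu k u by simp
    have "?g k = sp (fst x + word_deg u1) (x # u1 @ diff_letter z # u2)" using uu(1) by (simp add: uu(2)[symmetric])
    then have "?r (?g k) = sp (fst x + word_deg u1 + rho_exp + deg_pairs (u1 @ diff_letter z # u2)) (star_letter x # rev (map star_letter (u1 @ diff_letter z # u2)))"
      using u uu M_r_sp[of x "u1 @ diff_letter z # u2" n "m - 1"] by simp
    also have "\<dots> = sp (rho_exp + deg_pairs u + (fst x + word_deg u2)) (star_letter x # rev (map star_letter (u1 @ diff_letter z # u2)))"
      by (rule sp_parity) (auto simp: uu deg_pairs_append deg_pairs_Cons)
    also have "\<dots> = ?f i"
      using u uu i' by (simp add: u'_def rev_map nth_append list_update_append star_diff_letter)
    finally show "?f i = ?r (?g (n - 1 - i))" by (simp add: k_def)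
  qed (use gc M_r_closed in auto)
  also have "\<dots> = (\<Oplus>\<^bsub>?M\<^esub>i\<in>{..<n}. ?r (?g i))"
    using gc M_r_closed[of _ n "m - 1"] by (intro M.M.finsum_lessThan_rev) auto
  also have "?z = ?r (sp 0 (diff_letter x # u))"
    using u M_r_sp[of "diff_letter x" u n "m - 1"] by (simp add: u'_def star_diff_letter)
  also have "?r (sp 0 (diff_letter x # u)) \<oplus>\<^bsub>?M\<^esub> (\<Oplus>\<^bsub>?M\<^esub>i\<in>{..<n}. ?r (?g i))
      = (\<Oplus>\<^bsub>?M\<^esub>i\<in>{..<Suc n}. ?r (sp (word_deg (take i w)) (w[i := diff_letter (w ! i)])))"
    using diff_word_term[OF w] M_r_closed[of _ n "m - 1"] by (subst M.M.finsum_lessThan_Suc_shift) (auto simp: xu)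
  also have "\<dots> = ?r (bd (n + 1) m (sp 0 w))"
    using lin_finsum[OF T_module T_module M_r_lin[of n "m - 1"], of "{..<Suc n}" "\<lambda>i. sp (word_deg (take i w)) (w[i := diff_letter (w ! i)])"]
      diff_word_term[OF w] unfolding tensor_diff_sp[OF w] by simp
  finally show "bd (n + 1) m (flip n m (sp 0 w)) = ?r (bd (n + 1) m (sp 0 w))" .
qed

end

section \<open>Shuffles and hats\<close>

text \<open>The Vandermonde product, the usual carrier of the sign of a permutation.\<close>

definition vandermonde_prod :: "(nat \<Rightarrow> int) \<Rightarrow> nat \<Rightarrow> int"
  where "vandermonde_prod x k = (\<Prod>j<k. \<Prod>i<j. x j - x i)"

lemma vandermonde_prod_Suc: "vandermonde_prod x (Suc k) = vandermonde_prod x k * (\<Prod>i<k. x k - x i)"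
  by (simp add: vandermonde_prod_def)

lemma vandermonde_prod_cong: "(\<And>i. i < k \<Longrightarrow> x i = y i) \<Longrightarrow> vandermonde_prod x k = vandermonde_prod y k"
  unfolding vandermonde_prod_def by (intro prod.cong) auto

lemma vandermonde_prod_adjacent:
  "Suc a < k \<Longrightarrow> vandermonde_prod (x \<circ> transpose a (Suc a)) k = - vandermonde_prod x k"
proof (induction k)
  case 0 then show ?case by simp
next
  case (Suc k)
  let ?\<tau> = "transpose a (Suc a)"
  show ?case
  proof (cases "Suc a = k")
    case True
    define y where "y = x \<circ> ?\<tau>"
    have y: "y a = x (Suc a)" "y (Suc a) = x a" "\<And>i. i < a \<Longrightarrow> y i = x i"
      by (auto simp: y_def transpose_def)
    have "vandermonde_prod y a = vandermonde_prod x a" using y by (intro vandermonde_prod_cong)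
    moreover have "(\<Prod>i<a. c - y i) = (\<Prod>i<a. c - x i)" for c using y by (intro prod.cong) auto
    ultimately have "vandermonde_prod y (Suc k) = - vandermonde_prod x (Suc k)"
      using y True[symmetric] by (simp add: vandermonde_prod_Suc algebra_simps)
    then show ?thesis by (simp only: y_def)
  next
    case False
    then have a: "Suc a < k" using Suc.prems by simp
    have "?\<tau> permutes {..<k}" using a by (intro permutes_swap_id) auto
    then have "(\<Prod>i<k. x k - x i) = (\<Prod>i<k. x k - x (?\<tau> i))"
      using prod.permute[of ?\<tau> "{..<k}" "\<lambda>i. x k - x i"] by (simp add: o_def)
    then show ?thesis using Suc.IH[OF a] a by (simp add: vandermonde_prod_Suc)
  qed
qed

text \<open>By induction on the distance, since $(a\;b+1) = (b\;b+1)(a\;b)(b\;b+1)$.\<close>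

lemma vandermonde_prod_transpose:
  "a < b \<Longrightarrow> b < k \<Longrightarrow> vandermonde_prod (x \<circ> transpose a b) k = - vandermonde_prod x k"
proof (induction b arbitrary: x)
  case 0 then show ?case by simp
next
  case (Suc b)
  show ?case
  proof (cases "a = b")
    case True then show ?thesis using Suc.prems by (simp only: vandermonde_prod_adjacent)
  next
    case False
    then have ab: "a < b" "b < k" using Suc.prems by auto
    let ?s = "transpose b (Suc b)"
    have "transpose a (Suc b) = ?s \<circ> transpose a b \<circ> ?s"
      using ab by (auto simp: transpose_def fun_eq_iff)
    then have "vandermonde_prod (x \<circ> transpose a (Suc b)) k = vandermonde_prod ((x \<circ> ?s \<circ> transpose a b) \<circ> ?s) k"
      by (simp add: o_assoc)
    also have "\<dots> = - vandermonde_prod (x \<circ> ?s \<circ> transpose a b) k"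
      using Suc.prems by (intro vandermonde_prod_adjacent) auto
    also have "\<dots> = vandermonde_prod (x \<circ> ?s) k" by (simp only: Suc.IH[OF ab] minus_minus)
    also have "\<dots> = - vandermonde_prod x k"
      using Suc.prems by (intro vandermonde_prod_adjacent) auto
    finally show ?thesis .
  qed
qed

lemma vandermonde_prod_permute:
  assumes "p permutes {..<k}"
  shows "vandermonde_prod (x \<circ> p) k = sign p * vandermonde_prod x k"
  using assms finite_lessThan[of k]
proof (induction p arbitrary: x rule: permutes_induct)
  case id then show ?case by (simp add: o_def)
next
  case (swap a b p)
  have t: "vandermonde_prod (x \<circ> transpose a b) k = - vandermonde_prod x k"
    using swap.hyps vandermonde_prod_transpose[of a b k x] vandermonde_prod_transpose[of b a k x]
    by (cases a b rule: linorder_cases) (auto simp: transpose_commute)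
  have "permutation p" using swap.hyps by (auto simp: permutation_permutes)
  then have "sign (transpose a b \<circ> p) = - sign p"
    using swap.hyps by (simp add: sign_compose permutation_swap_id sign_swap_id)
  then show ?case by (simp only: o_assoc swap.IH t mult_minus_left mult_minus_right)
qed

text \<open>The sign of a permutation is the parity of its number of inversions: permuting the variables of
  a Vandermonde product whose factors are positive makes exactly the inverted factors negative.\<close>

lemma evenperm_inversions:
  fixes x :: "nat \<Rightarrow> nat"
  assumes p: "p permutes {..<k}" and x: "\<And>i j. i < j \<Longrightarrow> j < k \<Longrightarrow> x i < x j"
  shows "evenperm p \<longleftrightarrow> even (\<Sum>j<k. card {i. i < j \<and> x (p j) < x (p i)})"
proof -
  let ?x = "\<lambda>i. int (x i)"
  have pin: "p i < k" if "i < k" for i using permutes_in_image[OF p, of i] that by auto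
  have ne: "x (p i) \<noteq> x (p j)" if ij: "i < j" "j < k" for i j
  proof -
    have "i \<noteq> j" using ij(1) by simp
    then have "p i \<noteq> p j" using inj_eq[OF permutes_inj[OF p], of i j] by simp
    then show ?thesis using x[of "p i" "p j"] x[of "p j" "p i"] pin[of i] pin[of j] ij
      by (cases "p i" "p j" rule: linorder_cases) auto
  qed
  have sgn_prod: "sgn (\<Prod>i<j. f i) = (\<Prod>i<j. sgn (f i))" for f :: "nat \<Rightarrow> int" and j
    by (induction j) (auto simp: sgn_mult)
  have pos: "sgn (vandermonde_prod ?x k) = 1"
    unfolding vandermonde_prod_def sgn_1_pos using x by (intro prod_pos) auto
  have "sgn (\<Prod>i<j. ?x (p j) - ?x (p i)) = (-1) ^ card {i. i < j \<and> x (p j) < x (p i)}" if "j < k" for j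
  proof -
    have "sgn (\<Prod>i<j. ?x (p j) - ?x (p i)) = (\<Prod>i<j. sgn (?x (p j) - ?x (p i)))"
      by (rule sgn_prod)
    also have "\<dots> = (\<Prod>i<j. if x (p j) < x (p i) then -1 else 1)"
    proof (rule prod.cong)
      fix i assume "i \<in> {..<j}"
      then show "sgn (?x (p j) - ?x (p i)) = (if x (p j) < x (p i) then -1 else 1)"
        using ne[of i j] that by (auto simp: sgn_if)
    qed simp
    also have "\<dots> = (-1) ^ card {i. i < j \<and> x (p j) < x (p i)}"
      by (subst prod.If_cases) (auto simp: Int_def lessThan_def)
    finally show ?thesis .
  qed
  then have "(\<Prod>j<k. sgn (\<Prod>i<j. ?x (p j) - ?x (p i))) = (-1) ^ (\<Sum>j<k. card {i. i < j \<and> x (p j) < x (p i)})"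
    by (simp add: power_sum)
  moreover have "sgn (vandermonde_prod (?x \<circ> p) k) = (\<Prod>j<k. sgn (\<Prod>i<j. ?x (p j) - ?x (p i)))"
    unfolding vandermonde_prod_def by (simp add: sgn_prod)
  moreover have "sgn (vandermonde_prod (?x \<circ> p) k) = sgn (sign p) * sgn (vandermonde_prod ?x k)"
    using vandermonde_prod_permute[OF p, of ?x] by (simp add: sgn_mult)
  ultimately have "sgn (sign p :: int) = (-1) ^ (\<Sum>j<k. card {i. i < j \<and> x (p j) < x (p i)})"
    using pos by simp
  then show ?thesis by (auto simp: sign_def minus_one_power_iff split: if_splits)
qed

text \<open>The position of \<open>t\<close>, counted from 0, in the enumeration of what is left when
  the elements of \<open>S\<close> are removed.\<close>

definition squeeze :: "nat set \<Rightarrow> nat \<Rightarrow> nat"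
  where "squeeze S t = t - card {s \<in> S. s < t}"

text \<open>The number of inversions of the shuffle that lists \<open>T\<close> before \<open>S\<close>.\<close>

definition crossings :: "nat set \<Rightarrow> nat set \<Rightarrow> nat"
  where "crossings S T = (\<Sum>s\<in>S. card {t \<in> T. s < t})"

lemma card_below: "card {s \<in> S. s < (t::nat)} \<le> t"
  using card_mono[of "{..<t}" "{s \<in> S. s < t}"] by auto

text \<open>Between \<open>t\<close> and a larger \<open>t'\<close> there are at most $t'-t-1$ elements of \<open>S\<close>.\<close>

lemma squeeze_less:
  assumes "t < t'" "t \<notin> S"
  shows "squeeze S t < squeeze S t'"
proof -
  have "{s \<in> S. s < t'} \<subseteq> {s \<in> S. s < t} \<union> {t<..<t'}" using assms by (auto simp: not_less order.order_iff_strict)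
  then have "card {s \<in> S. s < t'} \<le> card ({s \<in> S. s < t} \<union> {t<..<t'})" by (intro card_mono) auto
  also have "\<dots> \<le> card {s \<in> S. s < t} + card {t<..<t'}" by (rule card_Un_le)
  also have "card {t<..<t'} = t' - t - 1" by simp
  finally show ?thesis using card_below[of S t] assms unfolding squeeze_def by linarith
qed

lemma card_nth_filter:
  assumes "distinct xs"
  shows "card {i. i < length xs \<and> P (xs ! i)} = card {x \<in> set xs. P x}"
proof (rule bij_betw_same_card[of "nth xs"])
  show "bij_betw ((!) xs) {i. i < length xs \<and> P (xs ! i)} {x \<in> set xs. P x}"
    unfolding bij_betw_def using assms by (auto simp: inj_on_def nth_eq_iff_index_eq in_set_conv_nth)
qed

lemma strict_sorted_eq:
  "sorted_wrt (<) xs \<Longrightarrow> xs = sorted_list_of_set (set (xs :: nat list))"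
  by (metis sorted_list_of_set.idem_if_sorted_distinct strict_sorted_iff)

lemma hat_tuple_nth:
  "i < length xs \<Longrightarrow> hat_tuple xs ! i = xs ! i - card {u. i < u \<and> u < length xs \<and> xs ! u < xs ! i}"
  by (simp add: hat_tuple_def)

lemma length_hat_tuple [simp]: "length (hat_tuple xs) = length xs"
  by (simp add: hat_tuple_def)

text \<open>In a shuffle, only entries of the second part are smaller than an earlier entry. So the
  hats leave the second part alone and renumber the first part by \<open>squeeze\<close>.\<close>

lemma hat_tuple_append:
  assumes "sorted_wrt (<) ts" "sorted_wrt (<) ss"
  shows "hat_tuple (ts @ ss) = map (squeeze (set ss)) ts @ ss"
proof (rule nth_equalityI)
  fix i assume i: "i < length (hat_tuple (ts @ ss))"
  let ?U = "{u. i < u \<and> u < length (ts @ ss) \<and> (ts @ ss) ! u < (ts @ ss) ! i}"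
  show "hat_tuple (ts @ ss) ! i = (map (squeeze (set ss)) ts @ ss) ! i"
  proof (cases "i < length ts")
    case True
    have "?U = (\<lambda>u. length ts + u) ` {u. u < length ss \<and> ss ! u < ts ! i}"
    proof (intro equalityI subsetI)
      fix u assume u: "u \<in> ?U"
      have "length ts \<le> u"
      proof (rule ccontr)
        assume "\<not> length ts \<le> u"
        then have "ts ! i < ts ! u" using u sorted_wrt_nth_less[OF assms(1), of i u] by auto
        then show False using u True \<open>\<not> length ts \<le> u\<close> by (auto simp: nth_append)
      qed
      then show "u \<in> (\<lambda>u. length ts + u) ` {u. u < length ss \<and> ss ! u < ts ! i}"
        using u True by (intro image_eqI[of _ _ "u - length ts"]) (auto simp: nth_append)
    qed (use True in \<open>auto simp: nth_append\<close>)
    then have "card ?U = card {u. u < length ss \<and> ss ! u < ts ! i}" by (simp add: card_image)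
    also have "\<dots> = card {s \<in> set ss. s < ts ! i}"
      using assms(2) by (intro card_nth_filter) (auto simp: strict_sorted_iff)
    finally show ?thesis using True i by (simp add: hat_tuple_nth nth_append squeeze_def)
  next
    case False
    have "?U = {}"
    proof (rule ccontr)
      assume "?U \<noteq> {}"
      then obtain u where u: "u \<in> ?U" by blast
      then have "ss ! (i - length ts) < ss ! (u - length ts)"
        using False i by (intro sorted_wrt_nth_less[OF assms(2)]) auto
      then show False using u False by (auto simp: nth_append)
    qed
    moreover have "hat_tuple (ts @ ss) ! i = (ts @ ss) ! i - card ?U" using i by (intro hat_tuple_nth) simp
    ultimately have "hat_tuple (ts @ ss) ! i = (ts @ ss) ! i" by (simp only: card.empty diff_zero)
    then show ?thesis using False by (simp add: nth_append)
  qed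
qed simp

text \<open>A descent stays a (weak) descent under the hats: the entry \<open>xs ! i\<close> loses at most its distance to the
  next entry more than that entry does. So a hatted tuple splits into increasing tuples only where
  the tuple itself does.\<close>

lemma hat_tuple_descent:
  assumes "distinct xs" "Suc i < length xs" "hat_tuple xs ! i < hat_tuple xs ! Suc i"
  shows "xs ! i < xs ! Suc i"
proof (rule ccontr)
  assume "\<not> ?thesis"
  then have gt: "xs ! Suc i < xs ! i"
    using assms(1,2) nth_eq_iff_index_eq[OF assms(1), of i "Suc i"] by (cases "xs ! i" "xs ! Suc i" rule: linorder_cases) auto
  let ?U = "\<lambda>i. {u. i < u \<and> u < length xs \<and> xs ! u < xs ! i}"
  let ?M = "{u. i < u \<and> u < length xs \<and> xs ! u \<in> {xs ! Suc i..<xs ! i}}"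
  have "?U i \<subseteq> ?U (Suc i) \<union> ?M"
  proof
    fix u assume u: "u \<in> ?U i"
    show "u \<in> ?U (Suc i) \<union> ?M"
    proof (cases "xs ! u < xs ! Suc i")
      case True
      then have "u \<noteq> Suc i" by auto
      then show ?thesis using True u by auto
    qed (use u in auto)
  qed
  then have "card (?U i) \<le> card (?U (Suc i) \<union> ?M)" by (intro card_mono) auto
  also have "\<dots> \<le> card (?U (Suc i)) + card ?M" by (rule card_Un_le)
  also have "card ?M \<le> card {xs ! Suc i..<xs ! i}"
  proof (rule card_inj_on_le[where f = "nth xs"])
    show "inj_on ((!) xs) ?M" using assms(1) by (auto simp: inj_on_def nth_eq_iff_index_eq)
  qed auto
  also have "\<dots> = xs ! i - xs ! Suc i" by simp
  finally show False using assms(2,3) gt by (simp add: hat_tuple_nth)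
qed

lemma hat_tuple_sorted_take:
  assumes "distinct xs" "sorted_wrt (<) (take j (hat_tuple xs))"
  shows "sorted_wrt (<) (take j xs)"
  using assms hat_tuple_descent[OF assms(1)]
  by (auto simp: sorted_wrt_iff_nth_Suc_transp transp_def)

lemma hat_tuple_sorted_drop:
  assumes "distinct xs" "sorted_wrt (<) (drop j (hat_tuple xs))"
  shows "sorted_wrt (<) (drop j xs)"
  using assms hat_tuple_descent[OF assms(1), of "j + _"]
  by (auto simp: sorted_wrt_iff_nth_Suc_transp transp_def)

lemma sum_lessThan_add: "(\<Sum>j<a + b. f j) = (\<Sum>j<a. f j) + (\<Sum>j<b. f (a + j :: nat) :: nat)"
  by (induction b) auto

lemma evenperm_shuffle:
  assumes "\<sigma> permutes {..<length xs}" "sorted_wrt (<) xs" "permute_list \<sigma> xs = ts @ ss"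
    "sorted_wrt (<) ts" "sorted_wrt (<) (ss :: nat list)"
  shows "evenperm \<sigma> \<longleftrightarrow> even (crossings (set ss) (set ts))"
proof -
  let ?ys = "ts @ ss"
  have len: "length xs = length ts + length ss" using arg_cong[OF assms(3), of length] by simp
  have ys: "xs ! \<sigma> i = ?ys ! i" if "i < length xs" for i
    using permute_list_nth[OF assms(1) that] assms(3) by simp
  have "evenperm \<sigma> \<longleftrightarrow> even (\<Sum>j<length xs. card {i. i < j \<and> xs ! \<sigma> j < xs ! \<sigma> i})"
    by (rule evenperm_inversions[OF assms(1)]) (use assms(2) sorted_wrt_nth_less in blast)
  also have "(\<Sum>j<length xs. card {i. i < j \<and> xs ! \<sigma> j < xs ! \<sigma> i}) = (\<Sum>j<length xs. card {i. i < j \<and> ?ys ! j < ?ys ! i})"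
    by (intro sum.cong arg_cong[of _ _ card]) (auto simp: ys)
  also have "\<dots> = (\<Sum>j<length ts. card {i. i < j \<and> ?ys ! j < ?ys ! i}) + (\<Sum>j<length ss. card {i. i < length ts + j \<and> ?ys ! (length ts + j) < ?ys ! i})"
    unfolding len by (rule sum_lessThan_add)
  also have "(\<Sum>j<length ts. card {i. i < j \<and> ?ys ! j < ?ys ! i}) = 0"
  proof (intro sum.neutral ballI)
    fix j assume "j \<in> {..<length ts}"
    then have "{i. i < j \<and> ?ys ! j < ?ys ! i} = {}"
      using sorted_wrt_nth_less[OF assms(4)] by (fastforce simp: nth_append)
    then show "card {i. i < j \<and> ?ys ! j < ?ys ! i} = 0" by simp
  qed
  also have "(\<Sum>j<length ss. card {i. i < length ts + j \<and> ?ys ! (length ts + j) < ?ys ! i})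
      = (\<Sum>j<length ss. card {t \<in> set ts. ss ! j < t})"
  proof (rule sum.cong)
    fix j assume j: "j \<in> {..<length ss}"
    have "{i. i < length ts + j \<and> ?ys ! (length ts + j) < ?ys ! i} = {i. i < length ts \<and> ss ! j < ts ! i}"
    proof (intro equalityI subsetI)
      fix i assume i: "i \<in> {i. i < length ts + j \<and> ?ys ! (length ts + j) < ?ys ! i}"
      have "i < length ts"
      proof (rule ccontr)
        assume "\<not> i < length ts"
        then have "i - length ts < j" using i by auto
        then show False using \<open>\<not> i < length ts\<close> i j sorted_wrt_nth_less[OF assms(5), of "i - length ts" j] by (auto simp: nth_append)
      qed
      then show "i \<in> {i. i < length ts \<and> ss ! j < ts ! i}" using i by (simp add: nth_append)
    qed (auto simp: nth_append)
    then show "card {i. i < length ts + j \<and> ?ys ! (length ts + j) < ?ys ! i} = card {t \<in> set ts. ss ! j < t}"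
      using card_nth_filter[of ts "\<lambda>t. ss ! j < t"] assms(4) by (simp add: strict_sorted_iff)
  qed simp
  also have "\<dots> = (\<Sum>s\<leftarrow>ss. card {t \<in> set ts. s < t})"
    by (simp add: sum_list_sum_nth atLeast0LessThan)
  also have "\<dots> = crossings (set ss) (set ts)"
    unfolding crossings_def using assms(5) by (intro sum_list_distinct_conv_sum_set) (auto simp: strict_sorted_iff)
  finally show ?thesis by simp
qed

lemma permute_list_inj:
  assumes "distinct xs" "\<sigma> permutes {..<length xs}" "\<tau> permutes {..<length xs}"
    "permute_list \<sigma> xs = permute_list \<tau> xs"
  shows "\<sigma> = \<tau>"
proof
  fix i
  show "\<sigma> i = \<tau> i"
  proof (cases "i < length xs")
    case True
    then have "xs ! \<sigma> i = xs ! \<tau> i"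
      using permute_list_nth[OF assms(2) True] permute_list_nth[OF assms(3) True] assms(4) by simp
    then show ?thesis using assms(1) permutes_in_image[OF assms(2), of i] permutes_in_image[OF assms(3), of i] True
      by (auto simp: nth_eq_iff_index_eq)
  next
    case False
    then show ?thesis using permutes_not_in[OF assms(2)] permutes_not_in[OF assms(3)] by simp
  qed
qed

text \<open>A permutation together with a position at which its hatted tuple splits into two increasing
  tuples is the same as a proper nonempty subset: the set \<open>S\<close> of entries of the second tuple, with
  the remaining entries renumbered by \<open>squeeze S\<close>.\<close>

lemma (in module) finsum_hat_splits:
  assumes srt: "sorted_wrt (<) xs"
    and cl: "\<And>S. S \<subset> set xs \<Longrightarrow> S \<noteq> {} \<Longrightarrow>
      \<Phi> (map (squeeze S) (sorted_list_of_set (set xs - S))) (sorted_list_of_set S) \<in> carrier M"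
  shows "(\<Oplus>\<^bsub>M\<^esub>\<sigma>\<in>{\<sigma>. \<sigma> permutes {..<length xs}}. \<Oplus>\<^bsub>M\<^esub>j\<in>hat_splits (hat_tuple (permute_list \<sigma> xs)).
        pm M ((if evenperm \<sigma> then 0 else 1) + 1)
          (\<Phi> (take j (hat_tuple (permute_list \<sigma> xs))) (drop j (hat_tuple (permute_list \<sigma> xs)))))
    = (\<Oplus>\<^bsub>M\<^esub>S\<in>{S. S \<subset> set xs \<and> S \<noteq> {}}. pm M (int (crossings S (set xs - S)) + 1)
        (\<Phi> (map (squeeze S) (sorted_list_of_set (set xs - S))) (sorted_list_of_set S)))"
    (is "?L = (\<Oplus>\<^bsub>M\<^esub>S\<in>?P. ?g S)")
proof -
  let ?B = "\<lambda>\<sigma>. hat_splits (hat_tuple (permute_list \<sigma> xs))"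
  let ?f = "\<lambda>\<sigma> j. pm M ((if evenperm \<sigma> then 0 else 1) + 1)
          (\<Phi> (take j (hat_tuple (permute_list \<sigma> xs))) (drop j (hat_tuple (permute_list \<sigma> xs))))"
  let ?ys = "\<lambda>S. sorted_list_of_set (set xs - S) @ sorted_list_of_set S"
  have dist: "distinct xs" using srt by (simp add: strict_sorted_iff)
  \<comment> \<open>the shuffle of a subset \<open>S\<close>\<close>
  define \<sigma> where "\<sigma> S = (SOME \<sigma>. \<sigma> permutes {..<length xs} \<and> permute_list \<sigma> xs = ?ys S)" for S
  have \<sigma>: "\<sigma> S permutes {..<length xs} \<and> permute_list (\<sigma> S) xs = ?ys S" if S: "S \<subseteq> set xs" for S
  proof -
    have fin: "finite S" using S by (rule finite_subset) simp
    have "mset (?ys S) = mset_set ((set xs - S) \<union> S)"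
      using fin by (subst mset_set_Union) (auto simp: sorted_list_of_mset_set[symmetric] simp del: sorted_list_of_mset_set)
    also have "(set xs - S) \<union> S = set xs" using S by auto
    also have "mset_set (set xs) = mset xs" using dist by (simp add: mset_set_set)
    finally obtain \<tau> where "\<tau> permutes {..<length xs}" "permute_list \<tau> xs = ?ys S"
      by (metis mset_eq_permutation)
    then show ?thesis unfolding \<sigma>_def by (intro someI[of "\<lambda>\<sigma>. \<sigma> permutes {..<length xs} \<and> permute_list \<sigma> xs = ?ys S"]) auto
  qed
  let ?h = "\<lambda>S. (\<sigma> S, card (set xs - S))"
  have hat: "hat_tuple (permute_list (\<sigma> S) xs) = map (squeeze S) (sorted_list_of_set (set xs - S)) @ sorted_list_of_set S"
    if "S \<subseteq> set xs" for S
    using \<sigma>[OF that] finite_subset[OF that] by (simp add: hat_tuple_append)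
  have bij: "?h ` ?P = Sigma {\<sigma>. \<sigma> permutes {..<length xs}} ?B"
  proof (intro equalityI subsetI)
    fix z assume "z \<in> ?h ` ?P"
    then obtain S where S: "S \<subset> set xs" "S \<noteq> {}" "z = ?h S" by auto
    have fin: "finite S" using S by (meson finite_set finite_subset psubset_imp_subset)
    have "0 < card (set xs - S)" "0 < card S" using S fin by (auto simp: card_gt_0_iff)
    moreover have "sorted_wrt (<) (map (squeeze S) (sorted_list_of_set (set xs - S)))"
      unfolding sorted_wrt_map
      by (rule sorted_wrt_mono_rel[OF _ strict_sorted_list_of_set]) (auto intro: squeeze_less)
    ultimately have "card (set xs - S) \<in> ?B (\<sigma> S)"
      using S fin hat[of S] by (auto simp: hat_splits_def)
    then show "z \<in> Sigma {\<sigma>. \<sigma> permutes {..<length xs}} ?B" using S \<sigma>[of S] by auto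
  next
    fix z assume "z \<in> Sigma {\<sigma>. \<sigma> permutes {..<length xs}} ?B"
    then obtain \<tau> j where z: "z = (\<tau>, j)" "\<tau> permutes {..<length xs}" "j \<in> ?B \<tau>" by auto
    let ?zs = "permute_list \<tau> xs"
    have dz: "distinct ?zs" "set ?zs = set xs" "length ?zs = length xs" using dist z(2) by (auto simp: distinct_permute_list)
    have j: "1 \<le> j" "j \<le> length ?zs - 1" "sorted_wrt (<) (take j ?zs)" "sorted_wrt (<) (drop j ?zs)"
      using z(3) hat_tuple_sorted_take[OF dz(1)] hat_tuple_sorted_drop[OF dz(1)] by (auto simp: hat_splits_def)
    define S where "S = set (drop j ?zs)"
    have T: "set (take j ?zs) = set xs - S"
      using dz(1,2) set_take_disj_set_drop_if_distinct[OF dz(1), of j j] append_take_drop_id[of j ?zs]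
      unfolding S_def by (metis Diff_cancel Int_Diff Un_Diff Un_Diff_Int Un_empty_right inf_commute order_refl set_append Diff_triv)
    have S: "S \<subseteq> set xs" unfolding S_def dz(2)[symmetric] by (rule set_drop_subset)
    have ys: "?zs = ?ys S"
      using strict_sorted_eq[OF j(3)] strict_sorted_eq[OF j(4)] append_take_drop_id[of j ?zs] unfolding T S_def by metis
    have "\<tau> = \<sigma> S" using \<sigma>[OF S] z(2) ys by (intro permute_list_inj[OF dist]) auto
    moreover have "j = card (set xs - S)" unfolding T[symmetric] using dz j by (simp add: distinct_card)
    moreover have "S \<noteq> {}" using j by (auto simp: S_def)
    moreover have "0 < length (take j ?zs)" using j(1,2) by simp
    then have "S \<noteq> set xs" using T by (metis Diff_cancel length_0_conv less_irrefl set_empty)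
    ultimately show "z \<in> ?h ` ?P" using z S by auto
  qed
  have inj: "inj_on ?h ?P"
  proof (rule inj_onI)
    fix S S' assume *: "S \<in> ?P" "S' \<in> ?P" "?h S = ?h S'"
    then have "?ys S = ?ys S'" "length (sorted_list_of_set (set xs - S)) = length (sorted_list_of_set (set xs - S'))"
      using \<sigma>[of S] \<sigma>[of S'] by auto
    then have "sorted_list_of_set S = sorted_list_of_set S'" by simp
    moreover have "finite S" "finite S'" using * by (auto intro: finite_subset[OF _ finite_set[of xs]])
    ultimately show "S = S'" by (metis set_sorted_list_of_set)
  qed
  have fg: "?f (fst (?h S)) (snd (?h S)) = ?g S" if "S \<in> ?P" for S
  proof -
    have S: "S \<subseteq> set xs" "finite S" using that by (auto intro: finite_subset[OF _ finite_set[of xs]])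
    have "evenperm (\<sigma> S) \<longleftrightarrow> even (crossings S (set xs - S))"
      using evenperm_shuffle[of "\<sigma> S" xs "sorted_list_of_set (set xs - S)" "sorted_list_of_set S"] \<sigma>[OF S(1)] S srt by simp
    then show ?thesis using hat[OF S(1)] by (auto simp: pm_def)
  qed
  have gc: "?g S \<in> carrier M" if "S \<in> ?P" for S using cl that by simp
  have set_face: "?f (fst z) (snd z) \<in> carrier M" if z: "z \<in> Sigma {\<sigma>. \<sigma> permutes {..<length xs}} ?B" for z
  proof -
    from z obtain S where "S \<in> ?P" "z = ?h S" unfolding bij[symmetric] by blast
    then show ?thesis using fg[of S] gc[of S] by (simp only:)
  qed
  have "?L = (\<Oplus>\<^bsub>M\<^esub>z\<in>Sigma {\<sigma>. \<sigma> permutes {..<length xs}} ?B. ?f (fst z) (snd z))"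
  proof (rule M.finsum_Sigma)
    show "?f \<sigma> j \<in> carrier M" if "\<sigma> \<in> {\<sigma>. \<sigma> permutes {..<length xs}}" "j \<in> ?B \<sigma>" for \<sigma> j
      using set_face[of "(\<sigma>, j)"] that by (simp only: fst_conv snd_conv mem_Sigma_iff)
  qed (auto simp: finite_permutations hat_splits_def)
  also have "\<dots> = (\<Oplus>\<^bsub>M\<^esub>S\<in>?P. ?f (fst (?h S)) (snd (?h S)))"
    unfolding bij[symmetric]
    by (rule M.finsum_reindex[OF _ inj], rule Pi_I, rule set_face) (simp only: bij)
  also have "\<dots> = (\<Oplus>\<^bsub>M\<^esub>S\<in>?P. ?g S)"
    by (rule M.finsum_cong'[OF refl _ fg], rule Pi_I, rule gc)
  finally show ?thesis .
qed

section \<open>Arcs of a cyclically ordered set\<close>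

text \<open>The positions of a set of gaps after the circle of \<open>n + 1\<close> letters has been turned by one letter.\<close>

definition rot :: "nat \<Rightarrow> nat set \<Rightarrow> nat set"
  where "rot n I = (\<lambda>i. if i = 0 then n else i - 1) ` I"

text \<open>The sets of entries of the tuples that index faces.\<close>

definition valid_index :: "nat \<Rightarrow> nat set \<Rightarrow> bool"
  where "valid_index n I \<longleftrightarrow> I \<subseteq> {..n} \<and> I \<noteq> {} \<and> card I \<le> n"

lemma valid_index_finite: "valid_index n I \<Longrightarrow> finite I"
  unfolding valid_index_def by (auto intro: finite_subset)

lemma valid_index_card: "valid_index n I \<Longrightarrow> 1 \<le> card I \<and> card I \<le> n"
  using valid_index_finite[of n I] by (auto simp: valid_index_def Suc_le_eq card_gt_0_iff)

lemma mem_rot: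
  assumes "I \<subseteq> {..n}"
  shows "m \<in> rot n I \<longleftrightarrow> m < n \<and> Suc m \<in> I \<or> m = n \<and> 0 \<in> I"
proof
  assume "m \<in> rot n I"
  then obtain i where i: "i \<in> I" "i \<le> n" "m = (if i = 0 then n else i - 1)" using assms by (auto simp: rot_def)
  then show "m < n \<and> Suc m \<in> I \<or> m = n \<and> 0 \<in> I" by (cases i) auto
next
  assume "m < n \<and> Suc m \<in> I \<or> m = n \<and> 0 \<in> I"
  then show "m \<in> rot n I" unfolding rot_def
    by (elim disjE conjE) (rule image_eqI[of _ _ "Suc m"], auto intro: image_eqI[of _ _ 0])
qed

lemma card_rot: "I \<subseteq> {..n} \<Longrightarrow> card (rot n I) = card I"
  unfolding rot_def by (rule card_image) (auto simp: inj_on_def split: if_splits)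

lemma rot_eqI:
  assumes "I \<subseteq> {..n}" "J \<subseteq> {..n}" "\<And>m. m < n \<Longrightarrow> m \<in> J \<longleftrightarrow> Suc m \<in> I" "n \<in> J \<longleftrightarrow> 0 \<in> I"
  shows "rot n I = J"
proof (rule Set.set_eqI)
  fix m
  show "m \<in> rot n I \<longleftrightarrow> m \<in> J"
  proof (cases "m < n")
    case True then show ?thesis using mem_rot[OF assms(1)] assms(3) by simp
  next
    case False then show ?thesis using mem_rot[OF assms(1), of m] assms(2,4) by (cases "m = n") auto
  qed
qed

lemma valid_index_rot:
  assumes "valid_index n I" shows "valid_index n (rot n I)"
proof -
  have "I \<subseteq> {..n}" "I \<noteq> {}" "card I \<le> n" using assms by (auto simp: valid_index_def)
  then have "rot n I \<subseteq> {..n}" "card (rot n I) \<le> n" by (auto simp: mem_rot card_rot)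
  moreover have "rot n I \<noteq> {}" unfolding rot_def image_is_empty using \<open>I \<noteq> {}\<close> .
  ultimately show ?thesis by (simp add: valid_index_def)
qed

text \<open>A set of at most \<open>n\<close> gaps misses some gap \<open>g\<close>; after \<open>g + 1\<close> rotations it misses the gap \<open>n\<close>.
  If it is then an interval, more rotations move it to the beginning.\<close>

lemma rot_cyclic_induct [consumes 1, case_names rot initial gap]:
  assumes I: "valid_index n I"
    and step: "\<And>I. valid_index n I \<Longrightarrow> P (rot n I) \<Longrightarrow> P I"
    and init: "\<And>k. 1 \<le> k \<Longrightarrow> k \<le> n \<Longrightarrow> P {..<k}"
    and gap: "\<And>I. valid_index n I \<Longrightarrow> n \<notin> I \<Longrightarrow> (\<And>j. I \<noteq> {j..<j + card I}) \<Longrightarrow> P I"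
  shows "P I"
proof -
  \<comment> \<open>an interval is rotated down to the beginning\<close>
  have block: "P {j..<j + k}" if "1 \<le> k" "j + k \<le> n" for j k
    using that
  proof (induction j)
    case 0 then show ?case using init by (simp add: atLeast0LessThan)
  next
    case (Suc j)
    have "rot n {Suc j..<Suc j + k} = {j..<j + k}" using Suc.prems by (intro rot_eqI) auto
    moreover have "valid_index n {Suc j..<Suc j + k}" using Suc.prems by (auto simp: valid_index_def)
    ultimately show ?case using Suc step[of "{Suc j..<Suc j + k}"] by simp
  qed
  have base: "P I" if "valid_index n I" "n \<notin> I" for I
  proof (cases "\<exists>j. I = {j..<j + card I}")
    case True
    then obtain j where j: "I = {j..<j + card I}" by blast
    have "j + card I - 1 \<in> I" using valid_index_card[OF that(1)] by (subst j) auto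
    then have "j + card I - 1 \<le> n" "j + card I - 1 \<noteq> n" using that by (auto simp: valid_index_def)
    then have "j + card I \<le> n" using valid_index_card[OF that(1)] by arith
    then show ?thesis using block[of "card I" j] j valid_index_card[OF that(1)] by simp
  qed (use gap that in blast)
  have gen: "P I" if "valid_index n I" "g \<notin> I" "g \<le> n" for g I
    using that
  proof (induction g arbitrary: I)
    case 0
    then have "n \<notin> rot n I" by (subst mem_rot) (auto simp: valid_index_def)
    then show ?case using step[OF 0(1) base[OF valid_index_rot[OF 0(1)]]] by simp
  next
    case (Suc g)
    then have "g \<notin> rot n I" by (subst mem_rot) (auto simp: valid_index_def)
    then show ?case using step[OF Suc.prems(1) Suc.IH[OF valid_index_rot[OF Suc.prems(1)]]] Suc.prems(3) by simp
  qed
  obtain g where g: "g \<le> n" "g \<notin> I"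
  proof -
    have "\<not> {..n} \<subseteq> I"
      using card_mono[of I "{..n}"] valid_index_finite[OF I] valid_index_card[OF I] by auto
    then show ?thesis using that by auto
  qed
  show ?thesis by (rule gen[OF I g(2,1)])
qed

text \<open>The arcs of the circle: intervals that miss the gap \<open>n\<close>, and arcs through the gap \<open>n\<close> with \<open>q\<close>
  gaps at the end of the enumeration. All other faces are zero by definition.\<close>

definition arc :: "nat \<Rightarrow> nat set \<Rightarrow> bool"
  where "arc n I \<longleftrightarrow> (\<exists>j. j + card I \<le> n \<and> I = {j..<j + card I}) \<or>
    (\<exists>q. 1 \<le> q \<and> q \<le> card I \<and> I = {..<card I - q} \<union> {n + 1 - q..n})"

lemma arc_cases [consumes 2, case_names block wrap gap]:
  assumes "valid_index n I" "k = card I"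
  obtains (block) j where "j + k \<le> n" "I = {j..<j + k}"
  | (wrap) q where "1 \<le> q" "q \<le> k" "I = {..<k - q} \<union> {n + 1 - q..n}"
  | (gap) "\<not> arc n I"
  using assms unfolding arc_def by blast

lemma rot_mem_iff: "I \<subseteq> {..n} \<Longrightarrow> i \<le> n \<Longrightarrow> i \<in> I \<longleftrightarrow> (if i = 0 then n else i - 1) \<in> rot n I"
  by (auto simp: mem_rot)

lemma arc_rot:
  assumes I: "valid_index n I" and arc: "arc n (rot n I)"
  shows "arc n I"
proof -
  have sub: "I \<subseteq> {..n}" using I by (simp add: valid_index_def)
  define k where "k = card I"
  have k: "1 \<le> k" "k \<le> n" using valid_index_card[OF I] by (auto simp: k_def)
  from valid_index_rot[OF I] card_rot[OF sub, folded k_def, symmetric] show ?thesis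
  proof (cases rule: arc_cases)
    case (block j)
    have m: "i \<in> I \<longleftrightarrow> i \<noteq> 0 \<and> j \<le> i - 1 \<and> i - 1 < j + k" if "i \<le> n" for i
      using rot_mem_iff[OF sub that] block by auto
    show ?thesis
    proof (cases "j + k = n")
      case True
      have "I = {..<k - k} \<union> {n + 1 - k..n}"
      proof (rule Set.set_eqI)
        fix i show "i \<in> I \<longleftrightarrow> i \<in> {..<k - k} \<union> {n + 1 - k..n}"
          using m[of i] sub True k by (cases "i \<le> n") auto
      qed
      then show ?thesis unfolding arc_def k_def[symmetric] using k by blast
    next
      case False
      have "I = {j + 1..<j + 1 + k}"
      proof (rule Set.set_eqI)
        fix i show "i \<in> I \<longleftrightarrow> i \<in> {j + 1..<j + 1 + k}"
          using m[of i] sub False block by (cases "i \<le> n") auto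
      qed
      then show ?thesis unfolding arc_def k_def[symmetric] using False block by (intro disjI1 exI[of _ "j + 1"]) auto
    qed
  next
    case (wrap q)
    have m: "i \<in> I \<longleftrightarrow> (if i = 0 then True else i - 1 < k - q \<or> n - q < i - 1)" if "i \<le> n" for i
      using rot_mem_iff[OF sub that] wrap that k by auto
    show ?thesis
    proof (cases "q = 1")
      case True
      have "I = {0..<0 + k}"
      proof (rule Set.set_eqI)
        fix i show "i \<in> I \<longleftrightarrow> i \<in> {0..<0 + k}"
          using m[of i] sub True k by (cases "i \<le> n") auto
      qed
      then show ?thesis unfolding arc_def k_def[symmetric] using k by (intro disjI1 exI[of _ 0]) auto
    next
      case False
      have "I = {..<k - (q - 1)} \<union> {n + 1 - (q - 1)..n}"
      proof (rule Set.set_eqI)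
        fix i show "i \<in> I \<longleftrightarrow> i \<in> {..<k - (q - 1)} \<union> {n + 1 - (q - 1)..n}"
          using m[of i] sub False k wrap(1,2) by (cases "i \<le> n") (auto split: if_splits)
      qed
      then show ?thesis unfolding arc_def k_def[symmetric] using False wrap by (intro disjI2 exI[of _ "q - 1"]) auto
    qed
  qed (use arc in simp)
qed

section \<open>The faces\<close>

context A_infinity_algebra
begin

abbreviation block where "block \<equiv> M_block K A \<pi>"

text \<open>The letter that replaces a block \<open>y\<close> of letters.\<close>

definition op_letter :: "(int \<times> 'a) list \<Rightarrow> int \<times> 'a"
  where "op_letter y = (word_deg y + int (length y) - 2, \<pi> (length y - 2) (word_deg y) (ptens K A y))"

lemma fst_op_letter [simp]: "fst (op_letter y) = word_deg y + int (length y) - 2"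
  by (simp add: op_letter_def)

lemma pi_lin_arity: "1 \<le> k \<Longrightarrow> \<pi> (k - 1) q \<in> lin_maps K (T (k + 1) q) (A (q + (int k - 1)))"
  using pi_lin[of "k - 1" q] by (simp add: of_nat_diff Suc_diff_le numeral_2_eq_2)

lemma op_letter_closed:
  assumes "letters y" "2 \<le> length y" shows "snd (op_letter y) \<in> carrier (A (fst (op_letter y)))"
proof -
  have "ptens K A y \<in> carrier (T (length y - 1 + 1) (word_deg y))"
    using assms by (intro ptens_closed) (simp add: tensor_words_iff)
  moreover have "int (length y - 1) - 1 = int (length y) - 2" using assms by simp
  ultimately show ?thesis
    using lin_mapsD(1)[OF pi_lin_arity[of "length y - 1" "word_deg y"]] assms
    by (simp add: op_letter_def diff_diff_eq numeral_2_eq_2 add_diff_eq)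
qed

lemma M_block_lin:
  assumes "1 \<le> k" "j + k \<le> n"
  shows "block n p k j \<in> lin_maps K (T (n + 1) p) (T (n - k + 1) (p + int k - 1))"
proof -
  have "j + (k + 1) + (n - k - j) = n + 1" "j + 1 + (n - k - j) = n - k + 1" "p + (int k - 1) = p + int k - 1"
    using assms by auto
  then have "tensor_insert K A j (k + 1) (n - k - j) (int k - 1) (\<pi> (k - 1)) p
      \<in> lin_maps K (T (n + 1) p) (T (n - k + 1) (p + int k - 1))"
    using tensor_insert_lin[of "\<pi> (k - 1)" "k + 1" "int k - 1" j "n - k - j" p] pi_lin_arity[OF assms(1)] by (simp add: add_diff_eq)
  then show ?thesis unfolding M_block_def[abs_def] M_obj_def by (rule lin_pm_map[OF T_module])
qed

lemma M_block_sp: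
  assumes "letters (u @ y @ v)" "length u = j" "length y = k + 1" "length v = n - k - j" "j + k \<le> n" "1 \<le> k"
    and "word_deg u + word_deg y + word_deg v = p"
  shows "block n p k j (sp c (u @ y @ v)) = sp (c + int k * (p - 1) + (int k - 1) * word_deg u) (u @ op_letter y # v)"
proof -
  have op_letter: "op_letter y = (word_deg y + (int k - 1), \<pi> (k - 1) (word_deg y) (ptens K A y))"
    using assms(3) by (simp add: op_letter_def numeral_2_eq_2)
  have "letters (u @ op_letter y # v)" "length (u @ op_letter y # v) = n - k + 1" "word_deg (u @ op_letter y # v) = p + int k - 1"
    using assms op_letter_closed[of y] by auto
  moreover have "tensor_insert K A j (k + 1) (n - k - j) (int k - 1) (\<pi> (k - 1)) p (sp c (u @ y @ v))
      = sp (c + (int k - 1) * word_deg u) (u @ op_letter y # v)"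
    unfolding op_letter using assms pi_lin_arity[OF assms(6)] by (intro tensor_insert_sp) auto
  ultimately show ?thesis unfolding M_block_def M_obj_def by (simp only: pm_sp) (simp add: add_ac)
qed

text \<open>The face as a function of the set of entries instead of the increasing tuple.\<close>

definition set_face :: "nat \<Rightarrow> int \<Rightarrow> nat set \<Rightarrow> ((int \<times> 'a) list \<Rightarrow> 'k) set \<Rightarrow> ((int \<times> 'a) list \<Rightarrow> 'k) set"
  where "set_face n p I = M_face K A \<pi> n p (sorted_list_of_set I)"

lemma upt_block_eq: "1 \<le> k \<Longrightarrow> [j..<j + k] = [i..<i + k] \<longleftrightarrow> i = j"
  by (metis add_less_cancel_left add_0_right hd_upt less_le_trans zero_less_one)

lemma set_wrap:
  "q \<le> k \<Longrightarrow> k \<le> n \<Longrightarrow> set ([0..<k - q] @ [n - q + 1..<n + 1]) = {..<k - q} \<union> {n + 1 - q..n}"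
  by (auto simp del: upt_Suc)

lemma sorted_list_of_wrap:
  assumes "1 \<le> q" "q \<le> k" "k \<le> n"
  shows "sorted_list_of_set ({..<k - q} \<union> {n + 1 - q..n}) = [0..<k - q] @ [n - q + 1..<n + 1]"
proof -
  have "sorted_wrt (<) ([0..<k - q] @ [n - q + 1..<n + 1])"
    using assms by (auto simp: sorted_wrt_append)
  then show ?thesis using strict_sorted_eq set_wrap[OF assms(2,3)] by metis
qed

text \<open>The number $k-q$ of initial gaps is determined, because $k-q$ itself is missing from the arc.\<close>

lemma wrap_unique:
  fixes n k q q' :: nat
  assumes "1 \<le> q" "q \<le> k" "1 \<le> q'" "q' \<le> k" "k \<le> n"
    and "{..<k - q} \<union> {n + 1 - q..n} = {..<k - q'} \<union> {n + 1 - q'..n}"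
  shows "q = q'"
proof (rule ccontr)
  assume "q \<noteq> q'"
  then consider "q < q'" | "q' < q" by linarith
  then show False
  proof cases
    case 1
    have "k - q' \<in> {..<k - q} \<union> {n + 1 - q..n}" using 1 assms by auto
    then show False unfolding assms(6) using 1 assms by auto
  next
    case 2
    have "k - q \<in> {..<k - q'} \<union> {n + 1 - q'..n}" using 2 assms by auto
    then show False unfolding assms(6)[symmetric] using 2 assms by auto
  qed
qed

lemma set_face_block:
  assumes "1 \<le> k" "j + k \<le> n"
  shows "set_face n p {j..<j + k} x = block n p k j x"
proof -
  have "(i \<le> n - k \<and> [j..<j + k] = [i..<i + k]) \<longleftrightarrow> i = j" for i
    using assms upt_block_eq[OF assms(1), of j i] by auto
  then show ?thesis unfolding set_face_def M_face_def by simp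
qed

lemma set_face_wrap:
  assumes "1 \<le> q" "q \<le> k" "k \<le> n"
  shows "set_face n p ({..<k - q} \<union> {n + 1 - q..n}) x
    = pm (T (n - k + 1) (p + int k - 1)) (int q * (int k - 1)) (block n p k 0 ((cyc n p ^^ q) x))"
proof -
  let ?is = "[0..<k - q] @ [n - q + 1..<n + 1]"
  have len: "length ?is = k" using assms by simp
  have nb: "\<nexists>i. i \<le> n - k \<and> ?is = [i..<i + k]"
  proof (intro notI, elim exE conjE)
    fix i assume that: "i \<le> n - k" and eq: "?is = [i..<i + k]"
    have "n \<in> set [n - q + 1..<n + 1]" unfolding set_upt using assms by simp
    then have "n \<in> set ?is" unfolding set_append by (rule UnI2)
    then show False unfolding eq set_upt using that assms by simp arith
  qed
  have w: "1 \<le> q' \<and> q' \<le> k \<and> ?is = [0..<k - q'] @ [n - q' + 1..<n + 1] \<longleftrightarrow> q' = q" for q'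
  proof
    assume q': "1 \<le> q' \<and> q' \<le> k \<and> ?is = [0..<k - q'] @ [n - q' + 1..<n + 1]"
    then have "set ?is = {..<k - q'} \<union> {n + 1 - q'..n}" using set_wrap[of q' k n] assms by (simp only:)
    then show "q' = q" using wrap_unique[of q k q' n] q' assms set_wrap[OF assms(2,3)] by (simp only:)
  qed (use assms in simp)
  show ?thesis
    unfolding set_face_def sorted_list_of_wrap[OF assms] M_face_def len Let_def M_obj_def if_not_P[OF nb] w by simp
qed

lemma set_face_gap:
  assumes I: "valid_index n I" "k = card I" and "\<not> arc n I"
  shows "set_face n p I x = \<zero>\<^bsub>T (n - k + 1) (p + int k - 1)\<^esub>"
proof -
  let ?is = "sorted_list_of_set I"
  have set_is: "set ?is = I" using valid_index_finite[OF I(1)] by simp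
  have len: "length ?is = k" using I by simp
  have k: "1 \<le> k" "k \<le> n" using valid_index_card[OF I(1)] I(2) by auto
  have nb: "\<nexists>i. i \<le> n - k \<and> ?is = [i..<i + k]"
  proof (intro notI, elim exE conjE)
    fix i assume that: "i \<le> n - k" and "?is = [i..<i + k]"
    then have "I = {i..<i + k}" using set_is by (metis set_upt)
    moreover have "i + k \<le> n" using that k by simp
    ultimately show False using assms(3) unfolding arc_def I(2)[symmetric] by blast
  qed
  have nw: "\<nexists>q. 1 \<le> q \<and> q \<le> k \<and> ?is = [0..<k - q] @ [n - q + 1..<n + 1]"
  proof (intro notI, elim exE conjE)
    fix q assume that: "1 \<le> q" "q \<le> k" and eq: "?is = [0..<k - q] @ [n - q + 1..<n + 1]"
    have "set ?is = {..<k - q} \<union> {n + 1 - q..n}" unfolding eq using k that by (intro set_wrap)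
    then have "I = {..<k - q} \<union> {n + 1 - q..n}" by (simp only: set_is)
    then show False using assms(3) that unfolding arc_def I(2)[symmetric] by blast
  qed
  show ?thesis unfolding set_face_def M_face_def len Let_def M_obj_def if_not_P[OF nb] if_not_P[OF nw] ..
qed

lemma set_face_lin:
  assumes "valid_index n I" "k = card I"
  shows "set_face n p I \<in> lin_maps K (T (n + 1) p) (T (n - k + 1) (p + int k - 1))"
proof -
  have k: "1 \<le> k" "k \<le> n" using valid_index_card[OF assms(1)] assms(2) by auto
  from assms show ?thesis
  proof (cases rule: arc_cases)
    case (block j)
    then show ?thesis using k
      by (intro lin_maps_cong[OF T_module M_block_lin[of k j n p]]) (auto simp: set_face_block)
  next
    case (wrap q)
    have "(\<lambda>x. pm (T (n - k + 1) (p + int k - 1)) (int q * (int k - 1)) (block n p k 0 ((cyc n p ^^ q) x)))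
      \<in> lin_maps K (T (n + 1) p) (T (n - k + 1) (p + int k - 1))"
      by (rule lin_pm_map[OF T_module lin_comp[OF lin_funpow[OF M_t_lin] M_block_lin]]) (use k in auto)
    then show ?thesis
      by (rule lin_maps_cong[OF T_module]) (unfold wrap(3), rule set_face_wrap[OF wrap(1,2) k(2)])
  next
    case gap
    show ?thesis
      by (rule lin_maps_cong[OF T_module lin_zero_map[OF T_module]]) (rule set_face_gap[OF assms gap])
  qed
qed

lemma set_face_closed:
  "valid_index n I \<Longrightarrow> k = card I \<Longrightarrow> x \<in> carrier (T (n + 1) p) \<Longrightarrow> set_face n p I x \<in> carrier (T (n - k + 1) (p + int k - 1))"
  by (rule lin_mapsD(1)[OF set_face_lin])

text \<open>Contracting a block commutes with a rotation that does not cut the block. No extra sign appears: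
  the rotated letter pays the degree of the operation on one side in the Koszul sign of the operation,
  on the other in the Koszul sign of the rotation.\<close>

lemma M_block_M_t:
  assumes "1 \<le> k" "Suc j + k \<le> n" "x \<in> carrier (T (n + 1) p)"
  shows "block n p k (Suc j) (cyc n p x) = cyc (n - k) (p + int k - 1) (block n p k j x)"
proof (rule tensor_ext_sp[OF T_module lin_comp[OF M_t_lin M_block_lin] lin_comp[OF M_block_lin M_t_lin] _ assms(3)])
  fix w assume w: "letters w" "length w = n + 1" "word_deg w = p"
  then obtain w0 b where wb: "w = w0 @ [b]" by (cases w rule: rev_exhaust) auto
  have "length w0 = j + (k + 1) + (n - k - Suc j)" using w wb assms by simp
  then obtain u y v where uyv: "w0 = u @ y @ v" "length u = j" "length y = k + 1" "length v = n - k - Suc j"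
    by (rule word_split3)
  have "cyc n p (sp 0 w) = sp (fst b * word_deg w0) ((b # u) @ y @ v)"
    using M_t_sp[of w0 b n p 0] w wb uyv by simp
  then have "block n p k (Suc j) (cyc n p (sp 0 w))
    = sp (fst b * word_deg w0 + int k * (p - 1) + (int k - 1) * word_deg (b # u)) ((b # u) @ op_letter y # v)"
    by (simp only:) (rule M_block_sp; use assms w wb uyv in auto)
  also have "\<dots> = sp (int k * (p - 1) + (int k - 1) * word_deg u + fst b * word_deg (u @ op_letter y # v)) (b # u @ op_letter y # v)"
    unfolding append_Cons by (rule sp_parity) (auto simp: uyv)
  also have "\<dots> = cyc (n - k) (p + int k - 1) (sp (int k * (p - 1) + (int k - 1) * word_deg u) ((u @ op_letter y # v) @ [b]))"
    using assms w wb uyv op_letter_closed[of y] by (intro M_t_sp[symmetric]) auto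
  also have "sp (int k * (p - 1) + (int k - 1) * word_deg u) ((u @ op_letter y # v) @ [b]) = block n p k j (sp 0 w)"
    using assms w wb uyv M_block_sp[of u y "v @ [b]" j k n p 0] by simp
  finally show "block n p k (Suc j) (cyc n p (sp 0 w)) = cyc (n - k) (p + int k - 1) (block n p k j (sp 0 w))" .
qed (use assms in auto)

text \<open>The remaining rotation: the block at the end of the word becomes the block at its beginning.\<close>

lemma M_block_M_t_pow:
  assumes "1 \<le> k" "k \<le> n" "x \<in> carrier (T (n + 1) p)"
  shows "block n p k 0 ((cyc n p ^^ (k + 1)) x) = cyc (n - k) (p + int k - 1) (block n p k (n - k) x)"
proof (rule tensor_ext_sp[OF T_module lin_comp[OF lin_funpow[OF M_t_lin] M_block_lin] lin_comp[OF M_block_lin M_t_lin] _ assms(3)])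
  fix w assume w: "letters w" "length w = n + 1" "word_deg w = p"
  have "length w = (n - k) + (k + 1) + 0" using w assms by simp
  then obtain u y v where uyv: "w = u @ y @ v" "length u = n - k" "length y = k + 1" "length v = 0"
    by (rule word_split3)
  then have wuy: "w = u @ y" by simp
  have "(cyc n p ^^ (k + 1)) (sp 0 w) = sp (word_deg y * word_deg u) ([] @ y @ u)"
    using M_t_pow_sp[of u y n p 0] w wuy uyv assms by simp
  then have "block n p k 0 ((cyc n p ^^ (k + 1)) (sp 0 w))
    = sp (word_deg y * word_deg u + int k * (p - 1)) (op_letter y # u)"
    using assms w wuy uyv M_block_sp[of "[]" y u 0 k n p "word_deg y * word_deg u"] by (simp add: add.commute)
  also have "\<dots> = sp (int k * (p - 1) + (int k - 1) * word_deg u + fst (op_letter y) * word_deg u) (op_letter y # u)"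
    by (rule sp_parity) (auto simp: uyv)
  also have "\<dots> = cyc (n - k) (p + int k - 1) (sp (int k * (p - 1) + (int k - 1) * word_deg u) (u @ [op_letter y]))"
    using assms w wuy uyv op_letter_closed[of y] by (intro M_t_sp[symmetric]) auto
  also have "sp (int k * (p - 1) + (int k - 1) * word_deg u) (u @ [op_letter y]) = block n p k (n - k) (sp 0 w)"
    using assms w wuy uyv M_block_sp[of u y "[]" "n - k" k n p 0] by simp
  finally show "block n p k 0 ((cyc n p ^^ (k + 1)) (sp 0 w)) = cyc (n - k) (p + int k - 1) (block n p k (n - k) (sp 0 w))" .
qed (use assms in auto)

lemma set_face_M_t_pos:
  assumes I: "valid_index n I" "k = card I" and "0 \<notin> I" and x: "x \<in> carrier (T (n + 1) p)"
  shows "set_face n p I (cyc n p x) = cyc (n - k) (p + int k - 1) (set_face n p (rot n I) x)"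
proof -
  have k: "1 \<le> k" "k \<le> n" using valid_index_card[OF I(1)] I(2) by auto
  from I show ?thesis
  proof (cases rule: arc_cases)
    case (block j)
    then obtain i where i: "j = Suc i" using assms(3) k by (cases j) auto
    have "rot n I = {i..<i + k}" using block i by (intro rot_eqI) auto
    then show ?thesis using block i k M_block_M_t[of k i n x p] x set_face_block[of k i n p x]
      by (simp add: set_face_block del: add_Suc)
  next
    case (wrap q)
    then have q: "q = k" using assms(3) k by auto
    have "rot n I = {n - k..<n - k + k}" using wrap q k by (intro rot_eqI) auto
    moreover have "set_face n p I (cyc n p x) = block n p k 0 ((cyc n p ^^ (k + 1)) x)"
      unfolding wrap(3) q using k by (subst set_face_wrap) (auto simp: pm_even funpow_swap1)
    moreover have "set_face n p {n - k..<n - k + k} x = block n p k (n - k) x"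
      using k by (intro set_face_block) auto
    ultimately show ?thesis using M_block_M_t_pow[OF k x] by simp
  next
    case gap
    then have "\<not> arc n (rot n I)" using arc_rot[OF I(1)] by blast
    then have "set_face n p (rot n I) x = \<zero>\<^bsub>T (n - k + 1) (p + int k - 1)\<^esub>"
      using I by (intro set_face_gap valid_index_rot) (auto simp: card_rot valid_index_def)
    then show ?thesis using set_face_gap[OF I gap] lin_zero[OF T_module T_module M_t_lin] by simp
  qed
qed

lemma set_face_M_t_zero:
  assumes I: "valid_index n I" "k = card I" and "0 \<in> I" and x: "x \<in> carrier (T (n + 1) p)"
  shows "set_face n p I (cyc n p x) = pm (T (n - k + 1) (p + int k - 1)) (int k - 1) (set_face n p (rot n I) x)"
proof -
  let ?Y = "T (n - k + 1) (p + int k - 1)"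
  interpret Y: module K ?Y by (rule T_module)
  have k: "1 \<le> k" "k \<le> n" using valid_index_card[OF I(1)] I(2) by auto
  have wrap_pm: "pm ?Y (int q * (int k - 1)) (block n p k 0 ((cyc n p ^^ q) (cyc n p x)))
      = pm ?Y (int k - 1) (pm ?Y (int (Suc q) * (int k - 1)) (block n p k 0 ((cyc n p ^^ Suc q) x)))" for q
  proof -
    have "block n p k 0 ((cyc n p ^^ Suc q) x) \<in> carrier ?Y"
      using k by (intro lin_mapsD(1)[OF M_block_lin] M_t_pow_closed[OF x]) auto
    moreover have "(cyc n p ^^ Suc q) x = (cyc n p ^^ q) (cyc n p x)" by (simp add: funpow_swap1)
    moreover have "even (int q * (int k - 1) + (int k - 1 + int (Suc q) * (int k - 1)))" by auto
    ultimately show ?thesis by (simp only: Y.pm_pm) (rule pm_parity)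
  qed
  from I show ?thesis
  proof (cases rule: arc_cases)
    case (block j)
    then have j: "j = 0" using assms(3) by auto
    have "rot n I = {..<k - 1} \<union> {n + 1 - 1..n}" using block j k by (intro rot_eqI) auto
    moreover have "set_face n p I (cyc n p x) = block n p k 0 (cyc n p x)"
      unfolding block(2) j using k by (intro set_face_block) auto
    ultimately show ?thesis using wrap_pm[of 0] set_face_wrap[of 1 k n p x] k by (simp add: pm_even)
  next
    case (wrap q)
    have q: "q < k" using assms(3) wrap k by (cases "q = k") auto
    have "rot n I = {..<k - Suc q} \<union> {n + 1 - Suc q..n}" using wrap q k by (intro rot_eqI) auto
    moreover have "set_face n p I (cyc n p x) = pm ?Y (int q * (int k - 1)) (block n p k 0 ((cyc n p ^^ q) (cyc n p x)))"
      unfolding wrap(3) using k wrap by (intro set_face_wrap) auto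
    ultimately show ?thesis using wrap_pm[of q] set_face_wrap[of "Suc q" k n p x] k q by simp
  next
    case gap
    then have "\<not> arc n (rot n I)" using arc_rot[OF I(1)] by blast
    then have "set_face n p (rot n I) x = \<zero>\<^bsub>?Y\<^esub>"
      using I by (intro set_face_gap valid_index_rot) (auto simp: card_rot valid_index_def)
    then show ?thesis using set_face_gap[OF I gap] by (simp only: Y.pm_zero)
  qed
qed

end

section \<open>Reflected faces\<close>

text \<open>The gaps after a reflection of the circle that fixes $a_0$.\<close>

definition refl_index :: "nat \<Rightarrow> nat set \<Rightarrow> nat set"
  where "refl_index n I = (\<lambda>i. n - i) ` I"

lemma mem_refl_index:
  assumes "I \<subseteq> {..n}" shows "m \<in> refl_index n I \<longleftrightarrow> m \<le> n \<and> n - m \<in> I"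
proof
  assume "m \<in> refl_index n I"
  then obtain i where "i \<in> I" "m = n - i" by (auto simp: refl_index_def)
  then show "m \<le> n \<and> n - m \<in> I" using assms by auto
next
  assume "m \<le> n \<and> n - m \<in> I"
  then show "m \<in> refl_index n I" unfolding refl_index_def by (intro image_eqI[of _ _ "n - m"]) auto
qed

lemma card_refl_index: "I \<subseteq> {..n} \<Longrightarrow> card (refl_index n I) = card I"
  unfolding refl_index_def by (rule card_image, rule inj_onI) (metis diff_diff_cancel subsetD atMost_iff)

lemma valid_index_refl:
  assumes "valid_index n I" shows "valid_index n (refl_index n I)"
proof -
  have "I \<subseteq> {..n}" "I \<noteq> {}" "card I \<le> n" using assms by (auto simp: valid_index_def)
  then show ?thesis unfolding valid_index_def by (auto simp: card_refl_index) (auto simp: refl_index_def)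
qed

lemma rot_subset: "I \<subseteq> {..n} \<Longrightarrow> rot n I \<subseteq> {..n}"
  by (auto simp: mem_rot)

text \<open>The relation between rotation and reflection in the dihedral group, on sets of gaps.\<close>

lemma rot_refl_rot:
  assumes "I \<subseteq> {..n}" shows "rot n (refl_index n (rot n I)) = refl_index n I"
proof -
  have r: "rot n I \<subseteq> {..n}" by (rule rot_subset[OF assms])
  then have rr: "refl_index n (rot n I) \<subseteq> {..n}" by (auto simp: mem_refl_index)
  show ?thesis
  proof (rule rot_eqI[OF rr])
    show "refl_index n I \<subseteq> {..n}" using assms by (auto simp: mem_refl_index)
    show "m \<in> refl_index n I \<longleftrightarrow> Suc m \<in> refl_index n (rot n I)" if "m < n" for m
    proof -
      have "n - Suc m \<noteq> n" using that by arith
      then show ?thesis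
        using that by (simp add: mem_refl_index[OF assms] mem_refl_index[OF r] mem_rot[OF assms] Suc_diff_Suc)
    qed
    show "n \<in> refl_index n I \<longleftrightarrow> 0 \<in> refl_index n (rot n I)"
      by (simp add: mem_refl_index[OF assms] mem_refl_index[OF r] mem_rot[OF assms])
  qed
qed

lemma refl_refl_index: "I \<subseteq> {..n} \<Longrightarrow> refl_index n (refl_index n I) = I"
  unfolding refl_index_def image_image by (force simp: subset_iff)

lemma gap_not_arc:
  assumes "valid_index n I" "n \<notin> I" "\<And>j. I \<noteq> {j..<j + card I}"
  shows "\<not> arc n I" "\<not> arc n (refl_index n I)"
proof -
  have sub: "I \<subseteq> {..n}" using assms(1) by (simp add: valid_index_def)
  define k where "k = card I"
  have k: "1 \<le> k" "k \<le> n" using valid_index_card[OF assms(1)] by (auto simp: k_def)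
  show "\<not> arc n I"
    using assms(1) k_def
  proof (cases rule: arc_cases)
    case (wrap q)
    then have "n \<in> {n + 1 - q..n}" using k by auto
    then show ?thesis using wrap(3) assms(2) by blast
  next
    case (block j)
    then show ?thesis using assms(3)[of j] unfolding k_def by simp
  qed
  show "\<not> arc n (refl_index n I)"
    using valid_index_refl[OF assms(1)] card_refl_index[OF sub, folded k_def, symmetric]
  proof (cases rule: arc_cases)
    case (block j)
    have "I = refl_index n {j..<j + k}" using refl_refl_index[OF sub] block(2) by simp
    also have "\<dots> = {n + 1 - j - k..<n + 1 - j - k + k}"
    proof (rule Set.set_eqI)
      fix i show "i \<in> refl_index n {j..<j + k} \<longleftrightarrow> i \<in> {n + 1 - j - k..<n + 1 - j - k + k}"
        using block(1) by (subst mem_refl_index) auto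
    qed
    finally show ?thesis using assms(3)[of "n + 1 - j - k"] unfolding k_def by simp
  next
    case (wrap q)
    show ?thesis
    proof (cases "q = k")
      case True
      have "I = refl_index n ({..<k - q} \<union> {n + 1 - q..n})" using refl_refl_index[OF sub] wrap(3) by simp
      also have "\<dots> = {0..<0 + k}"
      proof (rule Set.set_eqI)
        fix i show "i \<in> refl_index n ({..<k - q} \<union> {n + 1 - q..n}) \<longleftrightarrow> i \<in> {0..<0 + k}"
          using True k by (subst mem_refl_index) auto
      qed
      finally show ?thesis using assms(3)[of 0] unfolding k_def by simp
    next
      case False
      then have "0 \<in> refl_index n I" using wrap by simp
      then show ?thesis using assms(2) by (simp add: mem_refl_index[OF sub])
    qed
  qed simp
qed

context signed_involutive_algebra
begin

lemma M_t_pow_M_r_M_t_pow: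
  assumes "x \<in> carrier (T (n + 1) m)"
  shows "(cyc n m ^^ i) (flip n m ((cyc n m ^^ i) x)) = flip n m x"
  using assms
proof (induction i arbitrary: x)
  case (Suc i)
  have "(cyc n m ^^ Suc i) (flip n m ((cyc n m ^^ Suc i) x))
    = (cyc n m ^^ i) (cyc n m (flip n m (cyc n m ((cyc n m ^^ i) x))))"
    by (simp add: funpow_swap1)
  then show ?case using Suc M_t_M_r_M_t[OF M_t_pow_closed[OF Suc.prems]] by simp
qed simp

text \<open>The axiom on $\pi_n(a_0\otimes\dots\otimes a_{n+1})^*$, with \<open>k - 1\<close> in the place of \<open>n\<close>, inside a word.\<close>

lemma sp_star_op_letter:
  assumes "letters (y @ v)" "length y = k + 1" "1 \<le> k"
  shows "sp c (star_letter (op_letter y) # v) = sp (c + int (k * (k - 1) div 2) + deg_pairs y) (op_letter (rev (map star_letter y)) # v)"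
proof -
  let ?q = "word_deg y + int (k - 1)" and ?y = "rev (map star_letter y)"
  let ?e = "int (k * (k - 1) div 2) + deg_pairs y"
  interpret Aq: module K "A ?q" by (rule graded_module)
  have star_letter: "(\<lambda>(q, a). (q, star q a)) = star_letter" by (auto simp: star_letter_def)
  have len: "length y - 2 = k - 1" using assms by simp
  have q: "fst (op_letter y) = ?q" "fst (op_letter ?y) = ?q" using assms by auto
  have "y \<in> tensor_words A (k - 1 + 2) (word_deg y)" using assms by (simp add: tensor_words_iff)
  from star_pi[OF this] have "snd (star_letter (op_letter y)) = pm (A ?q) ?e (snd (op_letter ?y))"
    using assms(2,3) len by (simp add: star_letter_def op_letter_def star_letter rev_map mult.commute add_diff_eq)
  then have b: "star_letter (op_letter y) = (?q, pm (A ?q) ?e (snd (op_letter ?y)))" using q by (simp add: prod_eq_iff)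
  have c: "snd (op_letter ?y) \<in> carrier (A ?q)" unfolding q(2)[symmetric] by (rule op_letter_closed) (use assms in auto)
  have br': "(?q, snd (op_letter ?y)) = op_letter ?y" by (simp only: q(2)[symmetric] prod.collapse)
  have "sp c ([] @ (?q, pm (A ?q) ?e (snd (op_letter ?y))) # v)
    = pm (T (length v + 1) (?q + word_deg v)) ?e (sp c ([] @ (?q, snd (op_letter ?y)) # v))"
    using assms by (intro lin_pm[OF graded_module T_module sp_slot c]) auto
  also have "\<dots> = sp (?e + c) (op_letter ?y # v)"
    unfolding br' append_Nil using assms c q by (intro pm_sp) (auto simp: add_diff_eq)
  finally show ?thesis using b by (simp add: add_ac)
qed

text \<open>Here $t_n^kr_n$ reverses the first \<open>k + 1\<close> letters among themselves and the other letters among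
  themselves, so that the operation is applied to the reversed block.\<close>

lemma M_block_M_r:
  assumes "1 \<le> k" "k \<le> n" "x \<in> carrier (T (n + 1) p)"
  shows "block n p k 0 ((cyc n p ^^ k) (flip n p x))
    = pm (T (n - k + 1) (p + int k - 1)) (int (k * (k - 1) div 2))
        (flip (n - k) (p + int k - 1) (block n p k 0 x))"
proof (rule tensor_ext_sp[OF T_module
      lin_comp[OF lin_comp[OF M_r_lin lin_funpow[OF M_t_lin]] M_block_lin]
      lin_pm_map[OF T_module lin_comp[OF M_block_lin M_r_lin]] _ assms(3)])
  fix w assume w: "letters w" "length w = n + 1" "word_deg w = p"
  have "length w = 0 + (k + 1) + (n - k)" using w assms by simp
  then obtain u y v where "w = u @ y @ v" "length u = 0" "length y = k + 1" "length v = n - k"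
    by (rule word_split3)
  then have yv: "w = y @ v" "length y = k + 1" "length v = n - k" by auto
  then obtain a y' where y: "y = a # y'" by (cases y) auto
  let ?y = "rev (map star_letter y)" and ?v = "rev (map star_letter v)"
  have l: "letters y" "letters v" "letters ?y" "letters ?v" "word_deg y + word_deg v = p" using w yv by auto
  have "flip n p (sp 0 w) = sp (rho_exp + deg_pairs (y' @ v)) ((star_letter a # ?v) @ rev (map star_letter y'))"
    using M_r_sp[of a "y' @ v" n p 0] w yv y by simp
  moreover have "(cyc n p ^^ k) \<dots> = sp (rho_exp + deg_pairs (y' @ v) + word_deg y' * (fst a + word_deg v)) (?y @ ?v)"
    using M_t_pow_sp[of "star_letter a # ?v" "rev (map star_letter y')" n p] w yv y by simp
  moreover have "block n p k 0 \<dots>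
      = sp (rho_exp + deg_pairs (y' @ v) + word_deg y' * (fst a + word_deg v) + int k * (p - 1)) (op_letter ?y # ?v)"
    using M_block_sp[of "[]" ?y ?v 0 k n p] l yv assms by simp
  moreover have "\<dots> = sp (int k * (p - 1) + rho_exp + deg_pairs v + int (k * (k - 1) div 2) + deg_pairs y + int (k * (k - 1) div 2)) (op_letter ?y # ?v)"
    by (rule sp_parity) (auto simp: y deg_pairs_append deg_pairs_Cons)
  ultimately have L: "block n p k 0 ((cyc n p ^^ k) (flip n p (sp 0 w)))
    = sp (int k * (p - 1) + rho_exp + deg_pairs v + int (k * (k - 1) div 2) + deg_pairs y + int (k * (k - 1) div 2)) (op_letter ?y # ?v)"
    by simp
  have op_letter: "snd (op_letter y) \<in> carrier (A (fst (op_letter y)))" "snd (op_letter ?y) \<in> carrier (A (fst (op_letter ?y)))"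
    using op_letter_closed[of y] op_letter_closed[of ?y] l yv assms by auto
  have "block n p k 0 (sp 0 w) = sp (int k * (p - 1)) (op_letter y # v)"
    using M_block_sp[of "[]" y v 0 k n p 0] l yv assms by simp
  moreover have "flip (n - k) (p + int k - 1) \<dots> = sp (int k * (p - 1) + rho_exp + deg_pairs v) (star_letter (op_letter y) # ?v)"
    using op_letter l yv by (intro M_r_sp) auto
  moreover have "\<dots> = sp (int k * (p - 1) + rho_exp + deg_pairs v + int (k * (k - 1) div 2) + deg_pairs y) (op_letter ?y # ?v)"
    using l yv assms by (intro sp_star_op_letter) auto
  moreover have "pm (T (n - k + 1) (p + int k - 1)) (int (k * (k - 1) div 2)) \<dots>
    = sp (int (k * (k - 1) div 2) + (int k * (p - 1) + rho_exp + deg_pairs v + int (k * (k - 1) div 2) + deg_pairs y)) (op_letter ?y # ?v)"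
    using op_letter l yv by (intro pm_sp) auto
  ultimately show "block n p k 0 ((cyc n p ^^ k) (flip n p (sp 0 w)))
    = pm (T (n - k + 1) (p + int k - 1)) (int (k * (k - 1) div 2))
        (flip (n - k) (p + int k - 1) (block n p k 0 (sp 0 w)))"
    unfolding L by (simp only:) (rule sp_parity, auto)
qed (use assms in auto)

text \<open>With $r = trt$ the face of \<open>I\<close> is expressed by the face of the rotated set, and the rotation that
  comes out on the left is absorbed in the same way.\<close>

lemma set_face_M_r:
  assumes "valid_index n I" "x \<in> carrier (T (n + 1) p)"
  shows "set_face n p I (flip n p x)
    = pm (T (n - card I + 1) (p + int (card I) - 1)) (int (card I * (card I - 1) div 2))
        (flip (n - card I) (p + int (card I) - 1) (set_face n p (refl_index n I) x))"
  using assms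
proof (induction arbitrary: x p rule: rot_cyclic_induct)
  case (rot I)
  let ?k = "card I"
  let ?Y = "T (n - ?k + 1) (p + int ?k - 1)"
  let ?e = "int (?k * (?k - 1) div 2)"
  let ?t = "cyc (n - ?k) (p + int ?k - 1)" and ?r = "flip (n - ?k) (p + int ?k - 1)"
  interpret Y: module K ?Y by (rule T_module)
  have sub: "I \<subseteq> {..n}" using rot.hyps(1) by (simp add: valid_index_def)
  have c: "card (rot n I) = ?k" "card (refl_index n I) = ?k" "card (refl_index n (rot n I)) = ?k"
    using sub card_refl_index[OF rot_subset[OF sub]] by (auto simp: card_rot card_refl_index)
  have val: "valid_index n (rot n I)" "valid_index n (refl_index n (rot n I))" "valid_index n (refl_index n I)"
    using rot.hyps(1) by (auto intro: valid_index_rot valid_index_refl)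
  have tx: "cyc n p x \<in> carrier (T (n + 1) p)" by (rule M_t_closed[OF rot.prems])
  have rtx: "flip n p (cyc n p x) \<in> carrier (T (n + 1) p)" by (rule M_r_closed[OF tx])
  define z where "z = set_face n p (refl_index n I) x"
  have z: "z \<in> carrier ?Y" unfolding z_def using set_face_closed[OF val(3) refl rot.prems] c by simp
  have IH: "set_face n p (rot n I) (flip n p (cyc n p x)) = pm ?Y ?e (?r (set_face n p (refl_index n (rot n I)) (cyc n p x)))"
    using rot.IH[OF tx] by (simp only: c)
  have rx: "flip n p x = cyc n p (flip n p (cyc n p x))"
    by (rule M_t_M_r_M_t[OF rot.prems, symmetric])
  show ?case
  proof (cases "0 \<in> I")
    case False
    then have "0 \<notin> refl_index n (rot n I)" by (simp add: mem_refl_index[OF rot_subset[OF sub]] mem_rot[OF sub])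
    then have "set_face n p (refl_index n (rot n I)) (cyc n p x) = ?t z"
      unfolding z_def using set_face_M_t_pos[OF val(2) c(3)[symmetric] _ rot.prems] by (simp add: rot_refl_rot[OF sub])
    then have "set_face n p I (flip n p x) = ?t (pm ?Y ?e (?r (?t z)))"
      using set_face_M_t_pos[OF rot.hyps(1) refl False rtx] rx IH by simp
    also have "\<dots> = pm ?Y ?e (?t (?r (?t z)))"
      by (rule lin_pm[OF T_module T_module M_t_lin M_r_closed[OF M_t_closed[OF z]]])
    also have "?t (?r (?t z)) = ?r z" by (rule M_t_M_r_M_t[OF z])
    finally show ?thesis by (simp only: z_def)
  next
    case True
    then have "0 \<in> refl_index n (rot n I)" by (simp add: mem_refl_index[OF rot_subset[OF sub]] mem_rot[OF sub])
    then have f: "set_face n p (refl_index n (rot n I)) (cyc n p x) = pm ?Y (int ?k - 1) z"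
      unfolding z_def using set_face_M_t_zero[OF val(2) c(3)[symmetric] _ rot.prems] by (simp add: rot_refl_rot[OF sub])
    have "set_face n p I (flip n p x) = pm ?Y (int ?k - 1) (pm ?Y ?e (?r (pm ?Y (int ?k - 1) z)))"
      using set_face_M_t_zero[OF rot.hyps(1) refl True rtx] rx IH f by simp
    also have "?r (pm ?Y (int ?k - 1) z) = pm ?Y (int ?k - 1) (?r z)"
      by (rule lin_pm[OF T_module T_module M_r_lin z])
    also have "pm ?Y (int ?k - 1) (pm ?Y ?e (pm ?Y (int ?k - 1) (?r z))) = pm ?Y ?e (?r z)"
      using M_r_closed[OF z] by (simp only: Y.pm_pm Y.pm_closed) (rule pm_parity, simp)
    finally show ?thesis by (simp only: z_def)
  qed
next
  case (initial k)
  let ?Y = "T (n - k + 1) (p + int k - 1)"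
  have r: "refl_index n {..<k} = {..<k - k} \<union> {n + 1 - k..n}"
  proof (rule Set.set_eqI)
    fix i show "i \<in> refl_index n {..<k} \<longleftrightarrow> i \<in> {..<k - k} \<union> {n + 1 - k..n}"
      using initial by (subst mem_refl_index) auto
  qed
  have "set_face n p (refl_index n {..<k}) x = block n p k 0 ((cyc n p ^^ k) x)"
    unfolding r using initial by (subst set_face_wrap) (auto simp: pm_even)
  moreover have "set_face n p {..<k} (flip n p x) = block n p k 0 (flip n p x)"
    using set_face_block[of k 0 n p] initial by (simp add: atLeast0LessThan)
  ultimately show ?case
    using M_block_M_r[OF initial(1,2) M_t_pow_closed[OF initial.prems, of k]] M_t_pow_M_r_M_t_pow[OF initial.prems, of k]
    unfolding card_lessThan by simp
next
  case (gap I)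
  have sub: "I \<subseteq> {..n}" using gap by (simp add: valid_index_def)
  have "set_face n p I (flip n p x) = \<zero>\<^bsub>T (n - card I + 1) (p + int (card I) - 1)\<^esub>"
    using gap gap_not_arc[of n I] by (intro set_face_gap) auto
  moreover have "set_face n p (refl_index n I) x = \<zero>\<^bsub>T (n - card I + 1) (p + int (card I) - 1)\<^esub>"
    using gap gap_not_arc[of n I] by (intro set_face_gap valid_index_refl) (auto simp: card_refl_index[OF sub])
  ultimately show ?case
    by (simp only: lin_zero[OF T_module T_module M_r_lin] module.pm_zero[OF T_module])
qed

end

section \<open>Rotation of the sum over the subsets of an index set\<close>

definition rot1 :: "nat \<Rightarrow> nat \<Rightarrow> nat"
  where "rot1 n i = (if i = 0 then n else i - 1)"

lemma rot_eq_image: "rot n I = rot1 n ` I"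
  by (simp add: rot_def rot1_def)

lemma rot1_inj: "inj_on (rot1 n) {..n}"
  by (auto simp: inj_on_def rot1_def split: if_splits)

lemma rot_Diff: "I \<subseteq> {..n} \<Longrightarrow> S \<subseteq> I \<Longrightarrow> rot n (I - S) = rot n I - rot n S"
  unfolding rot_eq_image by (rule inj_on_image_set_diff[OF rot1_inj]) auto

lemma rot_image_proper_subsets:
  assumes "I \<subseteq> {..n}"
  shows "inj_on (rot n) {S. S \<subset> I \<and> S \<noteq> {}}"
    "rot n ` {S. S \<subset> I \<and> S \<noteq> {}} = {S. S \<subset> rot n I \<and> S \<noteq> {}}"
proof -
  have inj: "inj_on (rot1 n) I" by (rule inj_on_subset[OF rot1_inj assms])
  show "inj_on (rot n) {S. S \<subset> I \<and> S \<noteq> {}}"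
  proof -
    have "rot n = (`) (rot1 n)" by (simp add: fun_eq_iff rot_eq_image)
    then show ?thesis by (simp only:) (rule inj_on_subset[OF inj_on_image_Pow[OF inj]], auto)
  qed
  show "rot n ` {S. S \<subset> I \<and> S \<noteq> {}} = {S. S \<subset> rot n I \<and> S \<noteq> {}}"
  proof (intro equalityI subsetI)
    fix S assume "S \<in> rot n ` {S. S \<subset> I \<and> S \<noteq> {}}"
    then obtain S' where S': "S' \<subset> I" "S' \<noteq> {}" "S = rot n S'" by blast
    then have "rot1 n ` S' \<subset> rot1 n ` I" using inj by (metis image_strict_mono)
    then show "S \<in> {S. S \<subset> rot n I \<and> S \<noteq> {}}" using S' by (simp add: rot_eq_image)
  next
    fix S assume S: "S \<in> {S. S \<subset> rot n I \<and> S \<noteq> {}}"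
    then obtain S' where S': "S' \<subseteq> I" "S = rot1 n ` S'" unfolding rot_eq_image by (auto simp: subset_image_iff psubset_eq)
    moreover have "S' \<noteq> I" using S S' by (auto simp: rot_eq_image)
    moreover have "S' \<noteq> {}" using S S' by auto
    ultimately show "S \<in> rot n ` {S. S \<subset> I \<and> S \<noteq> {}}" by (auto simp: rot_eq_image)
  qed
qed

lemma rot_proper_subset:
  assumes "I \<subseteq> {..n}" "S \<subset> I" "S \<noteq> {}" shows "rot n S \<subset> rot n I" "rot n S \<noteq> {}"
proof -
  have "rot n S \<in> rot n ` {S. S \<subset> I \<and> S \<noteq> {}}" using assms by (intro imageI) simp
  then show "rot n S \<subset> rot n I" "rot n S \<noteq> {}" unfolding rot_image_proper_subsets(2)[OF assms(1)] by simp_all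
qed

lemma card_rot_filter:
  assumes "S \<subseteq> {..n}"
  shows "card {s \<in> rot n S. P s} = card {s \<in> S. P (rot1 n s)}"
proof -
  have "{s \<in> rot n S. P s} = rot1 n ` {s \<in> S. P (rot1 n s)}" by (auto simp: rot_eq_image)
  moreover have "inj_on (rot1 n) {s \<in> S. P (rot1 n s)}" by (rule inj_on_subset[OF rot1_inj]) (use assms in auto)
  ultimately show ?thesis by (simp add: card_image)
qed

lemma crossings_rot:
  assumes "S \<subseteq> {..n}" "T \<subseteq> {..n}"
  shows "crossings (rot n S) (rot n T) = (\<Sum>s\<in>S. card {t \<in> T. rot1 n s < rot1 n t})"
proof -
  have "inj_on (rot1 n) S" by (rule inj_on_subset[OF rot1_inj assms(1)])
  then show ?thesis unfolding crossings_def rot_eq_image[of n S]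
    by (simp add: sum.reindex card_rot_filter[OF assms(2)])
qed

text \<open>How the number of crossings changes when the cyclic order is cut one step further.\<close>

lemma crossings_rot_neither:
  assumes "S \<subseteq> {..n}" "T \<subseteq> {..n}" "0 \<notin> S" "0 \<notin> T"
  shows "crossings (rot n S) (rot n T) = crossings S T"
  unfolding crossings_rot[OF assms(1,2)] unfolding crossings_def
proof (intro sum.cong arg_cong[of _ _ card] Collect_cong conj_cong refl)
  fix s t assume "s \<in> S" "t \<in> T"
  then have "s \<noteq> 0" "t \<noteq> 0" using assms by metis+
  then show "rot1 n s < rot1 n t \<longleftrightarrow> s < t" by (auto simp: rot1_def)
qed

lemma crossings_rot_source:
  assumes "S \<subseteq> {..n}" "T \<subseteq> {..n}" "0 \<in> S" "0 \<notin> T"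
  shows "crossings S T = card T + crossings (rot n S) (rot n T)"
proof -
  have fin: "finite S" "finite T" using assms finite_subset by auto
  have "T = {t \<in> T. 0 < t}" using assms(4) by (metis (mono_tags, lifting) Collect_cong Collect_mem_eq neq0_conv)
  then have T: "card {t \<in> T. 0 < t} = card T" by simp
  have z: "{t \<in> T. rot1 n 0 < rot1 n t} = {}"
  proof -
    have "rot1 n t \<le> n" if "t \<in> T" for t using that assms(2) by (auto simp: rot1_def)
    then show ?thesis by (force simp: rot1_def not_less)
  qed
  have "(\<Sum>s\<in>S - {0}. card {t \<in> T. s < t}) = (\<Sum>s\<in>S - {0}. card {t \<in> T. rot1 n s < rot1 n t})"
  proof (intro sum.cong arg_cong[of _ _ card] Collect_cong conj_cong refl)
    fix s t assume "s \<in> S - {0}" "t \<in> T"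
    then have "s \<noteq> 0" "t \<noteq> 0" using assms by (auto intro: ccontr)
    then show "s < t \<longleftrightarrow> rot1 n s < rot1 n t" by (auto simp: rot1_def)
  qed
  moreover have "crossings S T = card {t \<in> T. 0 < t} + (\<Sum>s\<in>S - {0}. card {t \<in> T. s < t})"
    unfolding crossings_def by (rule sum.remove[OF fin(1) assms(3)])
  moreover have "crossings (rot n S) (rot n T) = card {t \<in> T. rot1 n 0 < rot1 n t} + (\<Sum>s\<in>S - {0}. card {t \<in> T. rot1 n s < rot1 n t})"
    unfolding crossings_rot[OF assms(1,2)] by (rule sum.remove[OF fin(1) assms(3)])
  ultimately show ?thesis using T z by simp
qed

lemma crossings_rot_target:
  assumes "S \<subseteq> {..n}" "T \<subseteq> {..n}" "0 \<notin> S" "0 \<in> T"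
  shows "crossings (rot n S) (rot n T) = crossings S T + card S"
proof -
  have fin: "finite T" using assms finite_subset by auto
  have "card {t \<in> T. rot1 n s < rot1 n t} = card {t \<in> T. s < t} + 1" if s: "s \<in> S" for s
  proof -
    have s': "s \<noteq> 0" "s \<le> n" using s assms by (auto intro: ccontr)
    have "{t \<in> T. rot1 n s < rot1 n t} = insert 0 {t \<in> T. s < t}"
      using assms(4) s' by (auto simp: rot1_def)
    then show ?thesis using fin by simp
  qed
  then show ?thesis unfolding crossings_rot[OF assms(1,2)] by (simp add: crossings_def sum_Suc)
qed

text \<open>Removing \<open>S\<close> from the circle and rotating commute, as long as the gap that moves from the
  beginning to the end is not itself removed.\<close>

lemma squeeze_rot:
  assumes "S \<subseteq> {..n}" "T \<subseteq> {..n}" "0 \<notin> S"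
  shows "rot (n - card S) (squeeze S ` T) = squeeze (rot n S) ` rot n T"
  unfolding rot_eq_image[of _ T] rot_eq_image[of "n - card S"] image_image
proof (rule image_cong[OF refl])
  fix t assume t: "t \<in> T"
  show "rot1 (n - card S) (squeeze S t) = squeeze (rot n S) (rot1 n t)"
  proof (cases "t = 0")
    case True
    have "{s \<in> S. rot1 n s < n} = S"
    proof -
      have "rot1 n s < n" if "s \<in> S" for s
      proof -
        have "s \<noteq> 0" "s \<le> n" using that assms by (auto intro: ccontr)
        then show ?thesis by (simp add: rot1_def)
      qed
      then show ?thesis by auto
    qed
    then show ?thesis using True card_rot_filter[OF assms(1), of "\<lambda>s. s < n"] by (simp add: squeeze_def rot1_def)
  next
    case False
    have "{s \<in> S. rot1 n s < rot1 n t} = {s \<in> S. s < t}"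
    proof (intro Collect_cong conj_cong refl)
      fix s assume "s \<in> S"
      then have "s \<noteq> 0" using assms by (auto intro: ccontr)
      then show "rot1 n s < rot1 n t \<longleftrightarrow> s < t" using False by (auto simp: rot1_def)
    qed
    then have c: "card {s \<in> rot n S. s < rot1 n t} = card {s \<in> S. s < t}"
      using card_rot_filter[OF assms(1), of "\<lambda>s. s < rot1 n t"] by simp
    have "{s \<in> S. s < t} \<subseteq> {1..<t}"
    proof
      fix s assume s: "s \<in> {s \<in> S. s < t}"
      then have "s \<noteq> 0" using assms by (auto intro: ccontr)
      then show "s \<in> {1..<t}" using s by auto
    qed
    then have "card {s \<in> S. s < t} \<le> t - 1" using card_mono[of "{1..<t}"] by fastforce
    then have "card {s \<in> S. s < t} < t" using False by arith
    then show ?thesis using False c by (simp add: squeeze_def rot1_def)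
  qed
qed

text \<open>If the gap 0 is removed, rotating does not change the enumeration of what is left.\<close>

lemma squeeze_rot_source:
  assumes "S \<subseteq> {..n}" "T \<subseteq> {..n}" "0 \<in> S" "0 \<notin> T"
  shows "squeeze S ` T = squeeze (rot n S) ` rot n T"
  unfolding rot_eq_image[of _ T] image_image
proof (rule image_cong[OF refl])
  fix t assume t: "t \<in> T"
  then have t0: "t \<noteq> 0" "t \<le> n" using assms by (auto intro: ccontr)
  have fin: "finite S" using assms finite_subset by auto
  have tn: "\<not> n < t - Suc 0" using t0 by arith
  have "{s \<in> S. s < t} = insert 0 {s \<in> S. rot1 n s < rot1 n t}"
    using assms(3) t0 by (auto simp: rot1_def tn)
  moreover have "0 \<notin> {s \<in> S. rot1 n s < rot1 n t}" using t0 by (simp add: rot1_def tn)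
  ultimately have "card {s \<in> S. s < t} = Suc (card {s \<in> S. rot1 n s < rot1 n t})"
    using fin by simp
  also have "card {s \<in> S. rot1 n s < rot1 n t} = card {s \<in> rot n S. s < rot1 n t}"
    using card_rot_filter[OF assms(1), of "\<lambda>s. s < rot1 n t"] by simp
  finally show "squeeze S t = squeeze (rot n S) (rot1 n t)"
    using t0 by (simp add: squeeze_def rot1_def)
qed

lemma squeeze_le:
  assumes "S \<subseteq> {..n}" "t \<le> n" "t \<notin> S" shows "squeeze S t \<le> n - card S"
proof -
  have "S \<subseteq> {s \<in> S. s < t} \<union> {s \<in> S. t \<le> s}" by auto
  then have "card S \<le> card ({s \<in> S. s < t} \<union> {s \<in> S. t \<le> s})"
    using finite_subset[OF assms(1)] by (intro card_mono) auto
  also have "\<dots> \<le> card {s \<in> S. s < t} + card {s \<in> S. t \<le> s}" by (rule card_Un_le)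
  finally have c: "card S \<le> card {s \<in> S. s < t} + card {s \<in> S. t \<le> s}" .
  have "{s \<in> S. t \<le> s} \<subseteq> {t<..n}" using assms by (auto simp: less_le)
  then have "card {s \<in> S. t \<le> s} \<le> n - t" using card_mono[of "{t<..n}"] by fastforce
  then show ?thesis using c assms card_below[of S t] unfolding squeeze_def by linarith
qed


lemma card_squeeze_image:
  assumes "S \<inter> T = {}" shows "card (squeeze S ` T) = card T"
proof (rule card_image, rule inj_onI)
  fix t t' assume "t \<in> T" "t' \<in> T" "squeeze S t = squeeze S t'"
  then show "t = t'" using squeeze_less[of t t' S] squeeze_less[of t' t S] assms
    by (cases t t' rule: linorder_cases) auto
qed

lemma valid_index_subset: "valid_index n I \<Longrightarrow> S \<subseteq> I \<Longrightarrow> S \<noteq> {} \<Longrightarrow> valid_index n S"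
  using card_mono[OF valid_index_finite, of n I S] unfolding valid_index_def by auto

lemma valid_index_squeeze:
  assumes "valid_index n I" "S \<subset> I"
  shows "valid_index (n - card S) (squeeze S ` (I - S))" "card (squeeze S ` (I - S)) = card I - card S"
    "card S < card I"
proof -
  have fin: "finite I" "finite S" using valid_index_finite[OF assms(1)] assms(2) finite_subset by auto
  have sub: "I \<subseteq> {..n}" "card I \<le> n" using assms(1) by (auto simp: valid_index_def)
  show lt: "card S < card I" using assms(2) fin by (intro psubset_card_mono)
  show c: "card (squeeze S ` (I - S)) = card I - card S"
    using fin assms(2) by (subst card_squeeze_image) (auto intro: card_Diff_subset)
  have "squeeze S ` (I - S) \<subseteq> {..n - card S}" using sub assms(2) squeeze_le[of S n] by auto
  then show "valid_index (n - card S) (squeeze S ` (I - S))"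
    using c lt sub assms(2) unfolding valid_index_def by auto
qed

section \<open>The relation between the faces is invariant under rotation\<close>

context A_infinity_algebra
begin

text \<open>The contribution of the subset \<open>S\<close> to the boundary of the face of \<open>I\<close>.\<close>

definition face_term :: "nat \<Rightarrow> int \<Rightarrow> nat set \<Rightarrow> nat set \<Rightarrow> ((int \<times> 'a) list \<Rightarrow> 'k) set \<Rightarrow> ((int \<times> 'a) list \<Rightarrow> 'k) set"
  where "face_term n p I S x = pm (T (n - card I + 1) (p + int (card I) - 2)) (int (crossings S (I - S)) + 1)
    (set_face (n - card S) (p + int (card S) - 1) (squeeze S ` (I - S)) (set_face n p S x))"

definition face_relation :: "nat \<Rightarrow> nat set \<Rightarrow> bool"
  where "face_relation n I \<longleftrightarrow> (\<forall>p. \<forall>x\<in>carrier (T (n + 1) p).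
    bd (n - card I + 1) (p + int (card I) - 1) (set_face n p I x)
      \<oplus>\<^bsub>T (n - card I + 1) (p + int (card I) - 2)\<^esub> set_face n (p - 1) I (bd (n + 1) p x)
    = (\<Oplus>\<^bsub>T (n - card I + 1) (p + int (card I) - 2)\<^esub>S\<in>{S. S \<subset> I \<and> S \<noteq> {}}. face_term n p I S x))"

lemma double_face_closed:
  assumes "valid_index n I" "S \<subset> I" "S \<noteq> {}" "x \<in> carrier (T (n + 1) p)"
  shows "set_face n p S x \<in> carrier (T (n - card S + 1) (p + int (card S) - 1))"
    "set_face (n - card S) (p + int (card S) - 1) (squeeze S ` (I - S)) (set_face n p S x)
      \<in> carrier (T (n - card I + 1) (p + int (card I) - 2))"
proof -
  note sq = valid_index_squeeze[OF assms(1,2)]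
  have S: "valid_index n S" using valid_index_subset[OF assms(1)] assms by auto
  show x': "set_face n p S x \<in> carrier (T (n - card S + 1) (p + int (card S) - 1))"
    by (rule set_face_closed[OF S refl assms(4)])
  have "n - card S - (card I - card S) = n - card I" "p + int (card S) - 1 + int (card I - card S) - 1 = p + int (card I) - 2"
    using sq(3) by auto
  then show "set_face (n - card S) (p + int (card S) - 1) (squeeze S ` (I - S)) (set_face n p S x)
      \<in> carrier (T (n - card I + 1) (p + int (card I) - 2))"
    using set_face_closed[OF sq(1) sq(2)[symmetric] x'] by (simp only:)
qed

lemma face_term_closed:
  assumes "valid_index n I" "S \<subset> I" "S \<noteq> {}" "x \<in> carrier (T (n + 1) p)"
  shows "face_term n p I S x \<in> carrier (T (n - card I + 1) (p + int (card I) - 2))"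
  unfolding face_term_def by (rule module.pm_closed[OF T_module double_face_closed(2)[OF assms]])

lemma face_term_M_t_pos:
  assumes I: "valid_index n I" "S \<subset> I" "S \<noteq> {}" and "0 \<notin> I" and x: "x \<in> carrier (T (n + 1) p)"
  shows "face_term n p I S (cyc n p x)
    = cyc (n - card I) (p + int (card I) - 2) (face_term n p (rot n I) (rot n S) x)"
proof -
  note sq = valid_index_squeeze[OF I(1,2)]
  have sub: "I \<subseteq> {..n}" "S \<subseteq> I" "S \<subseteq> {..n}" "I - S \<subseteq> {..n}" using I by (auto simp: valid_index_def)
  have z: "0 \<notin> S" "0 \<notin> I - S" using assms(4) sub by auto
  have S: "valid_index n S" using valid_index_subset[OF I(1)] I by auto
  have rI: "valid_index n (rot n I)" "rot n S \<subset> rot n I" "rot n S \<noteq> {}"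
    using valid_index_rot[OF I(1)] rot_proper_subset[OF sub(1) I(2,3)] by auto
  have c: "card (rot n S) = card S" "card (rot n I) = card I" using sub by (auto simp: card_rot)
  define y where "y = set_face n p (rot n S) x"
  have y: "y \<in> carrier (T (n - card S + 1) (p + int (card S) - 1))"
    using double_face_closed(1)[OF rI x] c by (simp add: y_def)
  have y2: "set_face (n - card S) (p + int (card S) - 1) (squeeze (rot n S) ` rot n (I - S)) y
    \<in> carrier (T (n - card I + 1) (p + int (card I) - 2))"
    using double_face_closed(2)[OF rI x] c rot_Diff[OF sub(1,2)] by (simp add: y_def)
  have sq0: "0 \<notin> squeeze S ` (I - S)"
  proof
    assume "0 \<in> squeeze S ` (I - S)"
    then obtain t where t: "t \<in> I - S" "squeeze S t = 0" by auto
    then have "t \<noteq> 0" using z by metis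
    then have "squeeze S 0 < squeeze S t" using z by (intro squeeze_less) auto
    then show False using t by simp
  qed
  have n: "n - card S - (card I - card S) = n - card I" "p + int (card S) - 1 + int (card I - card S) - 1 = p + int (card I) - 2"
    using sq(3) by auto
  have "set_face n p S (cyc n p x) = cyc (n - card S) (p + int (card S) - 1) y"
    unfolding y_def by (rule set_face_M_t_pos[OF S refl z(1) x])
  then have "set_face (n - card S) (p + int (card S) - 1) (squeeze S ` (I - S)) (set_face n p S (cyc n p x))
    = cyc (n - card I) (p + int (card I) - 2) (set_face (n - card S) (p + int (card S) - 1) (squeeze (rot n S) ` rot n (I - S)) y)"
    using set_face_M_t_pos[OF sq(1) sq(2)[symmetric] sq0 y] squeeze_rot[OF sub(3,4) z(1)] by (simp only: n)
  moreover have "crossings (rot n S) (rot n (I - S)) = crossings S (I - S)"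
    by (rule crossings_rot_neither[OF sub(3,4) z])
  ultimately show ?thesis
    using lin_pm[OF T_module T_module M_t_lin y2] unfolding face_term_def c rot_Diff[OF sub(1,2), symmetric]
    by (simp add: y_def)
qed

text \<open>The gap 0 lies in \<open>S\<close> or in its complement. In the first case the inner face gives the sign
  $(-1)^{|S|-1}$ and the crossings of the gap 0 with the complement disappear; in the second case the
  outer face gives the sign $(-1)^{|I\setminus S|-1}$ and each element of \<open>S\<close> gets one crossing more,
  with the new last gap. In both cases the total is $(-1)^{|I|-1}$.\<close>

lemma face_term_M_t_zero:
  assumes I: "valid_index n I" "S \<subset> I" "S \<noteq> {}" and "0 \<in> I" and x: "x \<in> carrier (T (n + 1) p)"
  shows "face_term n p I S (cyc n p x)
    = pm (T (n - card I + 1) (p + int (card I) - 2)) (int (card I) - 1) (face_term n p (rot n I) (rot n S) x)"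
proof -
  let ?Y = "T (n - card I + 1) (p + int (card I) - 2)"
  let ?f = "set_face (n - card S) (p + int (card S) - 1)"
  interpret Y: module K ?Y by (rule T_module)
  note sq = valid_index_squeeze[OF I(1,2)]
  have sub: "I \<subseteq> {..n}" "S \<subseteq> I" "S \<subseteq> {..n}" "I - S \<subseteq> {..n}" using I by (auto simp: valid_index_def)
  have fin: "finite S" using finite_subset[OF sub(3)] by simp
  have S: "valid_index n S" using valid_index_subset[OF I(1)] I by auto
  have rI: "valid_index n (rot n I)" "rot n S \<subset> rot n I" "rot n S \<noteq> {}"
    using valid_index_rot[OF I(1)] rot_proper_subset[OF sub(1) I(2,3)] by auto
  have c: "card (rot n S) = card S" "card (rot n I) = card I" "card (I - S) = card I - card S"
    using sub fin by (auto simp: card_rot card_Diff_subset)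
  define y where "y = set_face n p (rot n S) x"
  have y: "y \<in> carrier (T (n - card S + 1) (p + int (card S) - 1))"
    using double_face_closed(1)[OF rI x] c by (simp add: y_def)
  have y2: "?f (squeeze (rot n S) ` rot n (I - S)) y \<in> carrier ?Y"
    using double_face_closed(2)[OF rI x] c rot_Diff[OF sub(1,2)] by (simp add: y_def)
  have n: "n - card S - (card I - card S) = n - card I" "p + int (card S) - 1 + int (card I - card S) - 1 = p + int (card I) - 2"
    using sq(3) by auto
  have R: "face_term n p (rot n I) (rot n S) x
    = pm ?Y (int (crossings (rot n S) (rot n (I - S))) + 1) (?f (squeeze (rot n S) ` rot n (I - S)) y)"
    unfolding face_term_def c rot_Diff[OF sub(1,2), symmetric] y_def ..
  show ?thesis
  proof (cases "0 \<in> S")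
    case True
    then have z: "0 \<notin> I - S" by simp
    have "set_face n p S (cyc n p x) = pm (T (n - card S + 1) (p + int (card S) - 1)) (int (card S) - 1) y"
      unfolding y_def by (rule set_face_M_t_zero[OF S refl True x])
    moreover have "?f (squeeze S ` (I - S)) (pm (T (n - card S + 1) (p + int (card S) - 1)) (int (card S) - 1) y)
        = pm ?Y (int (card S) - 1) (?f (squeeze S ` (I - S)) y)"
      using lin_pm[OF T_module T_module set_face_lin[OF sq(1) sq(2)[symmetric]] y] by (simp only: n)
    ultimately have "face_term n p I S (cyc n p x) = pm ?Y (int (crossings S (I - S)) + 1)
        (pm ?Y (int (card S) - 1) (?f (squeeze (rot n S) ` rot n (I - S)) y))"
      unfolding face_term_def squeeze_rot_source[OF sub(3,4) True z] by (simp only:)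
    also have "\<dots> = pm ?Y (int (card I) - 1) (face_term n p (rot n I) (rot n S) x)"
      unfolding R using y2 crossings_rot_source[OF sub(3,4) True z] c sq(3)
      by (simp only: Y.pm_pm) (rule pm_parity, auto simp: of_nat_diff)
    finally show ?thesis .
  next
    case False
    then have z: "0 \<in> I - S" using assms(4) by simp
    have "squeeze S 0 = 0" by (simp add: squeeze_def)
    then have sq0: "0 \<in> squeeze S ` (I - S)" using z by (metis image_eqI)
    have "set_face n p S (cyc n p x) = cyc (n - card S) (p + int (card S) - 1) y"
      unfolding y_def by (rule set_face_M_t_pos[OF S refl False x])
    moreover have "?f (squeeze S ` (I - S)) (cyc (n - card S) (p + int (card S) - 1) y)
        = pm ?Y (int (card I - card S) - 1) (?f (squeeze (rot n S) ` rot n (I - S)) y)"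
      using set_face_M_t_zero[OF sq(1) sq(2)[symmetric] sq0 y] squeeze_rot[OF sub(3,4) False] by (simp only: n)
    ultimately have "face_term n p I S (cyc n p x) = pm ?Y (int (crossings S (I - S)) + 1)
        (pm ?Y (int (card I - card S) - 1) (?f (squeeze (rot n S) ` rot n (I - S)) y))"
      unfolding face_term_def by (simp only:)
    also have "\<dots> = pm ?Y (int (card I) - 1) (face_term n p (rot n I) (rot n S) x)"
      unfolding R using y2 crossings_rot_target[OF sub(3,4) False z] sq(3)
      by (simp only: Y.pm_pm) (rule pm_parity, auto simp: of_nat_diff)
    finally show ?thesis .
  qed
qed

text \<open>Every argument has the form $ty$. If $0\notin I$, both sides are the images under \<open>cyc\<close> of the two
  sides for the rotated set at \<open>y\<close>; if $0\in I$, they differ from them by the sign $(-1)^{k-1}$.\<close>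

lemma face_relation_rot:
  assumes I: "valid_index n I" and rel: "face_relation n (rot n I)"
  shows "face_relation n I"
  unfolding face_relation_def
proof (intro allI ballI)
  fix p x assume "x \<in> carrier (T (n + 1) p)"
  then obtain y where y: "y \<in> carrier (T (n + 1) p)" "x = cyc n p y" by (rule M_t_surj)
  let ?k = "card I"
  let ?Y = "T (n - ?k + 1) (p + int ?k - 2)"
  let ?P = "\<lambda>I. {S. S \<subset> I \<and> S \<noteq> {}}"
  interpret Y: module K ?Y by (rule T_module)
  have sub: "I \<subseteq> {..n}" using I by (simp add: valid_index_def)
  have c: "card (rot n I) = ?k" using sub by (rule card_rot)
  have dy: "bd (n + 1) p y \<in> carrier (T (n + 1) (p - 1))" by (rule tensor_diff_closed[OF y(1)])
  have deg: "p - 1 + int ?k - 1 = p + int ?k - 2" by simp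
  define a where "a = bd (n - ?k + 1) (p + int ?k - 1) (set_face n p (rot n I) y)"
  define b where "b = set_face n (p - 1) (rot n I) (bd (n + 1) p y)"
  have fy: "set_face n p (rot n I) y \<in> carrier (T (n - ?k + 1) (p + int ?k - 1))"
    using set_face_closed[OF valid_index_rot[OF I] c[symmetric] y(1)] .
  have a: "a \<in> carrier ?Y" unfolding a_def using tensor_diff_closed[OF fy] by simp
  have b: "b \<in> carrier ?Y" unfolding b_def using set_face_closed[OF valid_index_rot[OF I] c[symmetric] dy] by (simp only: deg)
  have set_face: "face_term n p (rot n I) S y \<in> carrier ?Y" if "S \<in> ?P (rot n I)" for S
    using face_term_closed[OF valid_index_rot[OF I] _ _ y(1)] that c by simp
  have R: "a \<oplus>\<^bsub>?Y\<^esub> b = (\<Oplus>\<^bsub>?Y\<^esub>S\<in>?P (rot n I). face_term n p (rot n I) S y)"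
    unfolding a_def b_def by (rule bspec[OF spec[OF rel[unfolded face_relation_def c], of p] y(1)])
  have reindex: "(\<Oplus>\<^bsub>?Y\<^esub>S\<in>?P (rot n I). g S) = (\<Oplus>\<^bsub>?Y\<^esub>S\<in>?P I. g (rot n S))"
    if "\<And>S. S \<in> ?P (rot n I) \<Longrightarrow> g S \<in> carrier ?Y" for g
  proof -
    have "g \<in> rot n ` ?P I \<rightarrow> carrier ?Y"
      unfolding rot_image_proper_subsets(2)[OF sub] using that by (intro Pi_I)
    then show ?thesis
      using Y.M.finsum_reindex[OF _ rot_image_proper_subsets(1)[OF sub], of g]
      unfolding rot_image_proper_subsets(2)[OF sub] by simp
  qed
  have img: "rot n S \<in> ?P (rot n I)" if "S \<in> ?P I" for S using that rot_proper_subset[OF sub] by blast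
  have dx: "bd (n + 1) p x = cyc n (p - 1) (bd (n + 1) p y)"
    unfolding y(2) by (rule tensor_diff_M_t[OF y(1)])
  show "bd (n - ?k + 1) (p + int ?k - 1) (set_face n p I x) \<oplus>\<^bsub>?Y\<^esub> set_face n (p - 1) I (bd (n + 1) p x)
    = (\<Oplus>\<^bsub>?Y\<^esub>S\<in>?P I. face_term n p I S x)"
  proof (cases "0 \<in> I")
    case False
    let ?t = "cyc (n - ?k) (p + int ?k - 2)"
    have "set_face n p I x = cyc (n - ?k) (p + int ?k - 1) (set_face n p (rot n I) y)"
      unfolding y(2) by (rule set_face_M_t_pos[OF I refl False y(1)])
    then have "bd (n - ?k + 1) (p + int ?k - 1) (set_face n p I x) = ?t a"
      unfolding a_def using tensor_diff_M_t[OF fy] by (simp add: diff_diff_eq)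
    moreover have "set_face n (p - 1) I (bd (n + 1) p x) = ?t b"
      unfolding dx b_def using set_face_M_t_pos[OF I refl False dy] by (simp only: deg)
    moreover have "?t a \<oplus>\<^bsub>?Y\<^esub> ?t b = ?t (a \<oplus>\<^bsub>?Y\<^esub> b)" using lin_mapsD(2)[OF M_t_lin a b] by simp
    moreover have "?t (a \<oplus>\<^bsub>?Y\<^esub> b) = (\<Oplus>\<^bsub>?Y\<^esub>S\<in>?P (rot n I). ?t (face_term n p (rot n I) S y))"
      unfolding R by (rule lin_finsum[OF T_module T_module M_t_lin set_face])
    moreover have "\<dots> = (\<Oplus>\<^bsub>?Y\<^esub>S\<in>?P I. ?t (face_term n p (rot n I) (rot n S) y))"
      using M_t_closed[OF set_face] by (rule reindex)
    moreover have "\<dots> = (\<Oplus>\<^bsub>?Y\<^esub>S\<in>?P I. face_term n p I S x)"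
      unfolding y(2) using face_term_M_t_pos[OF I _ _ False y(1)] M_t_closed[OF set_face[OF img]]
      by (intro Y.M.finsum_cong') auto
    ultimately show ?thesis by simp
  next
    case True
    let ?e = "int ?k - 1"
    have "set_face n p I x = pm (T (n - ?k + 1) (p + int ?k - 1)) ?e (set_face n p (rot n I) y)"
      unfolding y(2) by (rule set_face_M_t_zero[OF I refl True y(1)])
    then have "bd (n - ?k + 1) (p + int ?k - 1) (set_face n p I x) = pm ?Y ?e a"
      unfolding a_def using lin_pm[OF T_module T_module tensor_diff_lin fy] by (simp add: diff_diff_eq)
    moreover have "set_face n (p - 1) I (bd (n + 1) p x) = pm ?Y ?e b"
      unfolding dx b_def using set_face_M_t_zero[OF I refl True dy] by (simp only: deg)
    moreover have "pm ?Y ?e a \<oplus>\<^bsub>?Y\<^esub> pm ?Y ?e b = pm ?Y ?e (a \<oplus>\<^bsub>?Y\<^esub> b)" using Y.pm_add[OF a b] by simp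
    moreover have "pm ?Y ?e (a \<oplus>\<^bsub>?Y\<^esub> b) = (\<Oplus>\<^bsub>?Y\<^esub>S\<in>?P (rot n I). pm ?Y ?e (face_term n p (rot n I) S y))"
      unfolding R by (rule Y.pm_finsum[OF set_face])
    moreover have "\<dots> = (\<Oplus>\<^bsub>?Y\<^esub>S\<in>?P I. pm ?Y ?e (face_term n p (rot n I) (rot n S) y))"
      using Y.pm_closed[OF set_face] by (rule reindex)
    moreover have "\<dots> = (\<Oplus>\<^bsub>?Y\<^esub>S\<in>?P I. face_term n p I S x)"
      unfolding y(2) using face_term_M_t_zero[OF I _ _ True y(1)] Y.pm_closed[OF set_face[OF img]]
      by (intro Y.M.finsum_cong') auto
    ultimately show ?thesis by simp
  qed
qed

end

section \<open>Index sets that are not intervals\<close>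

lemma squeeze_interval:
  assumes "t \<notin> {s..<s + l}" shows "squeeze {s..<s + l} t = (if t < s then t else t - l)"
proof -
  have "{r \<in> {s..<s + l}. r < t} = (if t < s then {} else {s..<s + l})" using assms by auto
  then show ?thesis by (simp add: squeeze_def)
qed

text \<open>Undoing the renumbering: an interval of the shortened circle lies before the removed interval,
  after it, or around it.\<close>

lemma squeeze_image_interval:
  assumes "S = {s..<s + l}" "S \<inter> T = {}" "squeeze S ` T = {i..<i + b}"
  obtains "T = {i..<i + b}" | "T = {i + l..<i + l + b}" | "S \<union> T = {i..<i + (l + b)}"
proof -
  have mem: "t \<in> T \<longleftrightarrow> t < s \<and> i \<le> t \<and> t < i + b \<or> s + l \<le> t \<and> i \<le> t - l \<and> t - l < i + b" for t
  proof (cases "t \<in> S")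
    case True
    then show ?thesis using assms(1,2) by auto
  next
    case False
    have "t \<in> T \<longleftrightarrow> squeeze S t \<in> squeeze S ` T"
    proof
      assume "squeeze S t \<in> squeeze S ` T"
      then obtain t' where t': "t' \<in> T" "squeeze S t = squeeze S t'" by auto
      then have "t' \<notin> S" using assms(2) by auto
      then have "t = t'" using t' False squeeze_less[of t t' S] squeeze_less[of t' t S]
        by (cases t t' rule: linorder_cases) auto
      then show "t \<in> T" using t' by simp
    qed simp
    also have "\<dots> \<longleftrightarrow> i \<le> squeeze S t \<and> squeeze S t < i + b" unfolding assms(3) by simp
    also have "squeeze S t = (if t < s then t else t - l)" using False unfolding assms(1) by (rule squeeze_interval)
    finally show ?thesis using False assms(1) by auto
  qed
  consider "i + b \<le> s" | "s \<le> i" | "i < s" "s < i + b" by linarith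
  then show thesis
  proof cases
    case 1
    have "T = {i..<i + b}"
    proof (rule Set.set_eqI)
      fix t show "t \<in> T \<longleftrightarrow> t \<in> {i..<i + b}" unfolding mem using 1 by auto
    qed
    then show thesis by (rule that(1))
  next
    case 2
    have "T = {i + l..<i + l + b}"
    proof (rule Set.set_eqI)
      fix t show "t \<in> T \<longleftrightarrow> t \<in> {i + l..<i + l + b}" unfolding mem using 2 by auto
    qed
    then show thesis by (rule that(2))
  next
    case 3
    have "S \<union> T = {i..<i + (l + b)}"
    proof (rule Set.set_eqI)
      fix t show "t \<in> S \<union> T \<longleftrightarrow> t \<in> {i..<i + (l + b)}" unfolding Un_iff mem assms(1) using 3 by auto
    qed
    then show thesis by (rule that(3))
  qed
qed

lemma crossings_intervals:
  assumes "i + a \<le> j"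
  shows "crossings {i..<i + a} {j..<j + b} = a * b" "crossings {j..<j + b} {i..<i + a} = 0"
proof -
  have "card {t \<in> {j..<j + b}. s < t} = b" if "s \<in> {i..<i + a}" for s
  proof -
    have "{t \<in> {j..<j + b}. s < t} = {j..<j + b}" using that assms by auto
    then show ?thesis by simp
  qed
  then show "crossings {i..<i + a} {j..<j + b} = a * b" by (simp add: crossings_def)
  have "{t \<in> {i..<i + a}. s < t} = {}" if "s \<in> {j..<j + b}" for s using that assms by auto
  then show "crossings {j..<j + b} {i..<i + a} = 0" unfolding crossings_def by (simp del: Collect_empty_eq)
qed

definition interval :: "nat set \<Rightarrow> bool"
  where "interval I \<longleftrightarrow> (\<exists>j. I = {j..<j + card I})"

lemma intervalI: "I = {j..<j + k} \<Longrightarrow> interval I"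
  unfolding interval_def by (intro exI[of _ j]) simp

context A_infinity_algebra
begin

lemma set_face_not_interval:
  assumes "valid_index n I" "n \<notin> I" "\<not> interval I"
  shows "set_face n p I x = \<zero>\<^bsub>T (n - card I + 1) (p + int (card I) - 1)\<^esub>"
  using assms by (intro set_face_gap gap_not_arc) (auto simp: interval_def)

lemma double_face_lin:
  assumes "valid_index n I" "S \<subset> I" "S \<noteq> {}"
  shows "(\<lambda>x. set_face (n - card S) (p + int (card S) - 1) (squeeze S ` (I - S)) (set_face n p S x))
    \<in> lin_maps K (T (n + 1) p) (T (n - card I + 1) (p + int (card I) - 2))"
proof -
  note sq = valid_index_squeeze[OF assms(1,2)]
  have S: "valid_index n S" using valid_index_subset[OF assms(1)] assms by auto
  have "n - card S - (card I - card S) = n - card I" "p + int (card S) - 1 + int (card I - card S) - 1 = p + int (card I) - 2"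
    using sq(3) by auto
  then show ?thesis
    using lin_comp[OF set_face_lin[OF S refl, of p] set_face_lin[OF sq(1) sq(2)[symmetric], of "p + int (card S) - 1"]] by (simp only:)
qed

lemma face_term_lin:
  assumes "valid_index n I" "S \<subset> I" "S \<noteq> {}"
  shows "face_term n p I S \<in> lin_maps K (T (n + 1) p) (T (n - card I + 1) (p + int (card I) - 2))"
  unfolding face_term_def[abs_def] by (rule lin_pm_map[OF T_module double_face_lin[OF assms]])

text \<open>If \<open>S\<close> or the renumbered complement is not an interval, it is not an arc either, since the last
  gap is missing from both.\<close>

lemma face_term_vanishes:
  assumes I: "valid_index n I" "n \<notin> I" "S \<subset> I" "S \<noteq> {}"
    and "\<not> interval S \<or> \<not> interval (squeeze S ` (I - S))"
  shows "face_term n p I S x = \<zero>\<^bsub>T (n - card I + 1) (p + int (card I) - 2)\<^esub>"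
proof -
  note sq = valid_index_squeeze[OF I(1,3)]
  have S: "valid_index n S" "n \<notin> S" using valid_index_subset[OF I(1)] I by auto
  have n: "n - card S - (card I - card S) = n - card I" "p + int (card S) - 1 + int (card I - card S) - 1 = p + int (card I) - 2"
    using sq(3) by auto
  have "set_face (n - card S) (p + int (card S) - 1) (squeeze S ` (I - S)) (set_face n p S x)
    = \<zero>\<^bsub>T (n - card I + 1) (p + int (card I) - 2)\<^esub>"
  proof (cases "interval S")
    case False
    then have "set_face n p S x = \<zero>\<^bsub>T (n - card S + 1) (p + int (card S) - 1)\<^esub>"
      by (rule set_face_not_interval[OF S])
    then show ?thesis using lin_zero[OF T_module T_module set_face_lin[OF sq(1) sq(2)[symmetric]]] by (simp only: n)
  next
    case True
    have fin: "finite S" using valid_index_finite[OF S(1)] .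
    have sub: "I \<subseteq> {..n}" using I(1) by (simp add: valid_index_def)
    have "n - card S \<notin> squeeze S ` (I - S)"
    proof
      assume "n - card S \<in> squeeze S ` (I - S)"
      then obtain t where t: "t \<in> I - S" "squeeze S t = n - card S" by auto
      have "t < n" using t sub I(2) by (metis DiffD1 atMost_iff le_neq_implies_less subsetD)
      then have "squeeze S t < squeeze S n" using t by (intro squeeze_less) auto
      moreover have "{s \<in> S. s < n} = S" using I(2,3) sub by (auto simp: less_le)
      ultimately show False using t by (simp add: squeeze_def)
    qed
    moreover have "\<not> interval (squeeze S ` (I - S))" using True assms(5) by blast
    ultimately show ?thesis
      using set_face_not_interval[OF sq(1), of "p + int (card S) - 1" "set_face n p S x"] by (simp only: sq(2) n simp_thms)
  qed
  then show ?thesis unfolding face_term_def by (simp only: module.pm_zero[OF T_module])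
qed

text \<open>Contracting two disjoint blocks in either order gives the same word. The Koszul signs differ by
  $(a-1)(b-1)$, the crossings by $ab$, and the factors $(-1)^{k(p-1)}$, whose degree is shifted by the
  contraction that comes first, by $a(b-1)-b(a-1)$. The sum of these is odd.\<close>

lemma two_blocks_cancel:
  assumes "1 \<le> a" "1 \<le> b" "i + a < j" "j + b \<le> n" and x: "x \<in> carrier (T (n + 1) p)"
    and I: "I = {i..<i + a} \<union> {j..<j + b}"
  shows "face_term n p I {i..<i + a} x \<oplus>\<^bsub>T (n - card I + 1) (p + int (card I) - 2)\<^esub> face_term n p I {j..<j + b} x
    = \<zero>\<^bsub>T (n - card I + 1) (p + int (card I) - 2)\<^esub>"
proof -
  let ?S = "{i..<i + a}" and ?T = "{j..<j + b}"
  let ?Y = "T (n - card I + 1) (p + int (card I) - 2)"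
  have k: "card I = a + b" unfolding I using assms by (subst card_Un_disjoint) auto
  have val: "valid_index n I" using assms k unfolding valid_index_def by auto
  have D: "I - ?S = ?T" "I - ?T = ?S" unfolding I using assms by auto
  have "i \<in> ?S" "i \<notin> ?T" "j \<in> ?T" "j \<notin> ?S" using assms by auto
  then have psub: "?S \<subset> I" "?S \<noteq> {}" "?T \<subset> I" "?T \<noteq> {}" unfolding I by blast+
  have sS: "squeeze ?S ` ?T = {j - a..<j - a + b}"
  proof -
    have "squeeze ?S ` ?T = (\<lambda>t. t - a) ` ?T"
      using assms by (intro image_cong refl) (subst squeeze_interval; auto)
    also have "\<dots> = {j - a..<j - a + b}"
    proof (intro equalityI subsetI)
      fix t assume "t \<in> {j - a..<j - a + b}"
      then show "t \<in> (\<lambda>t. t - a) ` ?T" using assms by (intro image_eqI[of _ _ "t + a"]) auto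
    qed (use assms in auto)
    finally show ?thesis .
  qed
  have sT: "squeeze ?T ` ?S = ?S"
  proof -
    have "squeeze ?T ` ?S = (\<lambda>t. t) ` ?S" using assms by (intro image_cong refl) (subst squeeze_interval; auto)
    then show ?thesis by simp
  qed
  have fS: "face_term n p I ?S x = pm ?Y (int (a * b) + 1)
      (block (n - a) (p + int a - 1) b (j - a) (block n p a i x))" for x
    using set_face_block[of b "j - a" "n - a" "p + int a - 1"] set_face_block[of a i n p] assms crossings_intervals(1)[of i a j b]
    unfolding face_term_def D sS by simp
  have fT: "face_term n p I ?T x = pm ?Y 1 (block (n - b) (p + int b - 1) a i (block n p b j x))" for x
    using set_face_block[of a i "n - b" "p + int b - 1"] set_face_block[of b j n p] assms crossings_intervals(2)[of i a j b]
    unfolding face_term_def D sT by simp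
  show ?thesis
  proof (rule tensor_ext_sp[OF T_module
        lin_add_map[OF T_module face_term_lin[OF val psub(1,2)] face_term_lin[OF val psub(3,4)]]
        lin_zero_map[OF T_module] _ x])
    fix w assume w: "letters w" "length w = n + 1" "word_deg w = p"
    have "length w = i + (a + 1) + (n - a - i)" using w assms by simp
    then obtain u y w' where w1: "w = u @ y @ w'" "length u = i" "length y = a + 1" "length w' = n - a - i"
      by (rule word_split3)
    have "length w' = (j - i - a - 1) + (b + 1) + (n - b - j)" using w1 assms by simp
    then obtain v z v' where w2: "w' = v @ z @ v'" "length v = j - i - a - 1" "length z = b + 1" "length v' = n - b - j"
      by (rule word_split3)
    have l: "letters u" "letters y" "letters v" "letters z" "letters v'"
      "word_deg u + word_deg y + word_deg v + word_deg z + word_deg v' = p" using w w1(1) w2(1) by auto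
    note len = w1(2,3) w2(2,3,4)
    have op_letter: "snd (op_letter y) \<in> carrier (A (fst (op_letter y)))" "snd (op_letter z) \<in> carrier (A (fst (op_letter z)))"
      using op_letter_closed[of y] op_letter_closed[of z] l len assms by auto
    have S1: "block n p a i (sp 0 w) = sp (0 + int a * (p - 1) + (int a - 1) * word_deg u) (u @ op_letter y # v @ z @ v')"
      unfolding w1(1) w2(1) by (rule M_block_sp) (use l len assms in auto)
    have S2: "block (n - a) (p + int a - 1) b (j - a) (sp c ((u @ op_letter y # v) @ z @ v'))
      = sp (c + int b * (p + int a - 1 - 1) + (int b - 1) * word_deg (u @ op_letter y # v)) ((u @ op_letter y # v) @ op_letter z # v')" for c
      by (rule M_block_sp) (use l len assms op_letter in auto)
    have T1: "block n p b j (sp 0 ((u @ y @ v) @ z @ v'))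
      = sp (0 + int b * (p - 1) + (int b - 1) * word_deg (u @ y @ v)) ((u @ y @ v) @ op_letter z # v')"
      by (rule M_block_sp) (use l len assms in auto)
    have T2: "block (n - b) (p + int b - 1) a i (sp c (u @ y @ v @ op_letter z # v'))
      = sp (c + int a * (p + int b - 1 - 1) + (int a - 1) * word_deg u) (u @ op_letter y # v @ op_letter z # v')" for c
      by (rule M_block_sp) (use l len assms op_letter in auto)
    have E: "letters (u @ op_letter y # v @ op_letter z # v')" "length (u @ op_letter y # v @ op_letter z # v') = n - card I + 1"
      "word_deg (u @ op_letter y # v @ op_letter z # v') = p + int (card I) - 2"
      using l len assms op_letter unfolding k by auto
    have fa: "face_term n p I ?S (sp 0 w) = sp (int (a * b) + 1 + (int a * (p - 1) + (int a - 1) * word_deg u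
        + int b * (p + int a - 1 - 1) + (int b - 1) * word_deg (u @ op_letter y # v))) (u @ op_letter y # v @ op_letter z # v')"
      unfolding fS S1 S2[unfolded append_assoc append_Cons] pm_sp[OF E] by (simp only: add_ac add_0_left)
    have fb: "face_term n p I ?T (sp 0 w) = sp (1 + (int b * (p - 1) + (int b - 1) * word_deg (u @ y @ v)
        + int a * (p + int b - 1 - 1) + (int a - 1) * word_deg u)) (u @ op_letter y # v @ op_letter z # v')"
      unfolding fT w1(1) w2(1) T1[unfolded append_assoc append_Cons] T2 pm_sp[OF E] by (simp only: add_ac add_0_left)
    have opposite: "odd (int (a * b) + 1 + (int a * (p - 1) + (int a - 1) * word_deg u
        + int b * (p + int a - 1 - 1) + (int b - 1) * word_deg (u @ op_letter y # v))
      + (1 + (int b * (p - 1) + (int b - 1) * word_deg (u @ y @ v)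
        + int a * (p + int b - 1 - 1) + (int a - 1) * word_deg u)))"
      using len by auto
    show "face_term n p I ?S (sp 0 w) \<oplus>\<^bsub>?Y\<^esub> face_term n p I ?T (sp 0 w) = \<zero>\<^bsub>?Y\<^esub>"
      unfolding fa fb by (rule sp_cancel[OF opposite E])
  qed
qed

text \<open>The subsets that contain the minimum represent the pairs \<open>S\<close>, \<open>I - S\<close>, and the two terms of
  each pair cancel.\<close>

lemma face_relation_gap:
  assumes I: "valid_index n I" "n \<notin> I" "\<not> interval I"
  shows "face_relation n I"
  unfolding face_relation_def
proof (intro allI ballI)
  fix p x assume x: "x \<in> carrier (T (n + 1) p)"
  let ?k = "card I"
  let ?Y = "T (n - ?k + 1) (p + int ?k - 2)"
  let ?P = "{S. S \<subset> I \<and> S \<noteq> {}}" and ?P1 = "{S. S \<subset> I \<and> Min I \<in> S}"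
  interpret Y: module K ?Y by (rule T_module)
  have fin: "finite I" using valid_index_finite[OF I(1)] .
  have ne: "I \<noteq> {}" using I(1) by (simp add: valid_index_def)
  have min: "Min I \<in> I" "\<And>i. i \<in> I \<Longrightarrow> Min I \<le> i" using fin ne by auto
  have c: "face_term n p I S x \<in> carrier ?Y" if "S \<subset> I" "S \<noteq> {}" for S
    by (rule face_term_closed[OF I(1) that x])
  have P: "?P = ?P1 \<union> (\<lambda>S. I - S) ` ?P1"
  proof (intro equalityI subsetI)
    fix S assume S: "S \<in> ?P"
    show "S \<in> ?P1 \<union> (\<lambda>S. I - S) ` ?P1"
    proof (cases "Min I \<in> S")
      case False
      then have "I - S \<in> ?P1" "S = I - (I - S)" using S min(1) by auto
      then show ?thesis by blast
    qed (use S in auto)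
  qed (use min(1) in auto)
  have cancel: "face_term n p I S x \<oplus>\<^bsub>?Y\<^esub> face_term n p I (I - S) x = \<zero>\<^bsub>?Y\<^esub>" if S: "S \<subset> I" "Min I \<in> S" for S
  proof (cases "interval S \<and> interval (I - S)")
    case True
    then obtain i j where S': "S = {i..<i + card S}" and T': "I - S = {j..<j + card (I - S)}"
      unfolding interval_def by blast
    define a b where "a = card S" and "b = card (I - S)"
    note S' = S'[folded a_def] and T' = T'[folded b_def]
    have T: "I - S \<noteq> {}" using S(1) by auto
    have a: "1 \<le> a" using S(2) S' by (cases a) auto
    have b: "1 \<le> b" using T T' by (cases b) auto
    have iS: "i \<in> S" using S' a by (metis atLeastLessThan_iff le_refl less_add_same_cancel1 less_le_trans zero_less_one)
    have jT: "j \<in> I - S" using T' b by (metis atLeastLessThan_iff le_refl less_add_same_cancel1 less_le_trans zero_less_one)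
    have mi: "Min I = i" using min(2)[of i] iS S S' by (metis atLeastLessThan_iff le_antisym psubsetD)
    have "i \<le> j" using min(2)[of j] jT mi by simp
    moreover have "j \<notin> S" using jT by simp
    then have "\<not> (i \<le> j \<and> j < i + a)" unfolding S' by simp
    ultimately have ij: "i + a \<le> j" by simp
    have IU: "I = {i..<i + a} \<union> {j..<j + b}" using S' T' S(1) by (metis Un_Diff_cancel psubset_imp_subset subset_Un_eq)
    have "i + a \<noteq> j"
    proof
      assume "i + a = j"
      then have "I = {i..<i + (a + b)}" unfolding IU by auto
      then show False using I(3) intervalI by blast
    qed
    then have ij: "i + a < j" using ij by simp
    have "j + b - 1 \<in> I" unfolding IU using b by auto
    then have "j + b - 1 \<le> n" "j + b - 1 \<noteq> n" using I(1,2) by (auto simp: valid_index_def)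
    then have "j + b \<le> n" using b by arith
    from two_blocks_cancel[OF a b ij this x IU] show ?thesis using S' T' by simp
  next
    case False
    have gen: "face_term n p I U x = \<zero>\<^bsub>?Y\<^esub>" if U: "U \<subset> I" "U \<noteq> {}" "\<not> (interval U \<and> interval (I - U))" for U
    proof (rule face_term_vanishes[OF I(1,2) U(1,2)], rule ccontr)
      assume "\<not> (\<not> interval U \<or> \<not> interval (squeeze U ` (I - U)))"
      then obtain s i where s: "U = {s..<s + card U}" and i: "squeeze U ` (I - U) = {i..<i + card (squeeze U ` (I - U))}"
        unfolding interval_def by blast
      show False
      proof (rule squeeze_image_interval[OF s Diff_disjoint i])
        assume "U \<union> (I - U) = {i..<i + (card U + card (squeeze U ` (I - U)))}"
        moreover have "U \<union> (I - U) = I" using U(1) by auto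
        ultimately show False using I(3) intervalI by metis
      qed (use U(3) intervalI[OF s] intervalI in metis)+
    qed
    have "I - (I - S) = S" using S by auto
    then have "face_term n p I (I - S) x = \<zero>\<^bsub>?Y\<^esub>" using S False by (intro gen) auto
    moreover have "face_term n p I S x = \<zero>\<^bsub>?Y\<^esub>" using S False by (intro gen) auto
    ultimately show ?thesis by (simp only: Y.M.l_zero[OF Y.M.zero_closed])
  qed
  have "(\<Oplus>\<^bsub>?Y\<^esub>S\<in>?P. face_term n p I S x)
      = (\<Oplus>\<^bsub>?Y\<^esub>S\<in>?P1. face_term n p I S x) \<oplus>\<^bsub>?Y\<^esub> (\<Oplus>\<^bsub>?Y\<^esub>S\<in>(\<lambda>S. I - S) ` ?P1. face_term n p I S x)"
    unfolding P
  proof (rule Y.M.finsum_Un_disjoint)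
    show "finite ?P1" using fin by (intro finite_subset[of ?P1 "Pow I"]) auto
    then show "finite ((\<lambda>S. I - S) ` ?P1)" by simp
  qed (use c min(1) in auto)
  also have "(\<Oplus>\<^bsub>?Y\<^esub>S\<in>(\<lambda>S. I - S) ` ?P1. face_term n p I S x) = (\<Oplus>\<^bsub>?Y\<^esub>S\<in>?P1. face_term n p I (I - S) x)"
  proof (rule Y.M.finsum_reindex)
    show "inj_on (\<lambda>S. I - S) ?P1" by (auto simp: inj_on_def)
  qed (use c min(1) in auto)
  also have "(\<Oplus>\<^bsub>?Y\<^esub>S\<in>?P1. face_term n p I S x) \<oplus>\<^bsub>?Y\<^esub> (\<Oplus>\<^bsub>?Y\<^esub>S\<in>?P1. face_term n p I (I - S) x)
      = (\<Oplus>\<^bsub>?Y\<^esub>S\<in>?P1. face_term n p I S x \<oplus>\<^bsub>?Y\<^esub> face_term n p I (I - S) x)"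
    using c min(1) by (intro Y.M.finsum_addf[symmetric]) auto
  also have "\<dots> = \<zero>\<^bsub>?Y\<^esub>"
    by (rule Y.M.add.finprod_one_eqI) (simp only: mem_Collect_eq cancel monoid.simps)
  finally have R: "(\<Oplus>\<^bsub>?Y\<^esub>S\<in>?P. face_term n p I S x) = \<zero>\<^bsub>?Y\<^esub>" .
  have f: "set_face n q I z = \<zero>\<^bsub>T (n - ?k + 1) (q + int ?k - 1)\<^esub>" for q z by (rule set_face_not_interval[OF I])
  have "bd (n - ?k + 1) (p + int ?k - 1) (set_face n p I x) = \<zero>\<^bsub>?Y\<^esub>"
    unfolding f using lin_zero[OF T_module T_module tensor_diff_lin[of "n - ?k + 1" "p + int ?k - 1"]] by (simp add: diff_diff_eq)
  moreover have "set_face n (p - 1) I (bd (n + 1) p x) = \<zero>\<^bsub>?Y\<^esub>"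
    unfolding f by (simp add: algebra_simps)
  ultimately show "bd (n - ?k + 1) (p + int ?k - 1) (set_face n p I x) \<oplus>\<^bsub>?Y\<^esub> set_face n (p - 1) I (bd (n + 1) p x)
    = (\<Oplus>\<^bsub>?Y\<^esub>S\<in>?P. face_term n p I S x)"
    unfolding R by (simp only: Y.M.l_zero[OF Y.M.zero_closed])
qed

end

section \<open>Initial intervals\<close>

context A_infinity_algebra
begin

lemma sp_pi:
  assumes "letters y" "length y = k + 1" "1 \<le> k" "letters v" "word_deg y = q"
  shows "sp c ((q + int k - 1, \<pi> (k - 1) q (sp e y)) # v) = sp (c + e) (op_letter y # v)"
proof -
  have op_letter: "op_letter y = (q + int k - 1, \<pi> (k - 1) q (ptens K A y))"
    using assms by (simp add: op_letter_def)
  have pt: "ptens K A y \<in> carrier (T (k + 1) q)" using assms by (intro ptens_closed) (simp add: tensor_words_iff)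
  have pl: "\<pi> (k - 1) q \<in> lin_maps K (T (k + 1) q) (A (q + int k - 1))"
    using pi_lin_arity[OF assms(3), of q] by (simp only: add_diff_eq)
  have "\<pi> (k - 1) q (sp e y) = pm (A (q + int k - 1)) e (\<pi> (k - 1) q (ptens K A y))"
    using lin_pm[OF T_module graded_module pl pt, of e] assms by (simp only: pm_ptens)
  moreover have "sp c ([] @ (q + int k - 1, pm (A (q + int k - 1)) e (\<pi> (k - 1) q (ptens K A y))) # v)
    = pm (T (length v + 1) (q + int k - 1 + word_deg v)) e (sp c ([] @ (q + int k - 1, \<pi> (k - 1) q (ptens K A y)) # v))"
    using assms(4) by (intro lin_pm[OF graded_module T_module sp_slot lin_mapsD(1)[OF pl pt]]) auto
  moreover have "pm (T (length v + 1) (q + int k - 1 + word_deg v)) e (sp c (op_letter y # v)) = sp (e + c) (op_letter y # v)"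
    using assms op_letter_closed[of y] by (intro pm_sp) auto
  ultimately show ?thesis by (simp add: op_letter add.commute)
qed

text \<open>The boundary of the face that contracts an initial block: the differential of the letters
  outside the block cancels, and what remains is the boundary of the operation itself.\<close>

lemma boundary_initial_face:
  assumes k: "1 \<le> k" "k \<le> n" and l: "letters y" "letters v" "length y = k + 1" "length v = n - k"
    and p: "word_deg y + word_deg v = p"
  shows "bd (n - k + 1) (p + int k - 1) (set_face n p {..<k} (sp 0 (y @ v)))
      \<oplus>\<^bsub>T (n - k + 1) (p + int k - 2)\<^esub> set_face n (p - 1) {..<k} (bd (n + 1) p (sp 0 (y @ v)))
    = sp (int k * (p - 1)) ((word_deg y + int k - 2,
        d (word_deg y + int k - 1) (\<pi> (k - 1) (word_deg y) (sp 0 y))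
        \<oplus>\<^bsub>A (word_deg y + int k - 2)\<^esub> pm (A (word_deg y + int k - 2)) (int k)
            (\<pi> (k - 1) (word_deg y - 1) (bd (k + 1) (word_deg y) (sp 0 y)))) # v)"
proof -
  let ?Y = "T (n - k + 1) (p + int k - 2)"
  let ?q = "word_deg y" and ?c = "int k * (p - 1)"
  interpret Y: module K ?Y by (rule T_module)
  interpret Aq: module K "A (?q + int k - 2)" by (rule graded_module)
  have len: "length (y @ v) = n + 1" using k l by simp
  have blk: "set_face n p' {..<k} x = block n p' k 0 x" for p' x
    using set_face_block[of k 0 n p' x] k by (simp add: atLeast0LessThan)
  have op_letter: "snd (op_letter y) \<in> carrier (A (fst (op_letter y)))" using op_letter_closed[of y] l k by simp
  have bc: "letters (op_letter y # v)" "length (op_letter y # v) = n - k + 1" "word_deg (op_letter y # v) = p + int k - 1"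
    using op_letter l p by auto
  \<comment> \<open>the insertion of a value of the operation or of its boundary in front of \<open>v\<close>\<close>
  define L where "L a = sp ?c ((?q + int k - 2, a) # v)" for a
  have L: "L \<in> lin_maps K (A (?q + int k - 2)) ?Y"
    unfolding L_def[abs_def] using sp_slot[of "[]" v "n - k + 1" "?q + int k - 2" "p + int k - 2" ?c] l p by simp
  let ?B = "\<lambda>i. sp (?c + (?q + int k - 1) + word_deg (take i v)) (op_letter y # v[i := diff_letter (v ! i)])"
  let ?C = "\<lambda>i. sp (word_deg (take i y) + int k * (p - 2)) (op_letter (y[i := diff_letter (y ! i)]) # v)"
  let ?E = "\<lambda>i. sp (?q + word_deg (take i v) + int k * (p - 2)) (op_letter y # v[i := diff_letter (v ! i)])"
  have Bw: "letters (op_letter y # v[i := diff_letter (v ! i)])" "length (op_letter y # v[i := diff_letter (v ! i)]) = n - k + 1"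
    "word_deg (op_letter y # v[i := diff_letter (v ! i)]) = p + int k - 2" if "i < n - k" for i
    using that op_letter l p by (auto simp: letters_update letters_nth word_deg_update)
  have yi: "letters (y[i := diff_letter (y ! i)])" "length (y[i := diff_letter (y ! i)]) = k + 1" "word_deg (y[i := diff_letter (y ! i)]) = ?q - 1" if "i < k + 1" for i
    using that l by (auto simp: letters_update letters_nth word_deg_update)
  have Cc: "?C i \<in> carrier ?Y" if "i < k + 1" for i
    using op_letter_closed[OF yi(1)[OF that]] yi(2,3)[OF that] l p k by (intro sp_closed) auto
  have "set_face n p {..<k} (sp 0 (y @ v)) = sp ?c (op_letter y # v)"
    unfolding blk using M_block_sp[of "[]" y v 0 k n p 0] k l p by simp
  then have "bd (n - k + 1) (p + int k - 1) (set_face n p {..<k} (sp 0 (y @ v)))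
      = (\<Oplus>\<^bsub>?Y\<^esub>i\<in>{..<Suc (n - k)}. sp (?c + word_deg (take i (op_letter y # v))) ((op_letter y # v)[i := diff_letter ((op_letter y # v) ! i)]))"
    using tensor_diff_sp[OF bc] by (simp add: diff_diff_eq)
  also have "\<dots> = sp ?c (diff_letter (op_letter y) # v) \<oplus>\<^bsub>?Y\<^esub> (\<Oplus>\<^bsub>?Y\<^esub>i\<in>{..<n - k}. ?B i)"
  proof (subst Y.M.finsum_lessThan_Suc_shift)
    fix i assume "i < Suc (n - k)"
    then show "sp (?c + word_deg (take i (op_letter y # v))) ((op_letter y # v)[i := diff_letter ((op_letter y # v) ! i)]) \<in> carrier ?Y"
      using diff_word_term[OF bc, of i] by (simp add: diff_diff_eq)
  qed (use l in \<open>simp add: algebra_simps\<close>)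
  also have "sp ?c (diff_letter (op_letter y) # v) = L (d (?q + int k - 1) (\<pi> (k - 1) ?q (sp 0 y)))"
    unfolding L_def using l k by (simp add: diff_letter_def op_letter_def ptens_sp add_diff_eq)
  finally have LHS1: "bd (n - k + 1) (p + int k - 1) (set_face n p {..<k} (sp 0 (y @ v)))
      = L (d (?q + int k - 1) (\<pi> (k - 1) ?q (sp 0 y))) \<oplus>\<^bsub>?Y\<^esub> (\<Oplus>\<^bsub>?Y\<^esub>i\<in>{..<n - k}. ?B i)" .

  let ?w = "\<lambda>i. sp (word_deg (take i (y @ v))) ((y @ v)[i := diff_letter ((y @ v) ! i)])"
  have lyv: "letters (y @ v)" "length (y @ v) = n + 1" "word_deg (y @ v) = p" using l p len by auto
  have wc: "?w i \<in> carrier (T (n + 1) (p - 1))" if "i < n + 1" for i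
    using diff_word_term[OF lyv that] by simp
  have Yeq: "p - 1 + int k - 1 = p + int k - 2" by simp
  have Mlin: "block n (p - 1) k 0 \<in> lin_maps K (T (n + 1) (p - 1)) ?Y"
    using M_block_lin[of k 0 n "p - 1"] k by (simp only: Yeq)
  have "set_face n (p - 1) {..<k} (bd (n + 1) p (sp 0 (y @ v)))
      = block n (p - 1) k 0 (\<Oplus>\<^bsub>T (n + 1) (p - 1)\<^esub>i\<in>{..<n + 1}. ?w i)"
    unfolding blk tensor_diff_sp[OF lyv] by simp
  also have "\<dots> = (\<Oplus>\<^bsub>?Y\<^esub>i\<in>{..<n + 1}. block n (p - 1) k 0 (?w i))"
    by (rule lin_finsum[OF T_module T_module Mlin]) (use wc in auto)
  also have "\<dots> = (\<Oplus>\<^bsub>?Y\<^esub>i\<in>{..<k + 1}. block n (p - 1) k 0 (?w i))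
        \<oplus>\<^bsub>?Y\<^esub> (\<Oplus>\<^bsub>?Y\<^esub>i\<in>{..<n - k}. block n (p - 1) k 0 (?w (k + 1 + i)))"
  proof -
    have "{..<n + 1} = {..<(k + 1) + (n - k)}" using k by simp
    then show ?thesis
      by (simp only:) (rule Y.M.finsum_lessThan_add, use lin_mapsD(1)[OF Mlin wc] k in auto)
  qed
  also have "(\<Oplus>\<^bsub>?Y\<^esub>i\<in>{..<k + 1}. block n (p - 1) k 0 (?w i)) = (\<Oplus>\<^bsub>?Y\<^esub>i\<in>{..<k + 1}. ?C i)"
  proof (rule Y.M.finsum_cong')
    fix i assume "i \<in> {..<k + 1}"
    then have i: "i < k + 1" by simp
    have "?w i = sp (word_deg (take i y)) ([] @ y[i := diff_letter (y ! i)] @ v)"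
      using i l by (simp add: nth_append list_update_append)
    moreover have "block n (p - 1) k 0 (sp (word_deg (take i y)) ([] @ y[i := diff_letter (y ! i)] @ v))
        = sp (word_deg (take i y) + int k * (p - 1 - 1) + (int k - 1) * word_deg ([] :: (int \<times> 'a) list)) ([] @ op_letter (y[i := diff_letter (y ! i)]) # v)"
      using yi[OF i] l k p by (intro M_block_sp) auto
    ultimately show "block n (p - 1) k 0 (?w i) = ?C i" by simp
  qed (use Cc in auto)
  also have "(\<Oplus>\<^bsub>?Y\<^esub>i\<in>{..<n - k}. block n (p - 1) k 0 (?w (k + 1 + i))) = (\<Oplus>\<^bsub>?Y\<^esub>i\<in>{..<n - k}. ?E i)"
  proof (rule Y.M.finsum_cong')
    fix i assume "i \<in> {..<n - k}"
    then have i: "i < n - k" by simp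
    have "?w (k + 1 + i) = sp (?q + word_deg (take i v)) ([] @ y @ v[i := diff_letter (v ! i)])"
      using i l by (simp add: nth_append list_update_append)
    moreover have "block n (p - 1) k 0 (sp (?q + word_deg (take i v)) ([] @ y @ v[i := diff_letter (v ! i)]))
        = sp (?q + word_deg (take i v) + int k * (p - 1 - 1) + (int k - 1) * word_deg ([] :: (int \<times> 'a) list)) ([] @ op_letter y # v[i := diff_letter (v ! i)])"
      using i l k p by (intro M_block_sp) (auto simp: letters_update letters_nth word_deg_update)
    ultimately show "block n (p - 1) k 0 (?w (k + 1 + i)) = ?E i" by simp
  qed (use sp_closed[OF Bw] in auto)
  finally have LHS2: "set_face n (p - 1) {..<k} (bd (n + 1) p (sp 0 (y @ v)))
      = (\<Oplus>\<^bsub>?Y\<^esub>i\<in>{..<k + 1}. ?C i) \<oplus>\<^bsub>?Y\<^esub> (\<Oplus>\<^bsub>?Y\<^esub>i\<in>{..<n - k}. ?E i)" .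

  \<comment> \<open>a letter of \<open>v\<close> is differentiated before or after the operation, with opposite signs\<close>
  have BE: "(\<Oplus>\<^bsub>?Y\<^esub>i\<in>{..<n - k}. ?B i) \<oplus>\<^bsub>?Y\<^esub> (\<Oplus>\<^bsub>?Y\<^esub>i\<in>{..<n - k}. ?E i) = \<zero>\<^bsub>?Y\<^esub>"
  proof -
    have "(\<Oplus>\<^bsub>?Y\<^esub>i\<in>{..<n - k}. ?B i) \<oplus>\<^bsub>?Y\<^esub> (\<Oplus>\<^bsub>?Y\<^esub>i\<in>{..<n - k}. ?E i) = (\<Oplus>\<^bsub>?Y\<^esub>i\<in>{..<n - k}. ?B i \<oplus>\<^bsub>?Y\<^esub> ?E i)"
      using sp_closed[OF Bw] by (intro Y.M.finsum_addf[symmetric]) auto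
    also have "\<dots> = \<zero>\<^bsub>?Y\<^esub>"
    proof (rule Y.M.add.finprod_one_eqI)
      fix i assume "i \<in> {..<n - k}"
      then show "?B i \<oplus>\<^bsub>?Y\<^esub> ?E i = \<zero>\<^bsub>?Y\<^esub>" using Bw[of i] by (intro sp_cancel) auto
    qed
    finally show ?thesis .
  qed

  \<comment> \<open>the terms in which a letter of \<open>y\<close> is differentiated are the operation on the boundary of \<open>y\<close>\<close>
  define G where "G z = L (pm (A (?q + int k - 2)) (int k) (\<pi> (k - 1) (?q - 1) z))" for z
  have qk: "?q - 1 + (int k - 1) = ?q + int k - 2" by simp
  have pl: "\<pi> (k - 1) (?q - 1) \<in> lin_maps K (T (k + 1) (?q - 1)) (A (?q + int k - 2))"
    using pi_lin_arity[OF k(1), of "?q - 1"] by (simp only: qk)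
  have G: "G \<in> lin_maps K (T (k + 1) (?q - 1)) ?Y"
    unfolding G_def[abs_def] by (rule lin_comp[OF lin_pm_map[OF graded_module pl] L])
  have Dy: "bd (k + 1) ?q (sp 0 y) \<in> carrier (T (k + 1) (?q - 1))"
    using l by (intro tensor_diff_closed sp_closed) auto
  have Gsp: "G (sp e y') = sp (e + int k * (p - 2)) (op_letter y' # v)"
    if "letters y'" "length y' = k + 1" "word_deg y' = ?q - 1" for e y'
  proof -
    have c: "\<pi> (k - 1) (?q - 1) (sp e y') \<in> carrier (A (?q + int k - 2))"
      using lin_mapsD(1)[OF pl sp_closed] that by simp
    have "?q - 1 + int k - 1 = ?q + int k - 2" by simp
    then have "L (\<pi> (k - 1) (?q - 1) (sp e y')) = sp (?c + e) (op_letter y' # v)"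
      unfolding L_def using sp_pi[OF that(1,2) k(1) l(2) that(3), of ?c e] by (simp only:)
    moreover have "G (sp e y') = pm ?Y (int k) (L (\<pi> (k - 1) (?q - 1) (sp e y')))"
      unfolding G_def by (rule lin_pm[OF graded_module T_module L c])
    moreover have "pm ?Y (int k) (sp (?c + e) (op_letter y' # v)) = sp (int k + (?c + e)) (op_letter y' # v)"
      using that l k p op_letter_closed[of y'] by (intro pm_sp) auto
    moreover have "\<dots> = sp (e + int k * (p - 2)) (op_letter y' # v)" by (rule sp_parity) auto
    ultimately show ?thesis by simp
  qed
  have C: "(\<Oplus>\<^bsub>?Y\<^esub>i\<in>{..<k + 1}. ?C i) = G (bd (k + 1) ?q (sp 0 y))"
  proof -
    have "G (bd (k + 1) ?q (sp 0 y)) = G (\<Oplus>\<^bsub>T (k + 1) (?q - 1)\<^esub>i\<in>{..<k + 1}. sp (word_deg (take i y)) (y[i := diff_letter (y ! i)]))"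
      using tensor_diff_sp[OF l(1,3) refl, of 0] by simp
    also have "\<dots> = (\<Oplus>\<^bsub>?Y\<^esub>i\<in>{..<k + 1}. G (sp (word_deg (take i y)) (y[i := diff_letter (y ! i)])))"
      by (rule lin_finsum[OF T_module T_module G]) (use sp_closed[OF yi] in auto)
    also have "\<dots> = (\<Oplus>\<^bsub>?Y\<^esub>i\<in>{..<k + 1}. ?C i)"
      using Gsp[OF yi] Cc by (intro Y.M.finsum_cong') auto
    finally show ?thesis by simp
  qed

  let ?a = "d (?q + int k - 1) (\<pi> (k - 1) ?q (sp 0 y))"
  let ?b = "pm (A (?q + int k - 2)) (int k) (\<pi> (k - 1) (?q - 1) (bd (k + 1) ?q (sp 0 y)))"
  have "\<pi> (k - 1) ?q (sp 0 y) \<in> carrier (A (?q + (int k - 1)))"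
    using l by (intro lin_mapsD(1)[OF pi_lin_arity[OF k(1)] sp_closed]) auto
  moreover have "?q + (int k - 1) = ?q + int k - 1" "?q + int k - 1 - 1 = ?q + int k - 2" by simp_all
  ultimately have a: "?a \<in> carrier (A (?q + int k - 2))"
    using lin_mapsD(1)[OF diff_lin[of "?q + int k - 1"]] by (simp only:)
  have b: "?b \<in> carrier (A (?q + int k - 2))" using lin_mapsD(1)[OF pl Dy] by simp
  have "bd (n - k + 1) (p + int k - 1) (set_face n p {..<k} (sp 0 (y @ v)))
      \<oplus>\<^bsub>?Y\<^esub> set_face n (p - 1) {..<k} (bd (n + 1) p (sp 0 (y @ v)))
    = (L ?a \<oplus>\<^bsub>?Y\<^esub> (\<Oplus>\<^bsub>?Y\<^esub>i\<in>{..<n - k}. ?B i)) \<oplus>\<^bsub>?Y\<^esub> (L ?b \<oplus>\<^bsub>?Y\<^esub> (\<Oplus>\<^bsub>?Y\<^esub>i\<in>{..<n - k}. ?E i))"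
    unfolding LHS1 LHS2 C G_def ..
  also have "\<dots> = (L ?a \<oplus>\<^bsub>?Y\<^esub> L ?b) \<oplus>\<^bsub>?Y\<^esub> ((\<Oplus>\<^bsub>?Y\<^esub>i\<in>{..<n - k}. ?B i) \<oplus>\<^bsub>?Y\<^esub> (\<Oplus>\<^bsub>?Y\<^esub>i\<in>{..<n - k}. ?E i))"
  proof -
    have "(\<Oplus>\<^bsub>?Y\<^esub>i\<in>{..<n - k}. ?B i) \<in> carrier ?Y"
      by (rule Y.M.finsum_closed) (use sp_closed[OF Bw] in auto)
    moreover have "(\<Oplus>\<^bsub>?Y\<^esub>i\<in>{..<n - k}. ?E i) \<in> carrier ?Y"
      by (rule Y.M.finsum_closed) (use sp_closed[OF Bw] in auto)
    ultimately show ?thesis using lin_mapsD(1)[OF L a] lin_mapsD(1)[OF L b] by (simp only: Y.M.a_ac Y.M.a_closed)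
  qed
  also have "\<dots> = L ?a \<oplus>\<^bsub>?Y\<^esub> L ?b"
    unfolding BE using lin_mapsD(1)[OF L a] lin_mapsD(1)[OF L b] by (simp only: Y.M.r_zero Y.M.a_closed)
  also have "\<dots> = L (?a \<oplus>\<^bsub>A (?q + int k - 2)\<^esub> ?b)" by (rule lin_mapsD(2)[OF L a b, symmetric])
  finally show ?thesis unfolding L_def .
qed

text \<open>The gaps that remain after the contraction of a subinterval form again an initial interval. So
  both faces contract blocks, the second block contains the result of the first, and the letters
  \<open>v\<close> are not affected.\<close>

lemma face_term_initial:
  assumes "1 \<le> l" "1 \<le> m" "j \<le> m" "l + m \<le> n"
    and w: "letters (u @ z @ v' @ v)" "length u = j" "length z = l + 1" "length v' = m - j" "length v = n - l - m"
    and p: "word_deg u + word_deg z + word_deg v' + word_deg v = p"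
  shows "face_term n p {..<l + m} {j..<j + l} (sp 0 (u @ z @ v' @ v))
    = sp (int (l * (m - j)) + 1 + (int l * (p - 1) + (int l - 1) * word_deg u + int m * (p + int l - 2)))
        (op_letter (u @ op_letter z # v') # v)"
proof -
  let ?S = "{j..<j + l}"
  have D: "{..<l + m} - ?S = {0..<0 + j} \<union> {j + l..<j + l + (m - j)}" using assms by auto
  have sq: "squeeze ?S ` ({..<l + m} - ?S) = {0..<0 + m}"
  proof (rule Set.set_eqI)
    fix i
    show "i \<in> squeeze ?S ` ({..<l + m} - ?S) \<longleftrightarrow> i \<in> {0..<0 + m}"
    proof
      assume "i \<in> squeeze ?S ` ({..<l + m} - ?S)"
      then obtain t where "t \<in> {..<l + m} - ?S" "i = squeeze ?S t" by auto
      then show "i \<in> {0..<0 + m}" using assms(3) squeeze_interval[of t j l] by auto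
    next
      assume i: "i \<in> {0..<0 + m}"
      show "i \<in> squeeze ?S ` ({..<l + m} - ?S)"
      proof (cases "i < j")
        case True
        then show ?thesis using i squeeze_interval[of i j l] by (intro image_eqI[of _ _ i]) auto
      next
        case False
        then show ?thesis using i squeeze_interval[of "i + l" j l] by (intro image_eqI[of _ _ "i + l"]) auto
      qed
    qed
  qed
  have cr: "crossings ?S ({..<l + m} - ?S) = l * (m - j)"
  proof -
    have "crossings ?S ({..<l + m} - ?S) = crossings ?S {j + l..<j + l + (m - j)}"
      unfolding crossings_def D by (intro sum.cong arg_cong[of _ _ card]) auto
    then show ?thesis using crossings_intervals(1)[of j l "j + l" "m - j"] by simp
  qed
  have brz: "snd (op_letter z) \<in> carrier (A (fst (op_letter z)))" using op_letter_closed[of z] w assms(1) by simp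
  then have brw: "snd (op_letter (u @ op_letter z # v')) \<in> carrier (A (fst (op_letter (u @ op_letter z # v'))))"
    using w assms by (intro op_letter_closed) auto
  have 1: "block n p l j (sp 0 (u @ z @ v' @ v)) = sp (0 + int l * (p - 1) + (int l - 1) * word_deg u) (u @ op_letter z # v' @ v)"
    using w assms by (intro M_block_sp) auto
  have 2: "block (n - l) (p + int l - 1) m 0 (sp c ([] @ (u @ op_letter z # v') @ v))
    = sp (c + int m * (p + int l - 1 - 1) + (int m - 1) * word_deg ([] :: (int \<times> 'a) list)) ([] @ op_letter (u @ op_letter z # v') # v)" for c
    using w assms brz by (intro M_block_sp) auto
  have "set_face n p ?S x = block n p l j x" for x using assms by (intro set_face_block) auto
  moreover have "set_face (n - l) (p + int l - 1) {0..<0 + m} x = block (n - l) (p + int l - 1) m 0 x" for x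
    using assms by (intro set_face_block) auto
  ultimately have "face_term n p {..<l + m} ?S (sp 0 (u @ z @ v' @ v))
    = pm (T (n - (l + m) + 1) (p + int (l + m) - 2)) (int (l * (m - j)) + 1)
        (sp (int l * (p - 1) + (int l - 1) * word_deg u + int m * (p + int l - 2)) (op_letter (u @ op_letter z # v') # v))"
    unfolding face_term_def sq cr using 1 2 by simp
  also have "\<dots> = sp (int (l * (m - j)) + 1 + (int l * (p - 1) + (int l - 1) * word_deg u + int m * (p + int l - 2)))
        (op_letter (u @ op_letter z # v') # v)"
    using w assms brw by (intro pm_sp) auto
  finally show ?thesis .
qed

text \<open>The proper subintervals $\{t-1,\dots,t-2+k-m\}$ of the initial interval correspond to the summands
  of the $A_\infty$-relation for $\pi_{k-1}$, in which $\pi_{k-m-1}$ is inserted at the position \<open>t\<close>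
  of $\pi_{m-1}$; all other subsets contribute zero.\<close>

lemma face_relation_initial:
  assumes k: "1 \<le> k" "k \<le> n"
  shows "face_relation n {..<k}"
proof -
  have val: "valid_index n {..<k}" using k by (auto simp: valid_index_def lessThan_empty_iff)
  let ?P = "{S. S \<subset> {..<k} \<and> S \<noteq> {}}"
  let ?Y = "\<lambda>p. T (n - k + 1) (p + int k - 2)"
  have words: "bd (n - k + 1) (p + int k - 1) (set_face n p {..<k} (sp 0 w))
      \<oplus>\<^bsub>?Y p\<^esub> set_face n (p - 1) {..<k} (bd (n + 1) p (sp 0 w))
    = (\<Oplus>\<^bsub>?Y p\<^esub>S\<in>?P. face_term n p {..<k} S (sp 0 w))"
    if w: "letters w" "length w = n + 1" "word_deg w = p" for p w
  proof -
    interpret Y: module K "?Y p" by (rule T_module)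
    define y v where "y = take (k + 1) w" and "v = drop (k + 1) w"
    have yv: "w = y @ v" "length y = k + 1" "length v = n - k" using w k by (auto simp: y_def v_def)
    have l: "letters y" "letters v" "word_deg y + word_deg v = p" using w yv(1) by auto
    let ?q = "word_deg y" and ?c = "int k * (p - 1)"
    let ?A = "A (?q + int k - 2)"
    interpret Aq: module K ?A by (rule graded_module)
    define L where "L a = sp ?c ((?q + int k - 2, a) # v)" for a
    have L: "L \<in> lin_maps K ?A (?Y p)"
      unfolding L_def[abs_def] using sp_slot[of "[]" v "n - k + 1" "?q + int k - 2" "p + int k - 2" ?c] l yv by simp
    let ?op = "\<lambda>m t. \<pi> (m - 1) (?q + int (k - m - 1))
        (tensor_insert K A (t - 1) (k - m + 1) (m + 1 - t) (int (k - m - 1)) (\<pi> (k - m - 1)) ?q (sp 0 y))"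
    let ?e = "\<lambda>m t. int t * (int k - int m) + int k + 1"
    let ?M = "{1..k - 1}" and ?R = "\<lambda>m. {1..m + 1}"
    have op: "?op m t \<in> carrier ?A"
      "L (pm ?A (?e m t) (?op m t)) = face_term n p {..<k} {t - 1..<t - 1 + (k - m)} (sp 0 w)"
      if mt: "m \<in> ?M" "t \<in> ?R m" for m t
    proof -
      define r j where "r = k - m" and "j = t - 1"
      have rj: "1 \<le> r" "1 \<le> m" "j \<le> m" "k = r + m" "t = j + 1" using mt k by (auto simp: r_def j_def)
      have "length y = j + (r + 1) + (m - j)" using yv rj by simp
      then obtain u z v' where y: "y = u @ z @ v'" "length u = j" "length z = r + 1" "length v' = m - j"
        by (rule word_split3)
      have lu: "letters u" "letters z" "letters v'" using l(1) y(1) by auto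
      have brz: "snd (op_letter z) \<in> carrier (A (fst (op_letter z)))" using op_letter_closed[of z] lu y rj by simp
      let ?y = "u @ op_letter z # v'"
      have y': "letters ?y" "length ?y = m + 1" "word_deg ?y = ?q + int (r - 1)"
        using brz lu y rj by (auto simp: of_nat_diff)
      have "tensor_insert K A j (r + 1) (m - j) (int (r - 1)) (\<pi> (r - 1)) ?q (sp 0 (u @ z @ v'))
        = sp (0 + int (r - 1) * word_deg u)
            (u @ (word_deg z + int (r - 1), \<pi> (r - 1) (word_deg z) (ptens K A z)) # v')"
        using lu y rj pi_lin_arity[OF rj(1)] by (intro tensor_insert_sp) (auto simp: of_nat_diff)
      also have "(word_deg z + int (r - 1), \<pi> (r - 1) (word_deg z) (ptens K A z)) = op_letter z"
        using y rj by (simp add: op_letter_def of_nat_diff add_diff_eq)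
      finally have ins: "tensor_insert K A (t - 1) (k - m + 1) (m + 1 - t) (int (k - m - 1)) (\<pi> (k - m - 1)) ?q (sp 0 y)
        = sp (int (r - 1) * word_deg u) ?y"
        using rj y(1) by simp
      have q: "?q + int (r - 1) + (int m - 1) = ?q + int k - 2" "?q + int (r - 1) + int m - 1 = ?q + int k - 2"
        "k - m - 1 = r - 1" using rj by (auto simp: of_nat_diff)
      have "\<pi> (m - 1) (?q + int (r - 1)) (sp (int (r - 1) * word_deg u) ?y) \<in> carrier (A (?q + int (r - 1) + (int m - 1)))"
        by (intro lin_mapsD(1)[OF pi_lin_arity[OF rj(2)] sp_closed]) (use y' in auto)
      then show c: "?op m t \<in> carrier ?A" unfolding q(3) ins[unfolded q(3)] by (simp only: q)
      have "L (?op m t) = sp (?c + int (r - 1) * word_deg u) (op_letter ?y # v)"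
        unfolding L_def q(3) ins[unfolded q(3)] using sp_pi[OF y'(1,2) rj(2) l(2) y'(3), of ?c "int (r - 1) * word_deg u"] by (simp only: q)
      moreover have "L (pm ?A (?e m t) (?op m t)) = pm (?Y p) (?e m t) (L (?op m t))"
        by (rule lin_pm[OF graded_module T_module L c])
      moreover have "pm (?Y p) (?e m t) (sp (?c + int (r - 1) * word_deg u) (op_letter ?y # v))
        = sp (?e m t + (?c + int (r - 1) * word_deg u)) (op_letter ?y # v)"
        using y' l yv rj op_letter_closed[of ?y] by (intro pm_sp) (auto simp: of_nat_diff)
      moreover have "\<dots> = sp (int (r * (m - j)) + 1 + (int r * (p - 1) + (int r - 1) * word_deg u + int m * (p + int r - 2))) (op_letter ?y # v)"
        using rj by (intro sp_parity) (auto simp: of_nat_diff)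
      moreover have "face_term n p {..<r + m} {j..<j + r} (sp 0 (u @ z @ v' @ v))
        = sp (int (r * (m - j)) + 1 + (int r * (p - 1) + (int r - 1) * word_deg u + int m * (p + int r - 2))) (op_letter ?y # v)"
        using rj k lu l y yv by (intro face_term_initial) auto
      ultimately show "L (pm ?A (?e m t) (?op m t)) = face_term n p {..<k} {t - 1..<t - 1 + (k - m)} (sp 0 w)"
        using rj y(1) yv(1) by simp
    qed
    let ?h = "\<lambda>z. {snd z - 1..<snd z - 1 + (k - fst z)}"
    have hP: "?h z \<in> ?P" if "z \<in> Sigma ?M ?R" for z
    proof -
      obtain m t where z: "z = (m, t)" "1 \<le> m" "m \<le> k - 1" "1 \<le> t" "t \<le> m + 1" using \<open>z \<in> Sigma ?M ?R\<close> by auto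
      have "card (?h z) < card {..<k}" using z k by simp
      then have "?h z \<noteq> {..<k}" by (metis less_irrefl)
      moreover have "?h z \<subseteq> {..<k}" "?h z \<noteq> {}" using z k by auto
      ultimately show ?thesis by blast
    qed
    have inj: "inj_on ?h (Sigma ?M ?R)"
    proof (rule inj_onI)
      fix z z' assume z: "z \<in> Sigma ?M ?R" "z' \<in> Sigma ?M ?R" "?h z = ?h z'"
      obtain m t m' t' where mt: "z = (m, t)" "z' = (m', t')" by (metis surj_pair)
      have "m \<in> ?M" "t \<in> ?R m" "m' \<in> ?M" "t' \<in> ?R m'" using z(1,2) unfolding mt by blast+
      then have b: "m < k" "1 \<le> t" "m' < k" "1 \<le> t'" using k by auto
      have "{t - 1..<t - 1 + (k - m)} = {t' - 1..<t' - 1 + (k - m')}" using z(3) unfolding mt by simp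
      then have "t - 1 = t' - 1 \<and> t - 1 + (k - m) = t' - 1 + (k - m')"
        by (rule iffD1[OF atLeastLessThan_eq_iff, rotated 2]) (use b in linarith)+
      then have "m = m'" "t = t'" using b by arith+
      then show "z = z'" by (simp only: mt)
    qed
    have vanish: "face_term n p {..<k} S (sp 0 w) = \<zero>\<^bsub>?Y p\<^esub>" if S: "S \<in> ?P - ?h ` Sigma ?M ?R" for S
    proof -
      have "\<not> interval S"
      proof
        assume "interval S"
        then obtain j where j: "S = {j..<j + card S}" unfolding interval_def by blast
        have fin: "finite S" using S finite_subset[of S "{..<k}"] by auto
        then have c: "1 \<le> card S" "card S < k"
          using S psubset_card_mono[of "{..<k}" S] by (auto simp: Suc_le_eq card_gt_0_iff)
        have "j + card S - 1 \<in> S" using c by (subst j) auto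
        then have "j + card S - 1 < k" using S by auto
        then have M: "(k - card S, j + 1) \<in> Sigma ?M ?R" using c by auto
        have "?h (k - card S, j + 1) = {j..<j + card S}" using c by simp
        then have "S = ?h (k - card S, j + 1)" by (simp only: j[symmetric])
        then have "S \<in> ?h ` Sigma ?M ?R" using M by (rule image_eqI)
        then show False using S by blast
      qed
      moreover have "n \<notin> {..<k}" using k by simp
      ultimately show ?thesis using face_term_vanishes[OF val _ _ _ disjI1, of S p "sp 0 w"] S by simp
    qed
    have ftc: "face_term n p {..<k} S (sp 0 w) \<in> carrier (?Y p)" if "S \<in> ?P" for S
      using face_term_closed[OF val, of S "sp 0 w" p] that w by (simp add: sp_closed)
    have "(\<Oplus>\<^bsub>?Y p\<^esub>S\<in>?P. face_term n p {..<k} S (sp 0 w)) = (\<Oplus>\<^bsub>?Y p\<^esub>S\<in>?h ` Sigma ?M ?R. face_term n p {..<k} S (sp 0 w))"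
    proof (rule Y.M.add.finprod_mono_neutral_cong_right)
      show "finite ?P" by (rule finite_subset[of _ "Pow {..<k}"]) auto
      show "?h ` Sigma ?M ?R \<subseteq> ?P" using hP by (rule image_subsetI)
      show "(\<lambda>S. face_term n p {..<k} S (sp 0 w)) \<in> ?P \<rightarrow> carrier (?Y p)" using ftc by (rule Pi_I)
    qed (rule vanish, assumption, rule refl)
    also have "\<dots> = (\<Oplus>\<^bsub>?Y p\<^esub>z\<in>Sigma ?M ?R. face_term n p {..<k} (?h z) (sp 0 w))"
    proof (rule Y.M.finsum_reindex[OF _ inj])
      show "(\<lambda>S. face_term n p {..<k} S (sp 0 w)) \<in> ?h ` Sigma ?M ?R \<rightarrow> carrier (?Y p)"
        by (intro Pi_I, elim imageE) (simp only:, rule ftc[OF hP])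
    qed
    also have "\<dots> = (\<Oplus>\<^bsub>?Y p\<^esub>m\<in>?M. \<Oplus>\<^bsub>?Y p\<^esub>t\<in>?R m. face_term n p {..<k} {t - 1..<t - 1 + (k - m)} (sp 0 w))"
    proof (rule Y.M.finsum_Sigma[symmetric])
      fix m t assume "m \<in> ?M" "t \<in> ?R m"
      then show "face_term n p {..<k} {t - 1..<t - 1 + (k - m)} (sp 0 w) \<in> carrier (?Y p)"
        using ftc[OF hP[of "(m, t)"]] by simp
    qed auto
    also have "\<dots> = L (\<Oplus>\<^bsub>?A\<^esub>m\<in>?M. \<Oplus>\<^bsub>?A\<^esub>t\<in>?R m. pm ?A (?e m t) (?op m t))"
    proof -
      define X where "X m t = pm ?A (?e m t) (?op m t)" for m t
      define F where "F m t = face_term n p {..<k} {t - 1..<t - 1 + (k - m)} (sp 0 w)" for m t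
      have Xc: "X m t \<in> carrier ?A" if "m \<in> ?M" "t \<in> ?R m" for m t
        unfolding X_def by (rule Aq.pm_closed[OF op(1)[OF that]])
      have LX: "L (X m t) = F m t" if "m \<in> ?M" "t \<in> ?R m" for m t
        unfolding X_def F_def by (rule op(2)[OF that])
      have Fc: "F m t \<in> carrier (?Y p)" if "m \<in> ?M" "t \<in> ?R m" for m t
        unfolding LX[OF that, symmetric] by (rule lin_mapsD(1)[OF L Xc[OF that]])
      have Xs: "(\<Oplus>\<^bsub>?A\<^esub>t\<in>?R m. X m t) \<in> carrier ?A" if "m \<in> ?M" for m
        by (rule Aq.M.finsum_closed, rule Pi_I, rule Xc[OF that])
      have inner: "L (\<Oplus>\<^bsub>?A\<^esub>t\<in>?R m. X m t) = (\<Oplus>\<^bsub>?Y p\<^esub>t\<in>?R m. F m t)" if "m \<in> ?M" for m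
      proof -
        have "L (\<Oplus>\<^bsub>?A\<^esub>t\<in>?R m. X m t) = (\<Oplus>\<^bsub>?Y p\<^esub>t\<in>?R m. L (X m t))"
          by (rule lin_finsum[OF graded_module T_module L Xc[OF that]])
        also have "\<dots> = (\<Oplus>\<^bsub>?Y p\<^esub>t\<in>?R m. F m t)"
          by (rule Y.M.finsum_cong'[OF refl _ LX[OF that]], rule Pi_I, rule Fc[OF that])
        finally show ?thesis .
      qed
      have "L (\<Oplus>\<^bsub>?A\<^esub>m\<in>?M. \<Oplus>\<^bsub>?A\<^esub>t\<in>?R m. X m t) = (\<Oplus>\<^bsub>?Y p\<^esub>m\<in>?M. L (\<Oplus>\<^bsub>?A\<^esub>t\<in>?R m. X m t))"
        by (rule lin_finsum[OF graded_module T_module L Xs])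
      also have "\<dots> = (\<Oplus>\<^bsub>?Y p\<^esub>m\<in>?M. \<Oplus>\<^bsub>?Y p\<^esub>t\<in>?R m. F m t)"
        by (rule Y.M.finsum_cong'[OF refl _ inner], rule Pi_I, rule Y.M.finsum_closed, rule Pi_I, rule Fc)
      finally show ?thesis unfolding X_def F_def by (rule sym)
    qed
    also have "(\<Oplus>\<^bsub>?A\<^esub>m\<in>?M. \<Oplus>\<^bsub>?A\<^esub>t\<in>?R m. pm ?A (?e m t) (?op m t))
      = d (?q + int k - 1) (\<pi> (k - 1) ?q (sp 0 y)) \<oplus>\<^bsub>?A\<^esub> pm ?A (int k) (\<pi> (k - 1) (?q - 1) (bd (k + 1) ?q (sp 0 y)))"
      using pi_rel[OF k(1), of "sp 0 y" ?q] l yv by (simp add: sp_closed)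
    finally show ?thesis
      using boundary_initial_face[OF k l(1,2) yv(2,3) l(3)] yv(1) unfolding L_def by simp
  qed
  have lin1: "(\<lambda>x. bd (n - k + 1) (p + int k - 1) (set_face n p {..<k} x)) \<in> lin_maps K (T (n + 1) p) (?Y p)" for p
    using lin_comp[OF set_face_lin[OF val refl, of p] tensor_diff_lin] by (simp add: diff_diff_eq)
  have "p - 1 + int k - 1 = p + int k - 2" for p :: int by simp
  then have lin2: "(\<lambda>x. set_face n (p - 1) {..<k} (bd (n + 1) p x)) \<in> lin_maps K (T (n + 1) p) (?Y p)" for p
    using lin_comp[OF tensor_diff_lin set_face_lin[OF val refl, of "p - 1"]] by (simp only: card_lessThan)
  have lin3: "(\<lambda>x. \<Oplus>\<^bsub>?Y p\<^esub>S\<in>?P. face_term n p {..<k} S x) \<in> lin_maps K (T (n + 1) p) (?Y p)" for p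
    by (rule lin_finsum_map[OF T_module T_module]) (use face_term_lin[OF val, of _ p] in auto)
  show ?thesis
    unfolding face_relation_def card_lessThan
    by (intro allI ballI tensor_ext_sp[OF T_module lin_add_map[OF T_module lin1 lin2] lin3 words])
qed

lemma face_relation: "valid_index n I \<Longrightarrow> face_relation n I"
proof (induction rule: rot_cyclic_induct)
  case (rot I) then show ?case by (rule face_relation_rot)
next
  case (initial k) then show ?case by (rule face_relation_initial)
next
  case (gap I)
  then have "\<not> interval I" unfolding interval_def by blast
  with gap(1,2) show ?case by (rule face_relation_gap)
qed

end

section \<open>The dihedral module\<close>

lemma strict_sorted_map:
  assumes "sorted_wrt (<) xs" "\<And>x y. x \<in> set xs \<Longrightarrow> y \<in> set xs \<Longrightarrow> x < y \<Longrightarrow> f x < (f y :: nat)"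
  shows "sorted_wrt (<) (map f xs)"
  unfolding sorted_wrt_map by (rule sorted_wrt_mono_rel[OF _ assms(1)]) (rule assms(2))

lemma face_index_valid:
  assumes "face_index n is"
  shows "valid_index n (set is)" "card (set is) = length is" "sorted_wrt (<) is"
proof -
  show s: "sorted_wrt (<) is" using assms by (simp add: face_index_def)
  then show "card (set is) = length is" by (intro distinct_card) (simp add: strict_sorted_iff)
  then show "valid_index n (set is)" using assms by (auto simp: face_index_def valid_index_def)
qed

context A_infinity_algebra
begin

lemma M_face_fc: "sorted_wrt (<) is \<Longrightarrow> M_face K A \<pi> n p is = set_face n p (set is)"
  unfolding set_face_def using strict_sorted_eq[of "is"] by simp

text \<open>The relation for sets, translated back to permutations and splittings.\<close>

lemma M_face_relation:
  assumes idx: "face_index n is" "k = length is" and x: "x \<in> carrier (T (n + 1) m)"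
  shows "bd (n - k + 1) (m + int k - 1) (M_face K A \<pi> n m is x)
      \<oplus>\<^bsub>T (n - k + 1) (m + int k - 2)\<^esub> M_face K A \<pi> n (m - 1) is (bd (n + 1) m x)
    = (\<Oplus>\<^bsub>T (n - k + 1) (m + int k - 2)\<^esub>\<sigma>\<in>{\<sigma>. \<sigma> permutes {..<k}}.
        \<Oplus>\<^bsub>T (n - k + 1) (m + int k - 2)\<^esub>j\<in>hat_splits (hat_tuple (permute_list \<sigma> is)).
          pm (T (n - k + 1) (m + int k - 2)) ((if evenperm \<sigma> then 0 else 1) + 1)
            (M_face K A \<pi> (n - (k - j)) (m + int (k - j) - 1) (take j (hat_tuple (permute_list \<sigma> is)))
              (M_face K A \<pi> n m (drop j (hat_tuple (permute_list \<sigma> is))) x)))"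
proof -
  let ?Y = "T (n - k + 1) (m + int k - 2)" and ?I = "set is"
  note v = face_index_valid[OF idx(1)]
  have c: "card ?I = k" using v(2) idx(2) by simp
  interpret Y: module K ?Y by (rule T_module)
  let ?\<Phi> = "\<lambda>ts ss. M_face K A \<pi> (n - length ss) (m + int (length ss) - 1) ts (M_face K A \<pi> n m ss x)"
  have \<Phi>: "?\<Phi> (map (squeeze S) (sorted_list_of_set (?I - S))) (sorted_list_of_set S)
      = set_face (n - card S) (m + int (card S) - 1) (squeeze S ` (?I - S)) (set_face n m S x)" if "S \<subset> ?I" for S
  proof -
    have fin: "finite S" using that finite_subset by auto
    have "sorted_wrt (<) (map (squeeze S) (sorted_list_of_set (?I - S)))"
      by (rule strict_sorted_map[OF strict_sorted_list_of_set]) (auto intro: squeeze_less)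
    then show ?thesis using fin by (simp add: M_face_fc)
  qed
  have "bd (n - k + 1) (m + int k - 1) (set_face n m ?I x)
      \<oplus>\<^bsub>?Y\<^esub> set_face n (m - 1) ?I (bd (n + 1) m x)
    = (\<Oplus>\<^bsub>?Y\<^esub>S\<in>{S. S \<subset> ?I \<and> S \<noteq> {}}. face_term n m ?I S x)"
    using face_relation[OF v(1)] x unfolding face_relation_def c by blast
  also have "\<dots> = (\<Oplus>\<^bsub>?Y\<^esub>S\<in>{S. S \<subset> ?I \<and> S \<noteq> {}}. pm ?Y (int (crossings S (?I - S)) + 1)
        (?\<Phi> (map (squeeze S) (sorted_list_of_set (?I - S))) (sorted_list_of_set S)))"
  proof (rule Y.M.finsum_cong'[OF refl])
    show "(\<lambda>S. pm ?Y (int (crossings S (?I - S)) + 1)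
        (?\<Phi> (map (squeeze S) (sorted_list_of_set (?I - S))) (sorted_list_of_set S))) \<in> {S. S \<subset> ?I \<and> S \<noteq> {}} \<rightarrow> carrier ?Y"
    proof (rule Pi_I)
      fix S assume S: "S \<in> {S. S \<subset> ?I \<and> S \<noteq> {}}"
      then have "set_face (n - card S) (m + int (card S) - 1) (squeeze S ` (?I - S)) (set_face n m S x) \<in> carrier ?Y"
        using double_face_closed(2)[OF v(1) _ _ x, of S] unfolding c by blast
      then show "pm ?Y (int (crossings S (?I - S)) + 1)
        (?\<Phi> (map (squeeze S) (sorted_list_of_set (?I - S))) (sorted_list_of_set S)) \<in> carrier ?Y"
        using \<Phi>[of S] S by (simp only: mem_Collect_eq Y.pm_closed)
    qed
  next
    fix S assume "S \<in> {S. S \<subset> ?I \<and> S \<noteq> {}}"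
    then show "face_term n m ?I S x = pm ?Y (int (crossings S (?I - S)) + 1)
        (?\<Phi> (map (squeeze S) (sorted_list_of_set (?I - S))) (sorted_list_of_set S))"
      using \<Phi>[of S] unfolding face_term_def c by (simp only: mem_Collect_eq)
  qed
  also have "\<dots> = (\<Oplus>\<^bsub>?Y\<^esub>\<sigma>\<in>{\<sigma>. \<sigma> permutes {..<length is}}. \<Oplus>\<^bsub>?Y\<^esub>j\<in>hat_splits (hat_tuple (permute_list \<sigma> is)).
        pm ?Y ((if evenperm \<sigma> then 0 else 1) + 1)
          (?\<Phi> (take j (hat_tuple (permute_list \<sigma> is))) (drop j (hat_tuple (permute_list \<sigma> is)))))"
  proof (rule Y.finsum_hat_splits[OF v(3), symmetric])
    fix S assume S: "S \<subset> ?I" "S \<noteq> {}"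
    show "?\<Phi> (map (squeeze S) (sorted_list_of_set (?I - S))) (sorted_list_of_set S) \<in> carrier ?Y"
      unfolding \<Phi>[OF S(1)] using double_face_closed(2)[OF v(1) S x] unfolding c .
  qed
  finally show ?thesis
    unfolding M_face_fc[OF v(3)] length_drop length_hat_tuple length_permute_list idx(2)[symmetric] .
qed

lemma M_face_M_t_pos:
  assumes idx: "face_index n is" "k = length is" and "hd is > 0" and x: "x \<in> carrier (T (n + 1) m)"
  shows "M_face K A \<pi> n m is (cyc n m x)
    = cyc (n - k) (m + int k - 1) (M_face K A \<pi> n m (map (\<lambda>i. i - 1) is) x)"
proof -
  note v = face_index_valid[OF idx(1)]
  have pos: "0 < i" if "i \<in> set is" for i
    using that v(3) assms(3) by (cases "is") auto
  have "sorted_wrt (<) (map (\<lambda>i. i - 1) is)"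
    by (rule strict_sorted_map[OF v(3)]) (use pos in fastforce)
  moreover have "set (map (\<lambda>i. i - 1) is) = rot n (set is)"
    unfolding rot_def set_map by (intro image_cong refl) (use pos in auto)
  moreover have "0 \<notin> set is" using pos by blast
  moreover have "k = card (set is)" using v(2) idx(2) by simp
  ultimately show ?thesis
    using set_face_M_t_pos[OF v(1) _ _ x, of k] by (simp only: M_face_fc v(3) simp_thms)
qed

lemma M_face_M_t_zero:
  assumes idx: "face_index n is" "k = length is" and "hd is = 0" and x: "x \<in> carrier (T (n + 1) m)"
  shows "M_face K A \<pi> n m is (cyc n m x)
    = pm (T (n - k + 1) (m + int k - 1)) (int k - 1) (M_face K A \<pi> n m (map (\<lambda>i. i - 1) (tl is) @ [n]) x)"
proof -
  note v = face_index_valid[OF idx(1)]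
  have "is \<noteq> []" using idx(1) by (auto simp: face_index_def)
  then obtain js where js: "is = 0 # js" using assms(3) by (cases "is") auto
  have pos: "0 < i" if "i \<in> set js" for i using that v(3) js by auto
  have le: "i \<le> n" if "i \<in> set js" for i using that idx(1) js by (auto simp: face_index_def)
  have "sorted_wrt (<) js" using v(3) js by simp
  then have "sorted_wrt (<) (map (\<lambda>i. i - 1) js)"
    by (rule strict_sorted_map) (use pos in fastforce)
  then have "sorted_wrt (<) (map (\<lambda>i. i - 1) (tl is) @ [n])"
    using js pos le by (fastforce simp: sorted_wrt_append)
  moreover have "set (map (\<lambda>i. i - 1) (tl is) @ [n]) = rot n (set is)"
  proof -
    have eq: "(\<lambda>i. i - 1) ` set js = (\<lambda>i. if i = 0 then n else i - 1) ` set js"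
      by (intro image_cong refl) (use pos in auto)
    show ?thesis unfolding rot_def js list.set image_insert eq[symmetric] by simp
  qed
  moreover have "0 \<in> set is" using js by simp
  moreover have "k = card (set is)" using v(2) idx(2) by simp
  ultimately show ?thesis
    using set_face_M_t_zero[OF v(1) _ _ x, of k] by (simp only: M_face_fc v(3) simp_thms)
qed

end

context signed_involutive_algebra
begin

lemma M_face_M_r:
  assumes idx: "face_index n is" "k = length is" and x: "x \<in> carrier (T (n + 1) m)"
  shows "M_face K A \<pi> n m is (flip n m x)
    = pm (T (n - k + 1) (m + int k - 1)) (int (k * (k - 1) div 2))
        (flip (n - k) (m + int k - 1) (M_face K A \<pi> n m (map (\<lambda>i. n - i) (rev is)) x))"
proof -
  note v = face_index_valid[OF idx(1)]
  have le: "i \<le> n" if "i \<in> set is" for i using that idx(1) by (auto simp: face_index_def)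
  have "sorted_wrt (\<lambda>x y. n - y < n - x) is"
    by (rule sorted_wrt_mono_rel[OF _ v(3)]) (use le in \<open>fastforce intro: diff_less_mono2\<close>)
  then have "sorted_wrt (<) (map (\<lambda>i. n - i) (rev is))"
    by (simp add: sorted_wrt_map sorted_wrt_rev)
  moreover have "set (map (\<lambda>i. n - i) (rev is)) = refl_index n (set is)"
    by (simp add: refl_index_def)
  ultimately show ?thesis
    using set_face_M_r[OF v(1) x] v(2) idx(2) by (simp only: M_face_fc v(3))
qed

theorem dihedral_module:
  "dihedral_infinity_simplicial_module K (M_obj K A) (cyc) (flip) (M_d K A d) (M_face K A \<pi>)"
proof -
  have X: "M_obj K A = (\<lambda>n m. T (n + 1) m)" by (simp add: M_obj_def fun_eq_iff)
  have D: "M_d K A d = (\<lambda>n m. bd (n + 1) m)" by (simp add: M_d_def fun_eq_iff)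
  show ?thesis
    unfolding X D
  proof (intro dihedral_infinity_simplicial_module.intro infinity_simplicial_module.intro
      dihedral_infinity_simplicial_module_axioms.intro)
    show "differential_module K (\<lambda>m. T (n + 1) m) (\<lambda>m. bd (n + 1) m)" for n
      by (rule tensor_power_differential_module)
    show "M_face K A \<pi> n m is \<in> lin_maps K (T (n + 1) m) (T (n - k + 1) (m + int k - 1))"
      if "face_index n is" "k = length is" for n m "is" k
      using set_face_lin[OF face_index_valid(1)[OF that(1)], of k m] face_index_valid(2,3)[OF that(1)] that(2)
      by (simp only: M_face_fc)
  qed (use M_face_relation M_t_lin M_r_lin M_t_cyclic M_r_involution M_r_M_t tensor_diff_M_t tensor_diff_M_r
      M_face_M_t_pos M_face_M_t_zero M_face_M_r in \<open>simp_all only:\<close>)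
qed

end

theorem theorem2p1:
  fixes K :: "('k, 'e) ring_scheme" and A :: "int \<Rightarrow> ('k, 'a) module"
    and d :: "int \<Rightarrow> 'a \<Rightarrow> 'a"
    and \<pi> :: "nat \<Rightarrow> int \<Rightarrow> ((int \<times> 'a) list \<Rightarrow> 'k) set \<Rightarrow> 'a"
    and star :: "int \<Rightarrow> 'a \<Rightarrow> 'a" and \<rho> :: 'k
  assumes "cring K"
    and "involutive_A_infinity_algebra K A d \<pi> star"
    and "\<rho> \<in> {\<one>\<^bsub>K\<^esub>, \<ominus>\<^bsub>K\<^esub> \<one>\<^bsub>K\<^esub>}"
  shows "dihedral_infinity_simplicial_module K (M_obj K A)
    (M_t K A) (M_r K A star \<rho>) (M_d K A d) (M_face K A \<pi>)"
  using assms(2,3)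
  by (intro signed_involutive_algebra.dihedral_module signed_involutive_algebra.intro
      signed_involutive_algebra_axioms.intro)

end
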